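(* Let $\Omega\subset\mathbb{C}^n$ be a bounded pseudoconvex domain with $C^2$ boundary. Let $r=\sup_{z\in\Omega}|z|$. For $p\in b\Omega$, define $$\mathcal{N}_p(\Omega)=\left\{\tau\in T^{1,0}_p(b\Omega): i\partial\bar\partial\tilde\delta_\Omega(\tau,\bar\theta)|_p=0\text{ for all }\theta\in T_p^{1,0}(b\Omega)\right\}$$ and $$A=\sup_{\{p\in b\Omega:\ \mathcal{N}_p(\Omega)\neq\{0\}\}}\ \sup_{\tau\in\mathcal{N}_p(\Omega)\setminus\{0\}}\frac{|\alpha_\Omega(\tau)|}{|\tau|},$$ unless $\Omega$ is strictly pseudoconvex, in which case $A=0$. Then $$DF_{C^2}(\Omega)\geq\frac{1}{1+4\sqrt{2}\,A\,r}.$$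
   Context: $\delta_\Omega(z)=\operatorname{dist}(z,b\Omega)$; the signed distance function is $\tilde\delta_\Omega=\delta_\Omega$ outside $\Omega$ and $\tilde\delta_\Omega=-\delta_\Omega$ on $\Omega$; it is $C^2$ near $b\Omega$. $DF_{C^2}(\Omega)$ is the supremum over all exponents $0<\eta<1$ such that there exists $\rho_\eta\in C^2(\overline\Omega)$ satisfying $-c\,\delta_\Omega\leq\rho_\eta\leq-\delta_\Omega$ on $\overline\Omega$ for some $c>1$ and such that $-(-\rho_\eta)^\eta$ is plurisubharmonic on $\Omega$ (and $DF_{C^2}(\Omega)=0$ if no such function exists). For $X=\sum_jX_j\frac{\partial}{\partial z_j}$ and $Y=\sum_kY_k\frac{\partial}{\partial z_k}$, $i\partial\bar\partial f(X,\bar Y)=\sum_{j,k}\frac{\partial^2f}{\partial z_j\partial\bar z_k}X_j\bar Y_k$. With $\omega=\frac i2\partial\bar\partial|z|^2$, the Hermitian inner product on $T^{1,0}$ is $\langle X,Y\rangle=\omega(X,\bar Y)$, so $|X|^2=\frac12\sum_j|X_j|^2$. $T^{1,0}_p(b\Omega)$ is the space of $(1,0)$-vectors $\tau$ at $p\in b\Omega$ with $\partial\tilde\delta_\Omega(\tau)=0$. $\alpha_\Omega$ is the real one-form, defined near $b\Omega$, $$\alpha_\Omega=4\sum_{j=1}^n\operatorname{Re}\left(\frac{\partial\tilde\delta_\Omega}{\partial\bar z_j}\bar\partial\left(\frac{\partial\tilde\delta_\Omega}{\partial z_j}\right)\right).$$ *)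

theory Defs
  imports "HOL-Analysis.Analysis"
begin

section \<open>Twice continuously differentiable functions\<close>

definition C1_on :: "'a::real_normed_vector set \<Rightarrow> ('a \<Rightarrow> 'b::real_normed_vector) \<Rightarrow> bool" where
  "C1_on S f \<longleftrightarrow>
     (\<exists>f' :: 'a \<Rightarrow> 'a \<Rightarrow>\<^sub>L 'b.
        (\<forall>x\<in>S. (f has_derivative blinfun_apply (f' x)) (at x)) \<and> continuous_on S f')"

definition C2_on :: "'a::real_normed_vector set \<Rightarrow> ('a \<Rightarrow> 'b::real_normed_vector) \<Rightarrow> bool" where
  "C2_on S f \<longleftrightarrow>
     (\<exists>f' :: 'a \<Rightarrow> 'a \<Rightarrow>\<^sub>L 'b.
        (\<forall>x\<in>S. (f has_derivative blinfun_apply (f' x)) (at x)) \<and> C1_on S f')"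

text \<open>A function belongs to \<open>C\<^sup>2\<close> of a closed set if it is the restriction of a \<open>C\<^sup>2\<close> function
  defined on an open neighbourhood.\<close>

definition C2_on_closed :: "'a::real_normed_vector set \<Rightarrow> ('a \<Rightarrow> 'b::real_normed_vector) \<Rightarrow> bool" where
  "C2_on_closed K f \<longleftrightarrow>
     (\<exists>U g. open U \<and> K \<subseteq> U \<and> C2_on U g \<and> (\<forall>x\<in>K. f x = g x))"

text \<open>Because the differential of the local defining function vanishes nowhere on \<open>U\<close>, the last
  condition also forces the boundary to be the zero set of \<open>\<rho>\<close> in \<open>U\<close>.\<close>

definition C2_boundary :: "'a::real_normed_vector set \<Rightarrow> bool" where
  "C2_boundary \<Omega> \<longleftrightarrow>
     (\<forall>p\<in>frontier \<Omega>. \<exists>U. \<exists>\<rho> :: 'a \<Rightarrow> real.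
        open U \<and> p \<in> U \<and> C2_on U \<rho> \<and>
        (\<forall>z\<in>U. frechet_derivative \<rho> (at z) \<noteq> (\<lambda>v. 0)) \<and>
        \<Omega> \<inter> U = {z\<in>U. \<rho> z < 0})"

section \<open>Wirtinger derivatives and the complex Hessian\<close>

definition dz :: "'n::finite \<Rightarrow> (complex^'n \<Rightarrow> complex) \<Rightarrow> complex^'n \<Rightarrow> complex" where
  "dz j f z = (frechet_derivative f (at z) (axis j 1)
               - \<i> * frechet_derivative f (at z) (axis j \<i>)) / 2"

definition dzbar :: "'n::finite \<Rightarrow> (complex^'n \<Rightarrow> complex) \<Rightarrow> complex^'n \<Rightarrow> complex" where
  "dzbar j f z = (frechet_derivative f (at z) (axis j 1)
                  + \<i> * frechet_derivative f (at z) (axis j \<i>)) / 2"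

text \<open>Throughout, a \<open>(1,0)\<close>-vector is represented by the vector of its coefficients with respect to
  \<open>\<partial>/\<partial>z\<^sub>1, \<dots>, \<partial>/\<partial>z\<^sub>n\<close>.  The following is \<open>i\<partial>\<partial>\<close>-bar \<open>f (X, cnj Y)\<close> at the point \<open>z\<close>.\<close>

definition complex_hessian ::
    "(complex^'n::finite \<Rightarrow> complex) \<Rightarrow> complex^'n \<Rightarrow> complex^'n \<Rightarrow> complex^'n \<Rightarrow> complex" where
  "complex_hessian f z X Y =
     (\<Sum>j\<in>UNIV. \<Sum>k\<in>UNIV. dzbar k (dz j f) z * X $ j * cnj (Y $ k))"

text \<open>The inner product is the one induced by the Kaehler form \<open>(i/2) \<partial>\<partial>\<close>-bar of \<open>|z|\<^sup>2\<close>, so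
  the length of a \<open>(1,0)\<close>-vector is not the Euclidean norm of its coefficient vector.\<close>

definition hnorm :: "complex^'n::finite \<Rightarrow> real" where
  "hnorm X = sqrt ((\<Sum>j\<in>UNIV. (cmod (X $ j))\<^sup>2) / 2)"

section \<open>Boundary geometry\<close>

definition bdist :: "(complex^'n::finite) set \<Rightarrow> complex^'n \<Rightarrow> real" where
  "bdist \<Omega> z = infdist z (frontier \<Omega>)"

definition signed_dist :: "(complex^'n::finite) set \<Rightarrow> complex^'n \<Rightarrow> real" where
  "signed_dist \<Omega> z = (if z \<in> \<Omega> then - bdist \<Omega> z else bdist \<Omega> z)"

abbreviation sdist :: "(complex^'n::finite) set \<Rightarrow> complex^'n \<Rightarrow> complex" where
  "sdist \<Omega> \<equiv> (\<lambda>z. complex_of_real (signed_dist \<Omega> z))"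

definition T10 :: "(complex^'n::finite) set \<Rightarrow> complex^'n \<Rightarrow> (complex^'n) set" where
  "T10 \<Omega> p = {\<tau>. (\<Sum>j\<in>UNIV. dz j (sdist \<Omega>) p * \<tau> $ j) = 0}"

text \<open>Pseudoconvexity is meant in the sense of Levi, for domains with \<open>C\<^sup>2\<close> boundary.  The Hessian is
  Hermitian there, so taking the real part loses nothing.\<close>

definition pseudoconvex :: "(complex^'n::finite) set \<Rightarrow> bool" where
  "pseudoconvex \<Omega> \<longleftrightarrow>
     (\<forall>p\<in>frontier \<Omega>. \<forall>\<tau>\<in>T10 \<Omega> p. 0 \<le> Re (complex_hessian (sdist \<Omega>) p \<tau> \<tau>))"

definition strictly_pseudoconvex :: "(complex^'n::finite) set \<Rightarrow> bool" where
  "strictly_pseudoconvex \<Omega> \<longleftrightarrow>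
     (\<forall>p\<in>frontier \<Omega>. \<forall>\<tau>\<in>T10 \<Omega> p - {0}. 0 < Re (complex_hessian (sdist \<Omega>) p \<tau> \<tau>))"

definition levi_null :: "(complex^'n::finite) set \<Rightarrow> complex^'n \<Rightarrow> (complex^'n) set" where
  "levi_null \<Omega> p =
     {\<tau>\<in>T10 \<Omega> p. \<forall>\<theta>\<in>T10 \<Omega> p. complex_hessian (sdist \<Omega>) p \<tau> \<theta> = 0}"

text \<open>The real one-form \<open>\<alpha>\<close> at \<open>p\<close>, evaluated on a real tangent vector \<open>v\<close> of \<open>\<complex>\<^sup>n = \<real>\<^sup>2\<^sup>n\<close>; on such a
  vector the form \<open>dz\<^sub>k\<close> takes the value \<open>v\<^sub>k\<close> and its conjugate the value \<open>cnj v\<^sub>k\<close>.\<close>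

definition alpha :: "(complex^'n::finite) set \<Rightarrow> complex^'n \<Rightarrow> complex^'n \<Rightarrow> real" where
  "alpha \<Omega> p v =
     4 * (\<Sum>j\<in>UNIV. Re (dzbar j (sdist \<Omega>) p *
                          (\<Sum>k\<in>UNIV. dzbar k (dz j (sdist \<Omega>)) p * cnj (v $ k))))"

text \<open>The value of the complex-linear extension of a real one-form \<open>\<phi>\<close> on the \<open>(1,0)\<close>-vector with
  coefficients \<open>X\<close>: since \<open>\<partial>/\<partial>z\<^sub>j = (\<partial>/\<partial>x\<^sub>j - i \<partial>/\<partial>y\<^sub>j)/2\<close>, that vector is \<open>(X - i JX)/2\<close>, where \<open>X\<close> is
  now read as a real tangent vector and \<open>J\<close>, the complex structure, multiplies coordinates by \<open>\<i>\<close>.\<close>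

definition on_10 :: "(complex^'n::finite \<Rightarrow> real) \<Rightarrow> complex^'n \<Rightarrow> complex" where
  "on_10 \<phi> X = (complex_of_real (\<phi> X) - \<i> * complex_of_real (\<phi> (\<i> *s X))) / 2"

text \<open>The suprema are taken in the extended reals, so that they need no boundedness proviso.\<close>

definition alpha_sup :: "(complex^'n::finite) set \<Rightarrow> ereal" where
  "alpha_sup \<Omega> =
     (if strictly_pseudoconvex \<Omega> then 0
      else (SUP p\<in>{p\<in>frontier \<Omega>. levi_null \<Omega> p \<noteq> {0}}.
              SUP \<tau>\<in>levi_null \<Omega> p - {0}. ereal (cmod (on_10 (alpha \<Omega> p) \<tau>) / hnorm \<tau>)))"

section \<open>Plurisubharmonic functions and the Diederich--Fornaess index\<close>

text \<open>Upper semicontinuity together with the sub-mean value inequality on all closed affine discs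
  in \<open>\<Omega>\<close>.  For a real-valued function the circle means exceed a finite number, hence are finite;
  integrability is stated explicitly because the integral of a non-integrable function is \<open>0\<close> by
  convention.\<close>

definition plurisubharmonic_on ::
    "(complex^'n::finite) set \<Rightarrow> (complex^'n \<Rightarrow> real) \<Rightarrow> bool" where
  "plurisubharmonic_on \<Omega> u \<longleftrightarrow>
     (\<forall>a. openin (top_of_set \<Omega>) {z\<in>\<Omega>. u z < a}) \<and>
     (\<forall>z w. (\<forall>\<zeta>\<in>cball 0 1. z + \<zeta> *s w \<in> \<Omega>) \<longrightarrow>
        set_integrable lborel {0..2 * pi} (\<lambda>t. u (z + cis t *s w)) \<and>
        u z \<le> (LINT t:{0..2 * pi}|lborel. u (z + cis t *s w)) / (2 * pi))"

definition DF_exponents :: "(complex^'n::finite) set \<Rightarrow> real set" where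
  "DF_exponents \<Omega> =
     {\<eta>. 0 < \<eta> \<and> \<eta> < 1 \<and>
        (\<exists>\<rho> :: complex^'n \<Rightarrow> real.
           C2_on_closed (closure \<Omega>) \<rho> \<and>
           (\<exists>c>1. \<forall>z\<in>closure \<Omega>. - c * bdist \<Omega> z \<le> \<rho> z \<and> \<rho> z \<le> - bdist \<Omega> z) \<and>
           plurisubharmonic_on \<Omega> (\<lambda>z. - ((- \<rho> z) powr \<eta>)))}"

definition DF_C2 :: "(complex^'n::finite) set \<Rightarrow> real" where
  "DF_C2 \<Omega> = (if DF_exponents \<Omega> = {} then 0 else Sup (DF_exponents \<Omega>))"

end

(*
  Let d be the signed distance and put rho = d exp(-K|z|^2), phi = -log(-rho).  Then -(-rho)^eta is
  plurisubharmonic iff the complex Hessian of phi dominates eta times the square of its differential.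
  Split a vector into a complex tangential part tau and a complex normal part and complete the square
  in the normal part.  With L four times the complex Hessian of d, and beta = 4 |alpha(tau)|: since the
  gradient of d is constant along normals, L at distance t inside the boundary exceeds L at the foot
  point by at least t beta^2, up to O(t^2), on tau.  This absorbs the mixed term, and it suffices that
     4K|tau|^2 > eta/(1-eta) (beta + 2Kr|tau|)^2   (Euclidean |tau|).
  Directions that are not nearly Levi-null are harmless by compactness, and on the null directions
  beta is at most 2 sqrt 2 A |tau|.  The choice 2Kr = 2 sqrt 2 A is optimal and gives exactly
  eta (1 + 4 sqrt 2 A r) < 1.  Far from the boundary phi is replaced by a convex nondecreasing function
  of phi with slope at most 1 that is constant there.
*)
theory Submission
  imports Defs
begin

section \<open>Functions with a gradient and a continuous Hessian\<close>

text \<open>The signed distance is only \<open>C2\<close>, so its Levi form has no Taylor expansion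
  along a normal. It is replaced by the exact relation \<open>H z = H p + d H p (H z)\<close>
  between a point at depth \<open>d\<close> and its foot point \<open>p\<close>, which needs second
  derivatives only. Pseudoconvexity is thus used on the boundary alone.

  Let \<open>b\<close> be the mixed entry of the form, \<open>x\<close> the normal component divided
  by \<open>d\<close>, and \<open>y\<close> what \<open>|z|^2\<close> adds to the differential. The
  square of the gradient, the cross term and the gain of order \<open>d\<close> add up to
  \<open>(x + b)^2\<close>; its excess over \<open>\<eta> (x + y)^2\<close> has minimum
  \<open>-q (b - y)^2\<close>, \<open>q = \<eta> / (1 - \<eta>)\<close>. With
  \<open>|b| \<le> a |\<tau>|\<close>, \<open>|y| \<le> s |\<tau>|\<close>,
  \<open>s = 2 K r\<close>, the requirement is \<open>2 s / r > q (a + s)^2\<close>. The quotient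
  \<open>(a + s)^2 / s\<close> is least at \<open>s = a\<close>, giving
  \<open>1 / q > 2 a r\<close>. For \<open>a = 0\<close> this would make \<open>K\<close> vanish, so
  \<open>s\<close> is taken strictly above \<open>a\<close>; the gap also pays for nearly null
  directions, and an exponent slightly above \<open>\<eta>\<close> pays for errors of order
  \<open>d\<close>.\<close>

definition has_jet :: "'a::euclidean_space set \<Rightarrow> ('a \<Rightarrow> real) \<Rightarrow> ('a \<Rightarrow> 'a) \<Rightarrow> ('a \<Rightarrow> 'a \<Rightarrow> 'a) \<Rightarrow> bool" where
  "has_jet V f g H \<longleftrightarrow> open V \<and>
     (\<forall>x\<in>V. (f has_derivative (\<lambda>v. g x \<bullet> v)) (at x)) \<and>
     (\<forall>x\<in>V. (g has_derivative H x) (at x)) \<and>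
     (\<forall>v. continuous_on V (\<lambda>x. H x v))"

definition grad :: "('a::euclidean_space \<Rightarrow> real) \<Rightarrow> 'a \<Rightarrow> 'a" where
  "grad f x = (\<Sum>b\<in>Basis. frechet_derivative f (at x) b *\<^sub>R b)"

definition hess :: "('a::euclidean_space \<Rightarrow> real) \<Rightarrow> 'a \<Rightarrow> 'a \<Rightarrow> 'a" where
  "hess f x = frechet_derivative (grad f) (at x)"

lemma has_jetD:
  assumes "has_jet V f g H"
  shows "open V" "\<And>x. x \<in> V \<Longrightarrow> (f has_derivative (\<lambda>v. g x \<bullet> v)) (at x)"
    "\<And>x. x \<in> V \<Longrightarrow> (g has_derivative H x) (at x)" "\<And>v. continuous_on V (\<lambda>x. H x v)"
  using assms unfolding has_jet_def by auto

lemma has_jet_linear: "has_jet V f g H \<Longrightarrow> x \<in> V \<Longrightarrow> linear (H x)"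
  using has_derivative_linear has_jetD(3) by blast

lemma has_jet_continuous_on:
  assumes "has_jet V f g H"
  shows "continuous_on V f" "continuous_on V g"
  using has_jetD[OF assms] by (meson continuous_at_imp_continuous_on has_derivative_continuous)+

text \<open>\<open>has_jet\<close> asks for continuity of the Hessian only in each fixed direction.
  Expanding the direction in the finite basis gives joint continuity, which the integrals over
  circles and the compactness arguments need.\<close>

lemma continuous_on_hess_app:
  fixes h :: "'b::topological_space \<Rightarrow> 'a::euclidean_space"
  assumes J: "has_jet V f g H" and "continuous_on S a" "continuous_on S h" "a ` S \<subseteq> V"
  shows "continuous_on S (\<lambda>s. H (a s) (h s))"
proof -
  have "H (a s) (h s) = (\<Sum>b\<in>Basis. (h s \<bullet> b) *\<^sub>R H (a s) b)" if "s \<in> S" for s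
  proof -
    have lin: "linear (H (a s))" using has_jet_linear[OF J] assms(4) that by blast
    have "H (a s) (h s) = H (a s) (\<Sum>b\<in>Basis. (h s \<bullet> b) *\<^sub>R b)" by (simp add: euclidean_representation)
    then show ?thesis by (simp add: linear_sum[OF lin] linear_cmul[OF lin])
  qed
  moreover have "continuous_on S (\<lambda>s. \<Sum>b\<in>Basis. (h s \<bullet> b) *\<^sub>R H (a s) b)"
    by (intro continuous_intros assms continuous_on_compose2[OF has_jetD(4)[OF J]])
  ultimately show ?thesis by (simp cong: continuous_on_cong_simp)
qed

lemma has_jet_unique:
  assumes "has_jet V f g H" "x \<in> V"
  shows "grad f x = g x" "hess f x = H x"
proof -
  have *: "grad f y = g y" if "y \<in> V" for y
  proof -
    have "frechet_derivative f (at y) = (\<lambda>v. g y \<bullet> v)"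
      using has_jetD(2)[OF assms(1) that] frechet_derivative_at by metis
    then show ?thesis by (simp add: grad_def euclidean_representation)
  qed
  then show "grad f x = g x" using assms by blast
  have "(grad f has_derivative H x) (at x)"
    by (rule has_derivative_transform_within_open[OF has_jetD(3)[OF assms] has_jetD(1)[OF assms(1)] assms(2)])
      (simp add: *)
  then show "hess f x = H x" unfolding hess_def using frechet_derivative_at by metis
qed

lemma has_jet_cong:
  assumes "has_jet V f g H" "\<And>x. x \<in> V \<Longrightarrow> f' x = f x" "\<And>x. x \<in> V \<Longrightarrow> g' x = g x"
    "\<And>x. x \<in> V \<Longrightarrow> H' x = H x"
  shows "has_jet V f' g' H'"
proof -
  note J = has_jetD[OF assms(1)]
  have "(f' has_derivative (\<lambda>v. g' x \<bullet> v)) (at x)" if "x \<in> V" for x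
    unfolding assms(3)[OF that]
    by (rule has_derivative_transform_within_open[OF J(2)[OF that] J(1) that]) (simp add: assms)
  moreover have "(g' has_derivative H' x) (at x)" if "x \<in> V" for x
    unfolding assms(4)[OF that]
    by (rule has_derivative_transform_within_open[OF J(3)[OF that] J(1) that]) (simp add: assms)
  moreover have "continuous_on V (\<lambda>x. H' x v)" for v
    using J(4)[of v] by (simp add: assms(4) cong: continuous_on_cong)
  ultimately show ?thesis using J(1) by (simp add: has_jet_def)
qed

lemma has_jet_canonical: "has_jet V f g H \<Longrightarrow> has_jet V f (grad f) (hess f)"
  by (rule has_jet_cong) (auto simp: has_jet_unique)

lemma has_jet_subset: "has_jet V f g H \<Longrightarrow> open W \<Longrightarrow> W \<subseteq> V \<Longrightarrow> has_jet W f g H"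
  unfolding has_jet_def by (meson continuous_on_subset subsetD)

text \<open>\<open>grad f\<close> and \<open>hess f\<close> depend on \<open>f\<close> alone, so
  jets given near different points agree on overlaps and having a jet becomes a local property. This
  allows a defining function to be pieced together from several formulas.\<close>

lemma has_jet_glue:
  assumes "\<And>x. x \<in> U \<Longrightarrow> \<exists>V g H. x \<in> V \<and> has_jet V f g H" "open U"
  shows "has_jet U f (grad f) (hess f)"
proof -
  have *: "\<exists>V. x \<in> V \<and> has_jet V f (grad f) (hess f)" if "x \<in> U" for x
    using assms(1)[OF that] has_jet_canonical by blast
  have "continuous_on U (\<lambda>x. hess f x v)" for v
  proof (rule continuous_at_imp_continuous_on, rule ballI)
    fix x assume "x \<in> U"
    then obtain V where "x \<in> V" "has_jet V f (grad f) (hess f)" using * by blast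
    then show "isCont (\<lambda>x. hess f x v) x"
      using has_jetD(1,4) continuous_on_eq_continuous_at by blast
  qed
  then show ?thesis unfolding has_jet_def using assms(2) * has_jetD(2,3) by blast
qed

lemma has_jet_C2_on:
  assumes J: "has_jet V f g H"
  shows "C2_on V f"
proof -
  have bl: "bounded_linear (H x)" if "x \<in> V" for x
    using has_jetD(3)[OF J that] has_derivative_bounded_linear by blast

  \<comment> \<open>The operator-valued first derivative is the Riesz image of the gradient; its
    derivative is therefore the Riesz map after the Hessian.\<close>
  have app: "blinfun_apply (Blinfun blinfun_inner_right o\<^sub>L Blinfun (H x)) v = blinfun_inner_right (H x v)"
    if "x \<in> V" for x v
    by (simp add: bounded_linear_Blinfun_apply[OF bl[OF that]]
        bounded_linear_Blinfun_apply[OF bounded_linear_blinfun_inner_right])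
  have "C1_on V (\<lambda>x. blinfun_inner_right (g x))"
    unfolding C1_on_def
  proof (intro exI conjI ballI)
    fix x assume x: "x \<in> V"
    have "((\<lambda>x. blinfun_inner_right (g x)) has_derivative (\<lambda>v. blinfun_inner_right (H x v))) (at x)"
      by (rule bounded_linear.has_derivative[OF bounded_linear_blinfun_inner_right has_jetD(3)[OF J x]])
    then show "((\<lambda>x. blinfun_inner_right (g x)) has_derivative
        blinfun_apply (Blinfun blinfun_inner_right o\<^sub>L Blinfun (H x))) (at x)"
      using app[OF x] by (simp add: fun_eq_iff has_derivative_eq_rhs)
  next
    show "continuous_on V (\<lambda>x. Blinfun blinfun_inner_right o\<^sub>L Blinfun (H x))"
    proof (rule continuous_on_blinfun_componentwise)
      fix i :: 'a
      have "continuous_on V (\<lambda>x. blinfun_inner_right (H x i))"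
        by (rule bounded_linear.continuous_on[OF bounded_linear_blinfun_inner_right has_jetD(4)[OF J]])
      then show "continuous_on V (\<lambda>x. blinfun_apply (Blinfun blinfun_inner_right o\<^sub>L Blinfun (H x)) i)"
        using app by (simp cong: continuous_on_cong)
    qed
  qed
  then show ?thesis unfolding C2_on_def
    by (intro exI[of _ "\<lambda>x. blinfun_inner_right (g x)"]) (auto simp: has_jetD[OF J])
qed

lemma C2_on_has_jet:
  assumes "C2_on V f" "open V"
  shows "has_jet V f (grad f) (hess f)"
proof -
  obtain f' f'' where f': "\<And>x. x \<in> V \<Longrightarrow> (f has_derivative blinfun_apply (f' x)) (at x)"
    and f'': "\<And>x. x \<in> V \<Longrightarrow> (f' has_derivative blinfun_apply (f'' x)) (at x)" "continuous_on V f''"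
    using assms(1) unfolding C2_on_def C1_on_def by metis
  define g where "g x = (\<Sum>b\<in>Basis. blinfun_apply (f' x) b *\<^sub>R b)" for x
  define H where "H x v = (\<Sum>b\<in>Basis. blinfun_apply (blinfun_apply (f'' x) v) b *\<^sub>R b)" for x v
  have "has_jet V f g H"
    unfolding has_jet_def
  proof (intro conjI ballI allI assms)
    fix x assume x: "x \<in> V"
    have "blinfun_apply (f' x) v = g x \<bullet> v" for v
    proof -
      have "blinfun_apply (f' x) v = blinfun_apply (f' x) (\<Sum>b\<in>Basis. (v \<bullet> b) *\<^sub>R b)"
        by (simp add: euclidean_representation)
      also have "\<dots> = g x \<bullet> v"
        by (simp add: blinfun.sum_right blinfun.scaleR_right g_def inner_sum_right inner_commute[of _ v] mult.commute)
      finally show ?thesis .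
    qed
    then show "(f has_derivative (\<lambda>v. g x \<bullet> v)) (at x)" using f'[OF x] by (metis (no_types, lifting) ext)
    have "((\<lambda>x. blinfun_apply (f' x) b) has_derivative (\<lambda>v. blinfun_apply (blinfun_apply (f'' x) v) b)) (at x)" for b
      using bounded_linear.has_derivative[OF blinfun.bounded_linear_left f''(1)[OF x]] .
    then show "(g has_derivative H x) (at x)"
      unfolding g_def[abs_def] H_def[abs_def]
      by (intro has_derivative_sum has_derivative_scaleR_left)
  next
    fix v
    show "continuous_on V (\<lambda>x. H x v)"
      unfolding H_def by (intro continuous_intros f''(2))
  qed
  then show ?thesis by (rule has_jet_canonical)
qed

text \<open>The second difference of \<open>f\<close> over a parallelogram of size \<open>h\<close>
  is \<open>h^2\<close> times a nearby mixed value of the Hessian, by the mean value theorem in one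
  direction and then in the other. Reading the same difference in both orders and shrinking
  \<open>h\<close> identifies the two mixed values at \<open>x\<close>.\<close>

lemma has_jet_symmetric:
  assumes J: "has_jet V f g H" and x: "x \<in> V"
  shows "H x u \<bullet> v = u \<bullet> H x v"
proof -
  obtain e0 where e0: "e0 > 0" "ball x e0 \<subseteq> V" using has_jetD(1)[OF J] x open_contains_ball by blast
  \<comment> \<open>Scaled so that every parallelogram with sides shorter than \<open>e u\<close>
    and \<open>e v\<close> stays in the ball.\<close>
  define e where "e = e0 / (1 + norm u + norm v)"
  have epos: "e > 0" unfolding e_def using e0 by (simp add: add_pos_nonneg)
  have inV: "x + s *\<^sub>R u + t *\<^sub>R v \<in> V" if "0 \<le> s" "s < e" "0 \<le> t" "t < e" for s t
  proof -
    have "norm (s *\<^sub>R u + t *\<^sub>R v) \<le> s * norm u + t * norm v"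
      using that norm_triangle_ineq[of "s *\<^sub>R u" "t *\<^sub>R v"] by simp
    also have "\<dots> \<le> e * norm u + e * norm v"
      using that by (intro add_mono mult_right_mono) auto
    also have "\<dots> < e * (1 + norm u + norm v)" using epos by (simp add: algebra_simps)
    also have "\<dots> = e0" unfolding e_def using add_pos_nonneg[of 1 "norm u + norm v"] by simp
    finally have "dist x (x + s *\<^sub>R u + t *\<^sub>R v) < e0" by (simp add: dist_norm norm_minus_commute add.assoc add.commute)
    then show ?thesis using e0 by auto
  qed
  have key: "\<exists>s t. 0 \<le> s \<and> s \<le> h \<and> 0 \<le> t \<and> t \<le> h \<and>
      f (x + h *\<^sub>R a + h *\<^sub>R b) - f (x + h *\<^sub>R a) - f (x + h *\<^sub>R b) + f x = h * h * (H (x + s *\<^sub>R a + t *\<^sub>R b) b \<bullet> a)"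
    if h: "0 < h" "h < e" and V: "\<And>s t. 0 \<le> s \<Longrightarrow> s < e \<Longrightarrow> 0 \<le> t \<Longrightarrow> t < e \<Longrightarrow> x + s *\<^sub>R a + t *\<^sub>R b \<in> V"
    for h a b
  proof -
    define F where "F s = f (x + s *\<^sub>R a + h *\<^sub>R b) - f (x + s *\<^sub>R a)" for s
    have dF: "(F has_derivative (\<lambda>d. d * (g (x + s *\<^sub>R a + h *\<^sub>R b) \<bullet> a - g (x + s *\<^sub>R a) \<bullet> a))) (at s within {0..h})"
      if "0 \<le> s" "s \<le> h" for s
    proof -
      have 1: "x + s *\<^sub>R a + h *\<^sub>R b \<in> V" using V[of s h] that h by auto
      have 2: "x + s *\<^sub>R a \<in> V" using V[of s 0] that h by auto
      have "((\<lambda>s. f (x + s *\<^sub>R a + h *\<^sub>R b)) has_derivative (\<lambda>d. g (x + s *\<^sub>R a + h *\<^sub>R b) \<bullet> (d *\<^sub>R a))) (at s within {0..h})"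
        by (rule has_derivative_compose[where g=f and x=s and f="\<lambda>s. x + s *\<^sub>R a + h *\<^sub>R b", OF _ has_jetD(2)[OF J 1]]) (auto intro!: derivative_eq_intros)
      moreover have "((\<lambda>s. f (x + s *\<^sub>R a)) has_derivative (\<lambda>d. g (x + s *\<^sub>R a) \<bullet> (d *\<^sub>R a))) (at s within {0..h})"
        by (rule has_derivative_compose[where g=f and x=s and f="\<lambda>s. x + s *\<^sub>R a", OF _ has_jetD(2)[OF J 2]]) (auto intro!: derivative_eq_intros)
      ultimately show ?thesis unfolding F_def
        by (rule has_derivative_eq_rhs[OF has_derivative_diff]) (simp add: algebra_simps)
    qed
    obtain s where s: "0 < s" "s < h" and
      Fs: "F h - F 0 = h * (g (x + s *\<^sub>R a + h *\<^sub>R b) \<bullet> a - g (x + s *\<^sub>R a) \<bullet> a)"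
      using mvt_simple[OF h(1) dF] by auto
    define G where "G t = g (x + s *\<^sub>R a + t *\<^sub>R b) \<bullet> a" for t
    have dG: "(G has_derivative (\<lambda>d. d * (H (x + s *\<^sub>R a + t *\<^sub>R b) b \<bullet> a))) (at t within {0..h})"
      if "0 \<le> t" "t \<le> h" for t
    proof -
      have 1: "x + s *\<^sub>R a + t *\<^sub>R b \<in> V" using V[of s t] that h s by auto
      have lin: "linear (H (x + s *\<^sub>R a + t *\<^sub>R b))" using has_jet_linear[OF J 1] .
      have "((\<lambda>t. g (x + s *\<^sub>R a + t *\<^sub>R b)) has_derivative (\<lambda>d. H (x + s *\<^sub>R a + t *\<^sub>R b) (d *\<^sub>R b))) (at t within {0..h})"
        by (rule has_derivative_compose[where g=g and x=t and f="\<lambda>t. x + s *\<^sub>R a + t *\<^sub>R b", OF _ has_jetD(3)[OF J 1]]) (auto intro!: derivative_eq_intros)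
      from has_derivative_inner_left[OF this, of a] show ?thesis unfolding G_def
        by (rule has_derivative_eq_rhs) (simp add: linear_cmul[OF lin])
    qed
    obtain t where t: "0 < t" "t < h" and
      Gs: "G h - G 0 = h * (H (x + s *\<^sub>R a + t *\<^sub>R b) b \<bullet> a)"
      using mvt_simple[OF h(1) dG] by auto
    show ?thesis
      by (rule exI[of _ s], rule exI[of _ t]) (use s t Fs Gs in \<open>auto simp: F_def G_def algebra_simps\<close>)
  qed
  have "norm (H x u \<bullet> v - u \<bullet> H x v) \<le> 2 * r" if r: "r > 0" for r
  proof -
    have c: "isCont (\<lambda>y. H y w \<bullet> w') x" for w w'
      using has_jetD(1,4)[OF J] x by (auto intro!: continuous_intros simp: continuous_on_eq_continuous_at)
    obtain d1 where d1: "d1 > 0" "\<And>y. dist y x < d1 \<Longrightarrow> dist (H y u \<bullet> v) (H x u \<bullet> v) < r"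
      using c[of u v] r unfolding continuous_at_eps_delta by blast
    obtain d2 where d2: "d2 > 0" "\<And>y. dist y x < d2 \<Longrightarrow> dist (H y v \<bullet> u) (H x v \<bullet> u) < r"
      using c[of v u] r unfolding continuous_at_eps_delta by blast
    define h where "h = min (e/2) (min d1 d2 / (1 + norm u + norm v))"
    have pos: "0 < 1 + norm u + norm v" by (simp add: add_pos_nonneg)
    have h: "0 < h" "h < e" unfolding h_def using epos d1 d2 pos by auto
    have hd: "dist (x + s *\<^sub>R u + t *\<^sub>R v) x < min d1 d2" if "0 \<le> s" "s \<le> h" "0 \<le> t" "t \<le> h" for s t
    proof -
      have "norm (s *\<^sub>R u + t *\<^sub>R v) \<le> s * norm u + t * norm v"
        using that norm_triangle_ineq[of "s *\<^sub>R u" "t *\<^sub>R v"] by simp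
      also have "\<dots> \<le> h * norm u + h * norm v"
        using that by (intro add_mono mult_right_mono) auto
      also have "\<dots> < h * (1 + norm u + norm v)" using h by (simp add: algebra_simps)
      also have "\<dots> \<le> min d1 d2 / (1 + norm u + norm v) * (1 + norm u + norm v)"
        by (rule mult_right_mono) (use pos in \<open>simp_all add: h_def\<close>)
      also have "\<dots> = min d1 d2" using pos by simp
      finally show ?thesis by (simp add: dist_norm add.assoc)
    qed
    obtain s t where st: "0 \<le> s" "s \<le> h" "0 \<le> t" "t \<le> h"
      and 1: "f (x + h *\<^sub>R u + h *\<^sub>R v) - f (x + h *\<^sub>R u) - f (x + h *\<^sub>R v) + f x = h * h * (H (x + s *\<^sub>R u + t *\<^sub>R v) v \<bullet> u)"
      using key[OF h inV] by auto
    obtain s' t' where st': "0 \<le> s'" "s' \<le> h" "0 \<le> t'" "t' \<le> h"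
      and 2: "f (x + h *\<^sub>R v + h *\<^sub>R u) - f (x + h *\<^sub>R v) - f (x + h *\<^sub>R u) + f x = h * h * (H (x + s' *\<^sub>R v + t' *\<^sub>R u) u \<bullet> v)"
    proof -
      have inV': "x + s *\<^sub>R v + t *\<^sub>R u \<in> V" if "0 \<le> s" "s < e" "0 \<le> t" "t < e" for s t
        using inV[OF that(3,4,1,2)] by (simp add: add_ac)
      have "\<exists>s' t'. 0 \<le> s' \<and> s' \<le> h \<and> 0 \<le> t' \<and> t' \<le> h \<and>
        f (x + h *\<^sub>R v + h *\<^sub>R u) - f (x + h *\<^sub>R v) - f (x + h *\<^sub>R u) + f x = h * h * (H (x + s' *\<^sub>R v + t' *\<^sub>R u) u \<bullet> v)"
        by (rule key[OF h]) (rule inV')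
      then show thesis by (elim exE conjE) (rule that)
    qed
    have "h * h * (H (x + s *\<^sub>R u + t *\<^sub>R v) v \<bullet> u) = h * h * (H (x + s' *\<^sub>R v + t' *\<^sub>R u) u \<bullet> v)"
      using 1 2 by (simp add: algebra_simps)
    then have eq: "H (x + s *\<^sub>R u + t *\<^sub>R v) v \<bullet> u = H (x + t' *\<^sub>R u + s' *\<^sub>R v) u \<bullet> v"
      using h by (simp add: add_ac)
    have "dist (H (x + s *\<^sub>R u + t *\<^sub>R v) v \<bullet> u) (H x v \<bullet> u) < r" using d2(2) hd[OF st] by auto
    moreover have "dist (H (x + t' *\<^sub>R u + s' *\<^sub>R v) u \<bullet> v) (H x u \<bullet> v) < r"
      using d1(2) hd[OF st'(3,4,1,2)] by auto
    ultimately show ?thesis using eq by (simp add: dist_real_def inner_commute)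
  qed
  have "norm (H x u \<bullet> v - u \<bullet> H x v) \<le> 0 + e" if "e > 0" for e 
    using \<open>\<And>r. r > 0 \<Longrightarrow> norm (H x u \<bullet> v - u \<bullet> H x v) \<le> 2 * r\<close>[of "e / 2"] that by simp
  then have "norm (H x u \<bullet> v - u \<bullet> H x v) \<le> 0" by (rule field_le_epsilon)
  then show ?thesis by simp
qed

lemma has_jet_const: "open V \<Longrightarrow> has_jet V (\<lambda>x. c) (\<lambda>x. 0) (\<lambda>x v. 0)"
  by (simp add: has_jet_def)

lemma has_jet_add:
  assumes "has_jet V f g H" "has_jet V f' g' H'"
  shows "has_jet V (\<lambda>x. f x + f' x) (\<lambda>x. g x + g' x) (\<lambda>x v. H x v + H' x v)"
  using has_jetD[OF assms(1)] has_jetD[OF assms(2)] unfolding has_jet_def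
  by (auto simp: inner_add_left[abs_def] intro!: continuous_intros has_derivative_add)

lemma has_jet_mult:
  assumes "has_jet V f g H" "has_jet V f' g' H'"
  shows "has_jet V (\<lambda>x. f x * f' x) (\<lambda>x. f x *\<^sub>R g' x + f' x *\<^sub>R g x)
    (\<lambda>x v. f x *\<^sub>R H' x v + (g x \<bullet> v) *\<^sub>R g' x + f' x *\<^sub>R H x v + (g' x \<bullet> v) *\<^sub>R g x)"
  unfolding has_jet_def
proof (intro conjI ballI allI)
  note J = has_jetD[OF assms(1)] and J' = has_jetD[OF assms(2)]
  note C = has_jet_continuous_on[OF assms(1)] has_jet_continuous_on[OF assms(2)]
  show "open V" by fact
  fix x assume x: "x \<in> V"
  show "((\<lambda>x. f x * f' x) has_derivative (\<lambda>v. (f x *\<^sub>R g' x + f' x *\<^sub>R g x) \<bullet> v)) (at x)"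
    by (rule derivative_eq_intros J(2)[OF x] J'(2)[OF x] refl)+ (simp add: inner_add_left algebra_simps)
  show "((\<lambda>x. f x *\<^sub>R g' x + f' x *\<^sub>R g x) has_derivative
     (\<lambda>v. f x *\<^sub>R H' x v + (g x \<bullet> v) *\<^sub>R g' x + f' x *\<^sub>R H x v + (g' x \<bullet> v) *\<^sub>R g x)) (at x)"
    by (rule derivative_eq_intros J(2)[OF x] J'(2)[OF x] J(3)[OF x] J'(3)[OF x] refl)+ (simp add: add_ac)
next
  note J = has_jetD[OF assms(1)] and J' = has_jetD[OF assms(2)]
  note C = has_jet_continuous_on[OF assms(1)] has_jet_continuous_on[OF assms(2)]
  fix v
  show "continuous_on V (\<lambda>x. f x *\<^sub>R H' x v + (g x \<bullet> v) *\<^sub>R g' x + f' x *\<^sub>R H x v + (g' x \<bullet> v) *\<^sub>R g x)"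
    by (intro continuous_intros C J(4) J'(4))
qed

lemma has_jet_compose:
  assumes "has_jet V f g H" "\<And>x. x \<in> V \<Longrightarrow> f x \<in> I" "open I"
    "\<And>y. y \<in> I \<Longrightarrow> (k has_real_derivative k' y) (at y)"
    "\<And>y. y \<in> I \<Longrightarrow> (k' has_real_derivative k'' y) (at y)" "continuous_on I k''"
  shows "has_jet V (\<lambda>x. k (f x)) (\<lambda>x. k' (f x) *\<^sub>R g x)
    (\<lambda>x v. k' (f x) *\<^sub>R H x v + (k'' (f x) * (g x \<bullet> v)) *\<^sub>R g x)"
  unfolding has_jet_def
proof (intro conjI ballI allI)
  note J = has_jetD[OF assms(1)] and C = has_jet_continuous_on[OF assms(1)]
  show "open V" by fact
  fix x assume x: "x \<in> V"
  have 1: "((\<lambda>x. k (f x)) has_derivative (\<lambda>v. (g x \<bullet> v) * k' (f x))) (at x)"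
    using has_derivative_compose[OF J(2)[OF x], of k "\<lambda>d. d * k' (f x)"] assms(4)[OF assms(2)[OF x]]
    by (simp add: has_field_derivative_def mult_commute_abs)
  have 2: "((\<lambda>x. k' (f x)) has_derivative (\<lambda>v. (g x \<bullet> v) * k'' (f x))) (at x)"
    using has_derivative_compose[OF J(2)[OF x], of k' "\<lambda>d. d * k'' (f x)"] assms(5)[OF assms(2)[OF x]]
    by (simp add: has_field_derivative_def mult_commute_abs)
  show "((\<lambda>x. k (f x)) has_derivative (\<lambda>v. (k' (f x) *\<^sub>R g x) \<bullet> v)) (at x)"
    by (rule has_derivative_eq_rhs[OF 1]) (simp add: mult.commute)
  show "((\<lambda>x. k' (f x) *\<^sub>R g x) has_derivative
      (\<lambda>v. k' (f x) *\<^sub>R H x v + (k'' (f x) * (g x \<bullet> v)) *\<^sub>R g x)) (at x)"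
    by (rule has_derivative_eq_rhs[OF has_derivative_scaleR[OF 2 J(3)[OF x]]]) (simp add: mult.commute)
next
  note J = has_jetD[OF assms(1)] and C = has_jet_continuous_on[OF assms(1)]
  fix v
  have "continuous_on I k'" using assms(5) DERIV_isCont continuous_at_imp_continuous_on by blast
  then show "continuous_on V (\<lambda>x. k' (f x) *\<^sub>R H x v + (k'' (f x) * (g x \<bullet> v)) *\<^sub>R g x)"
    using assms(2) by (intro continuous_intros C J(4) continuous_on_compose2[of I k' V f] continuous_on_compose2[OF assms(6)]) auto
qed

lemma has_jet_norm_square:
  "open V \<Longrightarrow> has_jet V (\<lambda>x. c * (x \<bullet> x)) (\<lambda>x. (2 * c) *\<^sub>R x) (\<lambda>x v. (2 * c) *\<^sub>R v)"
  unfolding has_jet_def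
  by (auto intro!: derivative_eq_intros simp: inner_commute)

section \<open>Plurisubharmonicity of functions with nonnegative Levi form\<close>

text \<open>For the Hessian \<open>A\<close> of \<open>u\<close> at \<open>z\<close> this is the
  Laplacian at 0 of \<open>u (z + \<zeta> *s w)\<close> as a function of \<zeta>, that is, four
  times the complex Hessian in the direction \<open>w\<close>.\<close>

definition levi_trace :: "((complex^'n::finite) \<Rightarrow> complex^'n) \<Rightarrow> complex^'n \<Rightarrow> real" where
  "levi_trace A w = A w \<bullet> w + A (\<i> *s w) \<bullet> (\<i> *s w)"

lemma bounded_linear_smult: "bounded_linear (\<lambda>w::complex^'n::finite. c *s w)"
proof -
  have "linear (\<lambda>w::complex^'n. c *s w)"
    by (rule linearI) (simp_all add: vec_eq_iff algebra_simps)
  then show ?thesis by (rule linear_conv_bounded_linear[THEN iffD1])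
qed

lemma i_smult_i_smult [simp]: "\<i> *s (\<i> *s w) = - (w::complex^'n::finite)"
  by (simp add: vec_eq_iff mult.assoc[symmetric])

lemma continuous_on_cis_smult:
  "continuous_on S f \<Longrightarrow> continuous_on S (\<lambda>x. cis (f x) *s (w::complex^'n::finite))"
  unfolding vector_scalar_mult_def by (intro continuous_intros) 

lemma cis_smult_derivative:
  "((\<lambda>t. cis t *s (w::complex^'n::finite)) has_derivative (\<lambda>d. d *\<^sub>R (\<i> *s (cis t *s w)))) (at t within S)"
proof -
  have "bounded_linear (\<lambda>c::complex. c *s w)"
  proof -
    have "linear (\<lambda>c::complex. c *s w)"
      by (rule linearI) (simp_all add: vec_eq_iff algebra_simps)
    then show ?thesis by (rule linear_conv_bounded_linear[THEN iffD1])
  qed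
  moreover have "(cis has_derivative (\<lambda>d. d *\<^sub>R (\<i> * cis t))) (at t within S)"
    using has_derivative_cis[OF has_derivative_ident] by simp
  ultimately have "((\<lambda>t. cis t *s w) has_derivative (\<lambda>d. (d *\<^sub>R (\<i> * cis t)) *s w)) (at t within S)"
    by (rule bounded_linear.has_derivative)
  then show ?thesis
    by (rule has_derivative_eq_rhs) (simp add: fun_eq_iff vec_eq_iff mult.assoc)
qed

text \<open>Polar coordinates: the circle integral \<open>M s\<close> at radius \<open>s\<close> has
  derivative \<open>P s\<close>, and the derivative of \<open>s * P s\<close> is \<open>s\<close>
  times the integral of the Laplacian over the circle. Hence \<open>s * P s\<close> increases from 0
  and \<open>M\<close> is nondecreasing. The product \<open>s * P s\<close> avoids a division by the
  radius at the centre.\<close>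

lemma circle_mean_mono:
  fixes u :: "complex^'n::finite \<Rightarrow> real"
  assumes J: "has_jet \<Omega> u g H" and pos: "\<And>x w. x \<in> \<Omega> \<Longrightarrow> 0 \<le> levi_trace (H x) w"
    and disc: "\<And>\<zeta>. \<zeta> \<in> cball 0 1 \<Longrightarrow> z + \<zeta> *s w \<in> \<Omega>"
  shows "2 * pi * u z \<le> integral {0..2*pi} (\<lambda>t. u (z + cis t *s w))"
proof -
  let ?I = "{0..2*pi}"
  define e where "e t = cis t *s w" for t
  have e_cont: "continuous_on S (\<lambda>x. e (f x))" if "continuous_on S f" for f and S :: "'b::topological_space set"
    unfolding e_def by (rule continuous_on_cis_smult[OF that])
  have ie_cont: "continuous_on S (\<lambda>x. \<i> *s e (f x))" if "continuous_on S f" for f and S :: "'b::topological_space set"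
    by (rule bounded_linear.continuous_on[OF bounded_linear_smult e_cont[OF that]])
  have de: "(e has_derivative (\<lambda>d. d *\<^sub>R (\<i> *s e t))) (at t within S)" for t S
    unfolding e_def by (rule cis_smult_derivative)
  have die: "((\<lambda>t. \<i> *s e t) has_derivative (\<lambda>d. - d *\<^sub>R e t)) (at t within S)" for t S
    by (rule has_derivative_eq_rhs[OF bounded_linear.has_derivative[OF bounded_linear_smult de]])
      (simp add: fun_eq_iff linear_cmul[OF bounded_linear.linear[OF bounded_linear_smult]])
  have inO: "z + s *\<^sub>R e t \<in> \<Omega>" if "s \<in> {0..1}" for s t
  proof -
    have "z + (s *\<^sub>R cis t) *s w \<in> \<Omega>" using that by (intro disc) simp
    then show ?thesis by (simp add: e_def vec_eq_iff scalar_mult_eq_scaleR vector_scalar_mult_def scaleR_vec_def)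
  qed
  have lin: "linear (H (z + s *\<^sub>R e t))" if "s \<in> {0..1}" for s t
    using has_jet_linear[OF J inO[OF that]] .
  define M where "M s = integral ?I (\<lambda>t. u (z + s *\<^sub>R e t))" for s
  define P where "P s = integral ?I (\<lambda>t. g (z + s *\<^sub>R e t) \<bullet> e t)" for s
  have pt: "continuous_on S (\<lambda>p. z + f p *\<^sub>R e (h p))"
    if "continuous_on S f" "continuous_on S h" for f h and S :: "'b::topological_space set"
    by (intro continuous_intros e_cont that)
  have ug: "continuous_on S (\<lambda>p. u (z + f p *\<^sub>R e (h p)))" "continuous_on S (\<lambda>p. g (z + f p *\<^sub>R e (h p)))"
    if "continuous_on S f" "continuous_on S h" "f ` S \<subseteq> {0..1}" for f h and S :: "'b::topological_space set"
    by (rule continuous_on_compose2[OF has_jet_continuous_on(1)[OF J] pt[OF that(1,2)]], use that inO in blast)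
      (rule continuous_on_compose2[OF has_jet_continuous_on(2)[OF J] pt[OF that(1,2)]], use that inO in blast)
  have Hc: "continuous_on S (\<lambda>p. H (z + f p *\<^sub>R e (h p)) (k p))"
    if "continuous_on S f" "continuous_on S h" "continuous_on S k" "f ` S \<subseteq> {0..1}" for f h k and S :: "'b::topological_space set"
    using that inO by (intro continuous_on_hess_app[OF J] pt) auto
  have ds: "((\<lambda>s. z + s *\<^sub>R e t) has_derivative (\<lambda>d. d *\<^sub>R e t)) (at s within S)" for s t S
    by (auto intro!: derivative_eq_intros)
  have dt: "((\<lambda>t. z + s *\<^sub>R e t) has_derivative (\<lambda>d. (d * s) *\<^sub>R (\<i> *s e t))) (at t within S)" for s t S
    by (rule has_derivative_eq_rhs[OF has_derivative_add[OF has_derivative_const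
          has_derivative_scaleR_right[OF de]]]) (simp add: fun_eq_iff mult.commute)
  have us: "((\<lambda>s. u (z + s *\<^sub>R e t)) has_field_derivative (g (z + s *\<^sub>R e t) \<bullet> e t)) (at s within {0..1})"
    if "s \<in> {0..1}" for s t
    using has_derivative_compose[where g=u and x=s and f="\<lambda>s. z + s *\<^sub>R e t", OF ds has_jetD(2)[OF J inO[OF that]]]
    by (simp add: has_field_derivative_def mult_commute_abs)
  have gs: "((\<lambda>s. g (z + s *\<^sub>R e t)) has_derivative (\<lambda>d. d *\<^sub>R H (z + s *\<^sub>R e t) (e t))) (at s within {0..1})"
    if "s \<in> {0..1}" for s t
    using has_derivative_compose[where g=g and x=s and f="\<lambda>s. z + s *\<^sub>R e t", OF ds has_jetD(3)[OF J inO[OF that]]]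
    by (simp add: linear_cmul[OF lin[OF that]])
  have M: "(M has_field_derivative P s) (at s within {0..1})" if "s \<in> {0..1}" for s
    unfolding M_def P_def
  proof (rule leibniz_rule_field_derivative[where 'b=real, unfolded cbox_interval])
    show "(\<lambda>t. u (z + x *\<^sub>R e t)) integrable_on ?I" if "x \<in> {0..1}" for x
      using that
      by (intro integrable_continuous_interval ug(1) continuous_intros) auto
    have "continuous_on ({0..1} \<times> ?I) (\<lambda>p. g (z + fst p *\<^sub>R e (snd p)) \<bullet> e (snd p))"
      by (intro continuous_on_inner ug(2) e_cont continuous_intros) auto
    then show "continuous_on ({0..1} \<times> ?I) (\<lambda>(x, t). g (z + x *\<^sub>R e t) \<bullet> e t)"
      by (simp add: case_prod_beta)
  qed (use us that in auto)
  define Q where "Q s = integral ?I (\<lambda>t. s * levi_trace (H (z + s *\<^sub>R e t)) (e t))" for s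
  have sP: "((\<lambda>s. s * P s) has_field_derivative Q s) (at s within {0..1})" if s: "s \<in> {0..1}" for s
  proof -
    have 1: "(\<lambda>s. s * P s) = (\<lambda>s. integral ?I (\<lambda>t. s * (g (z + s *\<^sub>R e t) \<bullet> e t)))"
      by (simp add: P_def)
    let ?d = "\<lambda>s t. g (z + s *\<^sub>R e t) \<bullet> e t + s * (H (z + s *\<^sub>R e t) (e t) \<bullet> e t)"
    have gs': "((\<lambda>s. s * (g (z + s *\<^sub>R e t) \<bullet> e t)) has_field_derivative ?d s t) (at s within {0..1})"
      if "s \<in> {0..1}" for s t
      using has_derivative_mult[OF has_derivative_ident has_derivative_inner_left[OF gs[OF that]], of t "e t"]
      unfolding has_field_derivative_def
      by (rule has_derivative_eq_rhs) (simp add: fun_eq_iff algebra_simps)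
    have "((\<lambda>s. s * P s) has_field_derivative integral ?I (?d s)) (at s within {0..1})"
      unfolding 1
    proof (rule leibniz_rule_field_derivative[where 'b=real, unfolded cbox_interval])
      show "(\<lambda>t. x * (g (z + x *\<^sub>R e t) \<bullet> e t)) integrable_on ?I" if "x \<in> {0..1}" for x
        using that
        by (intro integrable_continuous_interval continuous_on_mult continuous_on_inner ug(2) e_cont
            continuous_on_const continuous_on_id) auto
      have "continuous_on ({0..1} \<times> ?I) (\<lambda>p. ?d (fst p) (snd p))"
        by (intro continuous_on_mult continuous_on_add continuous_on_inner ug(2) Hc e_cont continuous_on_fst
            continuous_on_snd continuous_on_id) auto
      then show "continuous_on ({0..1} \<times> ?I) (\<lambda>(x, t). ?d x t)"
        by (simp add: case_prod_beta)
    qed (use gs' s in auto)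
    moreover have "integral ?I (?d s) = Q s"
    proof -
      \<comment> \<open>\<open>?b\<close> is the angular derivative of a function of period
        \<open>2 * pi\<close>, so its integral is 0. Adding it to the radial derivative cancels the
        first-order terms and completes the second derivative along \<open>e t\<close> to the
        Laplacian.\<close>
      let ?b = "\<lambda>t. s * (H (z + s *\<^sub>R e t) (\<i> *s e t) \<bullet> (\<i> *s e t)) - g (z + s *\<^sub>R e t) \<bullet> e t"
      have "((\<lambda>t. g (z + s *\<^sub>R e t) \<bullet> (\<i> *s e t)) has_vector_derivative ?b t) (at t within ?I)" for t
      proof -
        have "((\<lambda>t. g (z + s *\<^sub>R e t)) has_derivative (\<lambda>d. (d * s) *\<^sub>R H (z + s *\<^sub>R e t) (\<i> *s e t))) (at t within ?I)"
          using has_derivative_compose[where g=g and x=t and f="\<lambda>t. z + s *\<^sub>R e t", OF dt has_jetD(3)[OF J inO[OF s]]]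
          by (simp add: linear_cmul[OF lin[OF s]])
        from has_derivative_inner[OF this die] show ?thesis
          unfolding has_vector_derivative_def
          by (rule has_derivative_eq_rhs) (simp add: fun_eq_iff algebra_simps)
      qed
      then have "(?b has_integral (g (z + s *\<^sub>R e (2*pi)) \<bullet> (\<i> *s e (2*pi)) - g (z + s *\<^sub>R e 0) \<bullet> (\<i> *s e 0))) ?I"
        by (intro fundamental_theorem_of_calculus) auto
      moreover have "e (2*pi) = e 0" by (simp add: e_def)
      ultimately have b: "(?b has_integral 0) ?I" by simp
      have "(?d s has_integral integral ?I (?d s)) ?I"
        using s by (intro integrable_integral integrable_continuous_interval continuous_on_mult
            continuous_on_add continuous_on_inner ug(2) Hc e_cont continuous_on_const continuous_on_id) auto
      from has_integral_add[OF this b] have "integral ?I (\<lambda>t. ?d s t + ?b t) = integral ?I (?d s)"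
        by (simp add: integral_unique)
      moreover have "(\<lambda>t. ?d s t + ?b t) = (\<lambda>t. s * levi_trace (H (z + s *\<^sub>R e t)) (e t))"
        by (simp add: fun_eq_iff levi_trace_def algebra_simps)
      ultimately show ?thesis unfolding Q_def by metis
    qed
    ultimately show ?thesis by simp
  qed
  have Q0: "0 \<le> Q s" if "s \<in> {0..1}" for s
    unfolding Q_def
  proof (intro integral_nonneg integrable_continuous_interval)
    show "continuous_on ?I (\<lambda>t. s * levi_trace (H (z + s *\<^sub>R e t)) (e t))"
      unfolding levi_trace_def using that
      by (intro continuous_on_mult continuous_on_add continuous_on_inner Hc ie_cont e_cont continuous_on_const
          continuous_on_id) auto
  qed (use that in \<open>auto intro!: mult_nonneg_nonneg pos inO\<close>)
  have sP0: "0 \<le> s * P s" if s: "s \<in> {0..1}" for s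
  proof (cases "s = 0")
    case False
    then have "0 < s" using s by auto
    then have "\<exists>x\<in>{0<..<s}. s * P s - 0 * P 0 = (s - 0) * Q x"
    proof (intro mvt_simple[where f'="\<lambda>x d. d * Q x"])
      fix x assume "0 \<le> x" "x \<le> s"
      then have "((\<lambda>s. s * P s) has_derivative (\<lambda>d. Q x * d)) (at x within {0..1})"
        using s sP[of x] by (simp add: has_field_derivative_def)
      then show "((\<lambda>s. s * P s) has_derivative (\<lambda>d. d * Q x)) (at x within {0..s})"
        using s by (simp add: mult.commute has_derivative_subset)
    qed
    then obtain x where "x \<in> {0<..<s}" "s * P s - 0 * P 0 = (s - 0) * Q x" by blast
    then show ?thesis using Q0[of x] s by simp
  qed simp
  have "\<exists>x\<in>{0<..<1}. M 1 - M 0 = (1 - 0) * P x"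
  proof (intro mvt_simple[where f'="\<lambda>x d. d * P x"])
    fix x :: real assume "0 \<le> x" "x \<le> 1"
    then have "(M has_derivative (\<lambda>d. P x * d)) (at x within {0..1})"
      using M[of x] by (simp add: has_field_derivative_def)
    then show "(M has_derivative (\<lambda>d. d * P x)) (at x within {0..1})" by (simp add: mult.commute)
  qed simp
  then obtain x where x: "x \<in> {0<..<1}" "M 1 - M 0 = P x" by auto
  then have "0 \<le> P x" using sP0[of x] by (simp add: zero_le_mult_iff)
  then have "M 0 \<le> M 1" using x by simp
  then show ?thesis by (simp add: M_def e_def)
qed

lemma plurisubharmonic_on_if_levi_trace_nonneg:
  fixes u :: "complex^'n::finite \<Rightarrow> real"
  assumes J: "has_jet \<Omega> u g H" and pos: "\<And>x w. x \<in> \<Omega> \<Longrightarrow> 0 \<le> levi_trace (H x) w"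
  shows "plurisubharmonic_on \<Omega> u"
  unfolding plurisubharmonic_on_def
proof (intro conjI allI impI)
  fix a
  have "{z \<in> \<Omega>. u z < a} = \<Omega> \<inter> u -` {..<a}" by auto
  then show "openin (top_of_set \<Omega>) {z \<in> \<Omega>. u z < a}"
    using continuous_openin_preimage_gen[OF has_jet_continuous_on(1)[OF J], of "{..<a}"] by simp
next
  fix z w assume disc: "\<forall>\<zeta>\<in>cball 0 1. z + \<zeta> *s w \<in> \<Omega>"
  have c: "continuous_on {0..2*pi} (\<lambda>t. u (z + cis t *s w))"
    by (rule continuous_on_compose2[OF has_jet_continuous_on(1)[OF J]])
      (use disc in \<open>auto intro!: continuous_intros continuous_on_cis_smult\<close>)
  show int: "set_integrable lborel {0..2 * pi} (\<lambda>t. u (z + cis t *s w))"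
    using borel_integrable_compact[OF compact_Icc c]
    by (simp add: set_integrable_def indicator_scaleR_eq_if)
  show "u z \<le> (LINT t:{0..2 * pi}|lborel. u (z + cis t *s w)) / (2 * pi)"
    using circle_mean_mono[OF J pos, of z w] disc set_borel_integral_eq_integral(2)[OF int]
    by (simp add: field_simps)
qed

section \<open>Regularity of the signed distance\<close>

text \<open>With \<open>x = B y w - B y0 w\<close> one has
  \<open>A y x = (A y0 - A y) (B y0 w)\<close>, and the lower bound for \<open>A y0\<close> survives
  for nearby \<open>A y\<close>, so \<open>x\<close> tends to 0. Applied to the derivative of the
  local inverse of the normal map, this makes that inverse continuously differentiable.\<close>

lemma continuous_on_inverse_family:
  fixes A :: "'x::metric_space \<Rightarrow> 'b::euclidean_space \<Rightarrow>\<^sub>L 'b"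
  assumes contA: "continuous_on S A" and AB: "\<And>y w. y \<in> S \<Longrightarrow> blinfun_apply (A y) (B y w) = w"
    and BA: "\<And>y w. y \<in> S \<Longrightarrow> B y (blinfun_apply (A y) w) = w"
    and lin: "\<And>y. y \<in> S \<Longrightarrow> linear (B y)"
  shows "continuous_on S (\<lambda>y. B y w)"
  unfolding continuous_on_def
proof
  fix y0 assume y0: "y0 \<in> S"
  have "bounded_linear (B y0)" using lin[OF y0] linear_conv_bounded_linear by blast
  then obtain b where b: "b > 0" "\<And>x. norm (B y0 x) \<le> norm x * b"
    using bounded_linear.pos_bounded by blast
  have lower: "norm x \<le> b * norm (blinfun_apply (A y0) x)" for x
    using b(2)[of "A y0 x"] by (simp add: BA[OF y0] mult.commute)
  have A0: "((\<lambda>y. norm (A y - A y0)) \<longlongrightarrow> 0) (at y0 within S)"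
    using contA y0 by (metis LIM_zero continuous_on_def tendsto_norm_zero)
  \<comment> \<open>The constant \<open>1 / (2 * b)\<close> lets the error
    \<open>norm (A y - A y0) * norm x\<close> be absorbed in half of \<open>norm x\<close>.\<close>
  then have small: "eventually (\<lambda>y. norm (A y - A y0) < 1 / (2 * b)) (at y0 within S)"
    using b(1) by (intro order_tendstoD(2)) auto
  have inS: "eventually (\<lambda>y. y \<in> S) (at y0 within S)" by (simp add: eventually_at_filter)
  have "eventually (\<lambda>y. norm (B y w - B y0 w) \<le> 2 * b * norm (B y0 w) * norm (A y - A y0)) (at y0 within S)"
    using small inS
  proof eventually_elim
    case (elim y)
    then have y: "y \<in> S" by simp
    define x where "x = B y w - B y0 w"
    have Ayx: "blinfun_apply (A y) x = blinfun_apply (A y0 - A y) (B y0 w)"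
      by (simp add: x_def blinfun.diff_right blinfun.diff_left AB[OF y] AB[OF y0])
    have "blinfun_apply (A y0) x = blinfun_apply (A y) x - blinfun_apply (A y - A y0) x"
      by (simp add: blinfun.diff_left)
    then have "norm (blinfun_apply (A y0) x) \<le> norm (blinfun_apply (A y) x) + norm (blinfun_apply (A y - A y0) x)"
      by (metis norm_triangle_ineq4)
    also have "\<dots> \<le> norm (A y - A y0) * norm (B y0 w) + norm (A y - A y0) * norm x"
      using norm_blinfun[of "A y0 - A y" "B y0 w"] norm_blinfun[of "A y - A y0" x]
      by (simp add: Ayx norm_minus_commute add_mono)
    also have "\<dots> \<le> norm (A y - A y0) * norm (B y0 w) + 1 / (2*b) * norm x"
      using elim(1) by (intro add_left_mono mult_right_mono) auto
    finally have "b * norm (blinfun_apply (A y0) x) \<le> b * (norm (A y - A y0) * norm (B y0 w) + 1 / (2*b) * norm x)"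
      using b(1) by (intro mult_left_mono) auto
    also have "\<dots> = b * (norm (A y - A y0) * norm (B y0 w)) + norm x / 2"
      using b(1) by (simp add: field_simps)
    finally have "norm x \<le> 2 * b * (norm (A y - A y0) * norm (B y0 w))" using lower[of x] by linarith
    then show ?case by (simp add: x_def mult_ac)
  qed
  moreover have "((\<lambda>y. 2 * b * norm (B y0 w) * norm (A y - A y0)) \<longlongrightarrow> 0) (at y0 within S)"
    using tendsto_mult_right_zero[OF A0] by blast
  ultimately have "((\<lambda>y. B y w - B y0 w) \<longlongrightarrow> 0) (at y0 within S)"
    by (rule Lim_null_comparison)
  then show "((\<lambda>y. B y w) \<longlongrightarrow> B y0 w) (at y0 within S)" by (rule LIM_zero_cancel)
qed

text \<open>If \<open>G\<close> had a component \<open>h\<close> orthogonal to \<open>w\<close>,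
  then \<open>w + k h\<close> would stay in the half-space for every \<open>k\<close> while
  \<open>G\<close> takes the value 1 for a suitable one. So \<open>G\<close> is a multiple of
  \<open>w\<close>, and a negative one.\<close>

lemma sgn_eq_if_halfspace_nonpos:
  fixes G w :: "'a::real_inner"
  assumes half: "\<And>v. v \<bullet> w > 0 \<Longrightarrow> G \<bullet> v \<le> 0" and "w \<noteq> 0" "G \<noteq> 0"
  shows "w = - norm w *\<^sub>R sgn G"
proof -
  define a where "a = (G \<bullet> w) / (w \<bullet> w)"
  define h where "h = G - a *\<^sub>R w"
  have ww: "w \<bullet> w > 0" using assms by simp
  have hw: "h \<bullet> w = 0" using ww by (simp add: h_def a_def inner_diff_left)
  have Gh: "G = a *\<^sub>R w + h" by (simp add: h_def)
  have "h = 0"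
  proof (rule ccontr)
    assume "h \<noteq> 0"
    then have hh: "h \<bullet> h > 0" by simp
    define k where "k = (1 - a * (w \<bullet> w)) / (h \<bullet> h)"
    have "G \<bullet> (w + k *\<^sub>R h) = a * (w \<bullet> w) + k * (h \<bullet> h)"
      using hw by (simp add: Gh inner_add_left inner_add_right inner_commute[of w h])
    also have "\<dots> = 1" using hh by (simp add: k_def)
    finally have "G \<bullet> (w + k *\<^sub>R h) = 1" .
    moreover have "(w + k *\<^sub>R h) \<bullet> w > 0" using hw ww by (simp add: inner_add_left)
    ultimately show False using half by fastforce
  qed
  then have G: "G = a *\<^sub>R w" using Gh by simp
  have "a * (w \<bullet> w) \<le> 0" using half[of w] ww G by (metis inner_scaleR_left)
  then have "a < 0" using ww G assms(3) by (auto simp: mult_le_0_iff)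
  then have "sgn G = - sgn w" by (simp add: G sgn_scaleR)
  then show ?thesis by (simp add: sgn_div_norm assms)
qed

text \<open>The open ball about \<open>z\<close> that reaches just to its nearest boundary point
  \<open>p\<close> misses the frontier; being connected, it lies in the domain or in its complement.
  Along every ray from \<open>p\<close> into the ball the function \<rho> therefore keeps one sign,
  and its difference quotients give the half-space condition that forces \<open>z - p\<close> to be
  a multiple of the gradient.\<close>

lemma nearest_point_normal:
  fixes \<rho> :: "complex^'n::finite \<Rightarrow> real"
  assumes "open \<Omega>" "open U" "p \<in> U" and loc: "\<Omega> \<inter> U = {z\<in>U. \<rho> z < 0}"
    and der: "(\<rho> has_derivative (\<lambda>v. G \<bullet> v)) (at p)" "G \<noteq> 0"
    and p: "p \<in> frontier \<Omega>" and near: "bdist \<Omega> z = dist z p"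
  shows "\<rho> p = 0" "z = p + signed_dist \<Omega> z *\<^sub>R sgn G"
proof -
  have pnO: "p \<notin> \<Omega>" using p \<open>open \<Omega>\<close> by (simp add: frontier_def interior_open)
  then have ge: "\<rho> p \<ge> 0" using loc \<open>p \<in> U\<close> by force
  have le: "\<rho> p \<le> 0"
  proof (rule ccontr)
    assume "\<not> \<rho> p \<le> 0"
    moreover have "isCont \<rho> p" using der(1) has_derivative_continuous by blast
    ultimately have "eventually (\<lambda>x. \<rho> x > 0) (at p)"
      unfolding isCont_def by (intro order_tendstoD(1)) auto
    moreover have "eventually (\<lambda>x. x \<in> U) (at p)" using \<open>open U\<close> \<open>p \<in> U\<close> by (simp add: eventually_at_topological) blast
    ultimately have "eventually (\<lambda>x. x \<notin> \<Omega>) (at p)"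
      by eventually_elim (use loc in force)
    then have "\<not> p islimpt \<Omega>" by (simp add: islimpt_iff_eventually)
    then show False using p pnO by (simp add: frontier_def closure_def)
  qed
  show r0: "\<rho> p = 0" using ge le by simp
  show "z = p + signed_dist \<Omega> z *\<^sub>R sgn G"
  proof (cases "z = p")
    case True
    then show ?thesis using near pnO by (simp add: signed_dist_def)
  next
    case False
    define w where "w = z - p"
    have w: "w \<noteq> 0" "norm w = dist z p" using False by (auto simp: w_def dist_norm)
    have inf: "ball z (norm w) \<inter> frontier \<Omega> = {}"
      using near w infdist_le[of _ "frontier \<Omega>" z] by (fastforce simp: bdist_def)
    have ray: "\<exists>e>0. \<forall>t. 0 < t \<and> t < e \<longrightarrow> p + t *\<^sub>R v \<in> ball z (norm w) \<inter> U" if v: "v \<bullet> w > 0" for v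
    proof -
      have "((\<lambda>t. p + t *\<^sub>R v) \<longlongrightarrow> p + 0 *\<^sub>R v) (at_right (0::real))" by (intro tendsto_intros)
      then have "eventually (\<lambda>t. p + t *\<^sub>R v \<in> U) (at_right (0::real))"
        using \<open>open U\<close> \<open>p \<in> U\<close> by (simp add: topological_tendstoD)
      then obtain e1 where e1: "e1 > 0" "\<And>t. 0 < t \<Longrightarrow> t < e1 \<Longrightarrow> p + t *\<^sub>R v \<in> U"
        by (auto simp: eventually_at_right_field)
      have vv: "v \<bullet> v > 0" using v by (metis inner_gt_zero_iff inner_zero_left less_irrefl)
      \<comment> \<open>The second entry is the parameter at which the ray leaves the ball
        again.\<close>
      define e where "e = min e1 (2 * (v \<bullet> w) / (v \<bullet> v))"
      have "p + t *\<^sub>R v \<in> ball z (norm w)" if "0 < t" "t < e" for t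
      proof -
        have "t * (v \<bullet> v) < 2 * (v \<bullet> w)" using that vv by (simp add: e_def field_simps)
        then have "t * (t * (v \<bullet> v)) < t * (2 * (v \<bullet> w))" using that by simp
        moreover have "(norm (w - t *\<^sub>R v))\<^sup>2 = (norm w)\<^sup>2 - t * (2 * (v \<bullet> w)) + t * (t * (v \<bullet> v))"
          by (simp add: power2_norm_eq_inner inner_diff_left inner_diff_right inner_commute algebra_simps)
        ultimately have "(norm (w - t *\<^sub>R v))\<^sup>2 < (norm w)\<^sup>2" by linarith
        then have "norm (w - t *\<^sub>R v) < norm w" by (simp add: power_less_imp_less_base)
        then show ?thesis by (simp add: w_def dist_norm algebra_simps)
      qed
      then show ?thesis using e1 v vv by (intro exI[of _ e]) (auto simp: e_def)
    qed
    have quot: "((\<lambda>t. \<rho> (p + t *\<^sub>R v) / t) \<longlongrightarrow> G \<bullet> v) (at_right (0::real))" for v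
    proof -
      have "((\<lambda>t. \<rho> (p + t *\<^sub>R v)) has_derivative (\<lambda>t. G \<bullet> (t *\<^sub>R v))) (at 0)"
        by (rule has_derivative_compose[where g=\<rho> and x=0 and f="\<lambda>t. p + t *\<^sub>R v"])
          (use der in \<open>auto intro!: derivative_eq_intros\<close>)
      then have "((\<lambda>t. \<rho> (p + t *\<^sub>R v)) has_field_derivative (G \<bullet> v)) (at 0)"
        by (simp add: has_field_derivative_def mult_commute_abs)
      then have "((\<lambda>t. \<rho> (p + t *\<^sub>R v) / t) \<longlongrightarrow> G \<bullet> v) (at 0)"
        by (simp add: DERIV_def r0)
      then show ?thesis using tendsto_within_subset by blast
    qed
    have conn: "connected (ball z (norm w))" by simp
    have zb: "z \<in> ball z (norm w)" using w(1) by (metis centre_in_ball zero_less_norm_iff)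
    show ?thesis
    proof (cases "z \<in> \<Omega>")
      case True
      then have sub: "ball z (norm w) \<subseteq> \<Omega>"
        using connected_Int_frontier[OF conn, of \<Omega>] inf zb by blast
      have "G \<bullet> v \<le> 0" if "v \<bullet> w > 0" for v
      proof (rule tendsto_upperbound[OF quot])
        obtain e where "e > 0" "\<forall>t. 0 < t \<and> t < e \<longrightarrow> p + t *\<^sub>R v \<in> ball z (norm w) \<inter> U"
          using ray[OF \<open>v \<bullet> w > 0\<close>] by blast
        then show "\<forall>\<^sub>F t in at_right 0. \<rho> (p + t *\<^sub>R v) / t \<le> 0"
          unfolding eventually_at_right_field using sub loc
          by (intro exI[of _ e]) (force simp: divide_le_0_iff)
      qed simp
      from sgn_eq_if_halfspace_nonpos[OF this w(1) der(2)]
      have "w = - norm w *\<^sub>R sgn G" .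
      moreover have "signed_dist \<Omega> z = - norm w" using True near w by (simp add: signed_dist_def)
      ultimately show ?thesis by (metis w_def add.commute diff_add_cancel)
    next
      case nO: False
      have dis: "ball z (norm w) \<inter> \<Omega> = {}"
        using connected_Int_frontier[OF conn, of \<Omega>] inf zb nO by blast
      have "(- G) \<bullet> v \<le> 0" if "v \<bullet> w > 0" for v
      proof -
        have "0 \<le> G \<bullet> v"
        proof (rule tendsto_lowerbound[OF quot])
          obtain e where "e > 0" "\<forall>t. 0 < t \<and> t < e \<longrightarrow> p + t *\<^sub>R v \<in> ball z (norm w) \<inter> U"
            using ray[OF \<open>v \<bullet> w > 0\<close>] by blast
          then show "\<forall>\<^sub>F t in at_right 0. 0 \<le> \<rho> (p + t *\<^sub>R v) / t"
            unfolding eventually_at_right_field using dis loc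
            by (intro exI[of _ e]) (force simp: zero_le_divide_iff)
        qed simp
        then show ?thesis by simp
      qed
      from sgn_eq_if_halfspace_nonpos[OF this w(1)] der(2)
      have "w = norm w *\<^sub>R sgn G" by (simp add: sgn_minus)
      moreover have "signed_dist \<Omega> z = norm w" using nO near w by (simp add: signed_dist_def)
      ultimately show ?thesis by (metis w_def add.commute diff_add_cancel)
    qed
  qed
qed

text \<open>The normal map \<Phi> takes a base point and a height to the point reached along the
  unit normal \<open>m\<close>, paired with the value of \<rho> at the base. Where the second
  coordinate is 0, its local inverse returns the foot point and the signed distance. A priori this
  gives one derivative of the distance; but the gradient turns out to be \<open>m\<close> at the
  foot point, itself continuously differentiable, so a second derivative is gained. In
  \<open>2 * dist p0 z + e/4\<close> the 2 appears because the nearest point is at most twice as far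
  from \<open>p0\<close> as \<open>z\<close>; the slack keeps the open ball nonempty at
  \<open>z = p0\<close>.\<close>

lemma local_tube:
  fixes \<Omega> :: "(complex^'n::finite) set"
  assumes O: "open \<Omega>" and C2: "C2_boundary \<Omega>" and p0: "p0 \<in> frontier \<Omega>"
  obtains e g H where "e > 0" "has_jet (ball p0 e) (signed_dist \<Omega>) g H"
    "\<And>z. z \<in> ball p0 e \<Longrightarrow> norm (g z) = 1 \<and> z - signed_dist \<Omega> z *\<^sub>R g z \<in> frontier \<Omega> \<inter> ball p0 (2 * dist p0 z + e/4)"
    "\<And>z. z \<in> ball p0 (e/4) \<Longrightarrow> g (z - signed_dist \<Omega> z *\<^sub>R g z) = g z"
proof -
  let ?d = "signed_dist \<Omega>"
  obtain U and \<rho> :: "complex^'n \<Rightarrow> real" where U: "open U" "p0 \<in> U" "C2_on U \<rho>"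
    and nz: "\<And>z. z \<in> U \<Longrightarrow> frechet_derivative \<rho> (at z) \<noteq> (\<lambda>v. 0)"
    and loc: "\<Omega> \<inter> U = {z\<in>U. \<rho> z < 0}"
    using bspec[OF C2[unfolded C2_boundary_def] p0] by (elim exE conjE) (rule that; simp)
  define G where "G = grad \<rho>"
  define K where "K = hess \<rho>"
  have J: "has_jet U \<rho> G K" unfolding G_def K_def using C2_on_has_jet[OF U(3,1)] .
  note JD = has_jetD[OF J] and JC = has_jet_continuous_on[OF J]
  have G0: "G x \<noteq> 0" if "x \<in> U" for x
    using nz[OF that] frechet_derivative_at[OF JD(2)[OF that]] by auto
  define m where "m x = sgn (G x)" for x
  define m' where "m' x v = inverse (norm (G x)) *\<^sub>R K x v - ((inverse (norm (G x)))\<^sup>2 * (m x \<bullet> K x v)) *\<^sub>R G x" for x v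
  have m1: "norm (m x) = 1" if "x \<in> U" for x using G0[OF that] by (simp add: m_def norm_sgn)
  have Gm: "G x = norm (G x) *\<^sub>R m x" for x by (cases "G x = 0") (simp_all add: m_def sgn_div_norm)
  have dm: "(m has_derivative m' x) (at x)" if "x \<in> U" for x
  proof -
    have "((\<lambda>y. norm (G y)) has_derivative (\<lambda>v. K x v \<bullet> m x)) (at x)"
      unfolding m_def
      by (rule has_derivative_compose[where g=norm and f=G and x=x, OF JD(3)[OF that] has_derivative_norm[OF G0[OF that]]])
    from has_derivative_scaleR[OF Deriv.has_derivative_inverse[OF _ this] JD(3)[OF that]] G0[OF that]
    have "((\<lambda>y. inverse (norm (G y)) *\<^sub>R G y) has_derivative
      (\<lambda>h. inverse (norm (G x)) *\<^sub>R K x h + (- (inverse (norm (G x)) * (K x h \<bullet> m x) * inverse (norm (G x)))) *\<^sub>R G x)) (at x)"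
      by simp
    then show ?thesis unfolding m_def[abs_def] sgn_div_norm m'_def
      by (rule has_derivative_eq_rhs) (simp add: fun_eq_iff m_def sgn_div_norm power2_eq_square inner_commute algebra_simps)
  qed
  have mm': "m x \<bullet> m' x v = 0" if "x \<in> U" for x v
  proof -
    have "m x \<bullet> G x = norm (G x)" using m1[OF that] by (subst Gm) (simp add: power2_norm_eq_inner[symmetric])
    then show ?thesis using G0[OF that] by (simp add: m'_def inner_diff_right power2_eq_square)
  qed
  have linm': "linear (m' x)" if "x \<in> U" for x using has_derivative_linear[OF dm[OF that]] .
  have cm: "continuous_on U m" unfolding m_def[abs_def] using JC(2) G0 by (intro continuous_on_sgn) auto
  have cm': "continuous_on U (\<lambda>x. m' x v)" for v
    unfolding m'_def[abs_def] using G0 by (intro continuous_intros JC(2) JD(4) cm) auto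
  have cm'2: "continuous_on S (\<lambda>s. m' (a s) (h s))"
    if "continuous_on S a" "continuous_on S h" "a ` S \<subseteq> U" for a h and S :: "'s::topological_space set"
  proof -
    have "m' (a s) (h s) = (\<Sum>b\<in>Basis. (h s \<bullet> b) *\<^sub>R m' (a s) b)" if "s \<in> S" for s
    proof -
      have lin: "linear (m' (a s))" using linm' \<open>a ` S \<subseteq> U\<close> that by blast
      have "m' (a s) (h s) = m' (a s) (\<Sum>b\<in>Basis. (h s \<bullet> b) *\<^sub>R b)" by (simp add: euclidean_representation)
      then show ?thesis by (simp add: linear_sum[OF lin] linear_cmul[OF lin])
    qed
    moreover have "continuous_on S (\<lambda>s. \<Sum>b\<in>Basis. (h s \<bullet> b) *\<^sub>R m' (a s) b)"
      by (intro continuous_intros that continuous_on_compose2[OF cm'])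
    ultimately show ?thesis by (simp cong: continuous_on_cong_simp)
  qed
  define \<Phi> where "\<Phi> y = (fst y + snd y *\<^sub>R m (fst y), \<rho> (fst y))" for y
  define D where "D y w = (fst w + (snd y *\<^sub>R m' (fst y) (fst w) + snd w *\<^sub>R m (fst y)), G (fst y) \<bullet> fst w)" for y w
  define A where "A y = Blinfun (D y)" for y
  let ?S = "U \<times> (UNIV :: real set)"
  have d\<Phi>: "(\<Phi> has_derivative D y) (at y)" if y: "y \<in> ?S" for y
  proof -
    have f: "fst y \<in> U" using y by auto
    have 1: "((\<lambda>y. m (fst y)) has_derivative (\<lambda>w. m' (fst y) (fst w))) (at y)"
      by (rule has_derivative_compose[where g=m and f=fst and x=y, OF has_derivative_fst[OF has_derivative_ident] dm[OF f]])
    have 2: "((\<lambda>y. \<rho> (fst y)) has_derivative (\<lambda>w. G (fst y) \<bullet> (fst w))) (at y)"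
      by (rule has_derivative_compose[where g=\<rho> and f=fst and x=y, OF has_derivative_fst[OF has_derivative_ident] JD(2)[OF f]])
    show ?thesis unfolding \<Phi>_def[abs_def] D_def[abs_def]
      by (intro has_derivative_Pair has_derivative_add has_derivative_fst has_derivative_snd has_derivative_ident
          has_derivative_scaleR 1 2)
  qed
  have blD: "bounded_linear (D y)" if "y \<in> ?S" for y
    using d\<Phi>[OF that] has_derivative_bounded_linear by blast
  have Aapp: "blinfun_apply (A y) = D y" if "y \<in> ?S" for y
    unfolding A_def using bounded_linear_Blinfun_apply[OF blD[OF that]] .
  have contA: "continuous_on ?S A"
  proof (rule continuous_on_blinfun_componentwise)
    fix i :: "(complex^'n) \<times> real"
    have "continuous_on ?S (\<lambda>y. D y i)" unfolding D_def
      by (intro continuous_intros cm'2 continuous_on_compose2[OF cm] continuous_on_compose2[OF JC(2)]) auto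
    then show "continuous_on ?S (\<lambda>y. blinfun_apply (A y) i)"
      using Aapp by (simp cong: continuous_on_cong)
  qed
  \<comment> \<open>The inverse of the derivative at \<open>(p0, 0)\<close>. Height 0 removes the
    term with \<open>m'\<close>; the second coordinate then determines the normal part of the base
    displacement, and the rest of the normal part is the change in height.\<close>
  define B where "B y = (let s = m p0 \<bullet> fst y - snd y / norm (G p0) in (fst y - s *\<^sub>R m p0, s))" for y
  have lB: "linear B"
    unfolding B_def Let_def by (rule linearI) (simp_all add: inner_add_right algebra_simps add_divide_distrib)
  have BD: "B (D (p0, 0) w) = w" for w
  proof -
    have "G p0 \<bullet> fst w = norm (G p0) * (m p0 \<bullet> fst w)" by (subst Gm) simp
    moreover have "m p0 \<bullet> m p0 = 1" using m1[OF U(2)] by (simp add: norm_eq_1)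
    ultimately show ?thesis using G0[OF U(2)]
      by (simp add: B_def D_def Let_def inner_add_right prod_eq_iff)
  qed
  have p0S: "(p0, 0) \<in> ?S" using U by simp
  have inv0: "Blinfun B o\<^sub>L A (p0, 0) = id_blinfun"
    by (rule blinfun_eqI)
      (simp add: Aapp[OF p0S] bounded_linear_Blinfun_apply[OF lB[THEN linear_conv_bounded_linear[THEN iffD1]]] BD)
  obtain U' V \<Psi> \<Psi>' where UV: "open U'" "U' \<subseteq> ?S" "(p0, 0) \<in> U'" "open V" "homeomorphism U' V \<Phi> \<Psi>"
    and d\<Psi>: "\<And>y. y \<in> V \<Longrightarrow> (\<Psi> has_derivative \<Psi>' y) (at y)"
    and inv\<Psi>: "\<And>y. y \<in> V \<Longrightarrow> \<Psi>' y = inv (blinfun_apply (A (\<Psi> y)))"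
    and bij\<Psi>: "\<And>y. y \<in> V \<Longrightarrow> bij (blinfun_apply (A (\<Psi> y)))"
  proof (rule inverse_function_theorem[of ?S \<Phi> A "(p0, 0)" "Blinfun B"])
    show "open ?S" using U(1) by (intro open_Times) auto
    show "(\<Phi> has_derivative blinfun_apply (A y)) (at y)" if "y \<in> ?S" for y
      using d\<Phi>[OF that] Aapp[OF that] by simp
    show "continuous_on ?S A" "(p0, 0) \<in> ?S" "Blinfun B o\<^sub>L A (p0, 0) = id_blinfun" by fact+
    fix U' V g g' assume *: "open U'" "U' \<subseteq> ?S" "(p0, 0) \<in> U'" "open V" "homeomorphism U' V \<Phi> g"
      "\<And>y. y \<in> V \<Longrightarrow> (g has_derivative g' y) (at y)"
      "\<And>y. y \<in> V \<Longrightarrow> g' y = inv (blinfun_apply (A (g y)))"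
      "\<And>y. y \<in> V \<Longrightarrow> bij (blinfun_apply (A (g y)))"
    show thesis by (rule that[OF *])
  qed
  have \<Psi>V: "\<Psi> y \<in> ?S" if "y \<in> V" for y using UV that unfolding homeomorphism_def by blast
  have c\<Psi>': "continuous_on V (\<lambda>y. \<Psi>' y w)" for w
  proof (rule continuous_on_inverse_family)
    show "continuous_on V (\<lambda>y. A (\<Psi> y))"
      by (rule continuous_on_compose2[OF contA homeomorphism_cont2[OF UV(5)]]) (use \<Psi>V in blast)
    show "blinfun_apply (A (\<Psi> y)) (\<Psi>' y w) = w" if "y \<in> V" for y w
      using bij\<Psi>[OF that] by (simp add: inv\<Psi>[OF that] bij_is_surj surj_f_inv_f)
    show "\<Psi>' y (blinfun_apply (A (\<Psi> y)) w) = w" if "y \<in> V" for y w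
      using bij\<Psi>[OF that] by (simp add: inv\<Psi>[OF that] bij_is_inj inv_f_f)
    show "linear (\<Psi>' y)" if "y \<in> V" for y using has_derivative_linear[OF d\<Psi>[OF that]] .
  qed
  obtain r where r: "r > 0" "ball (p0, 0::real) r \<subseteq> U'" using UV(1,3) open_contains_ball by blast
  \<comment> \<open>The foot point is at distance less than \<open>2 e\<close> from
    \<open>p0\<close> and the height is less than \<open>e\<close>, so the pair stays in the ball of
    radius \<open>r\<close>.\<close>
  define e where "e = r / 3"
  have e: "e > 0" using r by (simp add: e_def)
  have near: "\<exists>p\<in>frontier \<Omega>. bdist \<Omega> z = dist z p \<and> p \<in> U \<and> (p, ?d z) \<in> U' \<and> \<Psi> (z, 0) = (p, ?d z) \<and> (z, 0) \<in> V
      \<and> z = p + ?d z *\<^sub>R m p \<and> \<rho> p = 0 \<and> dist p0 p \<le> 2 * dist p0 z"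
    if z: "z \<in> ball p0 e" for z
  proof -
    obtain p where p: "p \<in> frontier \<Omega>" "bdist \<Omega> z = dist z p"
      using infdist_attains_inf[of "frontier \<Omega>" z] p0 unfolding bdist_def by auto
    have "dist z p \<le> dist z p0" using p infdist_le[OF p0, of z] by (simp add: bdist_def)
    moreover have "dist p0 p \<le> dist p0 z + dist z p" by (rule dist_triangle)
    ultimately have d: "dist z p < e" "dist p0 p < 2 * e" "dist p0 p \<le> 2 * dist p0 z"
      using z by (auto simp: dist_commute)
    have "dist (p0, 0::real) (p, ?d z) \<le> dist p0 p + dist 0 (?d z)"
      unfolding dist_Pair_Pair by (rule sqrt_sum_squares_le_sum) auto
    also have "dist 0 (?d z) = dist z p" using p(2) by (simp add: signed_dist_def dist_real_def)
    finally have "dist (p0, 0::real) (p, ?d z) < r" using d by (simp add: e_def)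
    then have U': "(p, ?d z) \<in> U'" using r by auto
    then have pU: "p \<in> U" using UV(2) by auto
    note nn = nearest_point_normal[OF O U(1) pU loc JD(2)[OF pU] G0[OF pU] p]
    have "\<Phi> (p, ?d z) = (z, 0)" using nn by (simp add: \<Phi>_def m_def)
    then have "\<Psi> (z, 0) = (p, ?d z)" "(z, 0) \<in> V"
      using homeomorphism_apply1[OF UV(5) U'] homeomorphism_image1[OF UV(5)] U' by (simp, metis imageI)
    then show ?thesis using p pU U' nn d by (auto simp: m_def)
  qed
  define \<pi> where "\<pi> z = fst (\<Psi> (z, 0))" for z
  define g where "g z = m (\<pi> z)" for z
  define H where "H z v = m' (\<pi> z) (fst (\<Psi>' (z, 0) (v, 0)))" for z v
  have N: "\<pi> z \<in> frontier \<Omega>" "\<pi> z \<in> U" "?d z = snd (\<Psi> (z, 0))" "(z, 0) \<in> V" "z = \<pi> z + ?d z *\<^sub>R g z"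
    "dist p0 (\<pi> z) \<le> 2 * dist p0 z" if "z \<in> ball p0 e" for z
    using near[OF that] by (auto simp: \<pi>_def g_def)
  have d1: "((\<lambda>z. \<Psi> (z, 0)) has_derivative (\<lambda>v. \<Psi>' (z, 0) (v, 0))) (at z)" if "z \<in> ball p0 e" for z
    by (rule has_derivative_compose[where g=\<Psi> and x=z and f="\<lambda>z. (z,0)"])
      (auto intro!: derivative_eq_intros d\<Psi> N(4)[OF that])
  have "has_jet (ball p0 e) ?d g H" unfolding has_jet_def
  proof (intro conjI ballI allI open_ball)
    fix z assume z: "z \<in> ball p0 e"
    have "(\<pi> has_derivative (\<lambda>v. fst (\<Psi>' (z, 0) (v, 0)))) (at z)"
      unfolding \<pi>_def[abs_def] by (rule has_derivative_fst[OF d1[OF z]])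
    from has_derivative_compose[where g=m and f=\<pi> and x=z, OF this dm[OF N(2)[OF z]]]
    show "(g has_derivative H z) (at z)" by (simp add: g_def[abs_def] H_def[abs_def])
    \<comment> \<open>Pairing the first coordinate of
      \<open>D (\<Psi> (z, 0)) (a, s) = (v, 0)\<close> with the unit normal leaves only
      \<open>s\<close>: the second coordinate makes \<open>a\<close> tangential, and
      \<open>m'\<close> takes values orthogonal to \<open>m\<close>.\<close>
    have "snd (\<Psi>' (z, 0) (v, 0)) = g z \<bullet> v" for v
    proof -
      obtain a s where as: "\<Psi>' (z, 0) (v, 0) = (a, s)" by fastforce
      have S: "\<Psi> (z, 0) \<in> ?S" using \<Psi>V N(4)[OF z] by blast
      have "D (\<Psi> (z, 0)) (a, s) = (v, 0)"
        using bij\<Psi>[OF N(4)[OF z]] as by (metis Aapp[OF S] bij_is_surj inv\<Psi>[OF N(4)[OF z]] surj_f_inv_f)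
      then have v: "a + (?d z *\<^sub>R m' (\<pi> z) a + s *\<^sub>R g z) = v" "G (\<pi> z) \<bullet> a = 0"
        by (simp_all add: D_def \<pi>_def N(3)[OF z] g_def)
      have "norm (G (\<pi> z)) * (g z \<bullet> a) = 0" using v(2) by (subst (asm) Gm) (simp add: g_def)
      then have "g z \<bullet> a = 0" using G0[OF N(2)[OF z]] by simp
      moreover have "g z \<bullet> g z = 1" using m1[OF N(2)[OF z]] by (simp add: g_def norm_eq_1)
      moreover have "g z \<bullet> m' (\<pi> z) a = 0" using mm'[OF N(2)[OF z]] by (simp add: g_def)
      ultimately have "g z \<bullet> v = s" by (simp add: v(1)[symmetric] inner_add_right)
      then show ?thesis using as by simp
    qed
    then have "((\<lambda>z. snd (\<Psi> (z, 0))) has_derivative (\<lambda>v. g z \<bullet> v)) (at z)"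
      using has_derivative_snd[OF d1[OF z]] by simp
    then show "(?d has_derivative (\<lambda>v. g z \<bullet> v)) (at z)"
      by (rule has_derivative_transform_within_open[OF _ open_ball z]) (simp add: N(3))
  next
    fix v
    have "continuous_on (ball p0 e) \<pi>"
      unfolding \<pi>_def[abs_def] using d1 has_derivative_continuous
      by (intro continuous_on_fst continuous_at_imp_continuous_on) blast
    then show "continuous_on (ball p0 e) (\<lambda>z. H z v)" unfolding H_def
      using N(2,4) by (intro cm'2 continuous_on_fst continuous_on_compose2[OF c\<Psi>'] continuous_intros) auto
  qed
  moreover have "norm (g z) = 1 \<and> z - ?d z *\<^sub>R g z \<in> frontier \<Omega> \<inter> ball p0 (2 * dist p0 z + e/4)"
    if z: "z \<in> ball p0 e" for z
  proof -
    have eq: "z - ?d z *\<^sub>R g z = \<pi> z" using N(5)[OF z] by (metis add_diff_cancel_right')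
    have "dist p0 (\<pi> z) < 2 * dist p0 z + e/4" using N(6)[OF z] e by linarith
    then show ?thesis unfolding eq using m1[OF N(2)[OF z]] N(1)[OF z] by (simp add: g_def)
  qed
  \<comment> \<open>The quarter radius keeps the foot point inside \<open>ball p0 e\<close>, where
    the construction applies again; a boundary point has height 0 and is its own foot point.\<close>
  moreover have "g (z - ?d z *\<^sub>R g z) = g z" if z: "z \<in> ball p0 (e/4)" for z
  proof -
    have ze: "z \<in> ball p0 e" using z e by auto
    have eq: "z - ?d z *\<^sub>R g z = \<pi> z" using N(5)[OF ze] by (metis add_diff_cancel_right')
    have pe: "\<pi> z \<in> ball p0 e" using N(6)[OF ze] z e by auto
    have "?d (\<pi> z) = 0"
      using N(1)[OF ze] O by (simp add: signed_dist_def bdist_def frontier_def interior_open)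
    then have "\<pi> (\<pi> z) = \<pi> z" using N(5)[OF pe] by simp
    then show ?thesis unfolding eq by (simp add: g_def)
  qed
  ultimately show ?thesis by (rule that[OF e])
qed

text \<open>The local tubes cover the compact frontier, hence a neighbourhood of uniform width. The
  closed collar times the unit sphere is compact too, which bounds the Hessian.\<close>

lemma tube:
  fixes \<Omega> :: "(complex^'n::finite) set"
  assumes O: "open \<Omega>" "\<Omega> \<noteq> {}" "bounded \<Omega>" and C2: "C2_boundary \<Omega>"
  obtains e M where "e > 0" "has_jet {z. bdist \<Omega> z < e} (signed_dist \<Omega>) (grad (signed_dist \<Omega>)) (hess (signed_dist \<Omega>))"
    "\<And>z. bdist \<Omega> z < e \<Longrightarrow> norm (grad (signed_dist \<Omega>) z) = 1"
    "\<And>z. bdist \<Omega> z < e \<Longrightarrow> z - signed_dist \<Omega> z *\<^sub>R grad (signed_dist \<Omega>) z \<in> frontier \<Omega>"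
    "\<And>z. bdist \<Omega> z < e \<Longrightarrow>
      grad (signed_dist \<Omega>) (z - signed_dist \<Omega> z *\<^sub>R grad (signed_dist \<Omega>) z) = grad (signed_dist \<Omega>) z"
    "M > 0" "\<And>z v. bdist \<Omega> z < e \<Longrightarrow> norm (hess (signed_dist \<Omega>) z v) \<le> M * norm v"
proof -
  let ?d = "signed_dist \<Omega>" and ?F = "frontier \<Omega>"
  have cF: "compact ?F" using O(3) by (simp add: compact_frontier_bounded)
  have Fne: "?F \<noteq> {}" using O frontier_eq_empty[of \<Omega>] not_bounded_UNIV by auto
  have "\<exists>W. open W \<and> p \<in> W \<and> has_jet W ?d (grad ?d) (hess ?d) \<and>
     (\<forall>z\<in>W. norm (grad ?d z) = 1 \<and> z - ?d z *\<^sub>R grad ?d z \<in> ?F \<and> grad ?d (z - ?d z *\<^sub>R grad ?d z) = grad ?d z)"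
    if p: "p \<in> ?F" for p
  proof -
    obtain e g H where e: "e > 0" and J: "has_jet (ball p e) ?d g H"
      and a: "\<And>z. z \<in> ball p e \<Longrightarrow> norm (g z) = 1 \<and> z - ?d z *\<^sub>R g z \<in> ?F \<inter> ball p (2 * dist p z + e/4)"
      and b: "\<And>z. z \<in> ball p (e/4) \<Longrightarrow> g (z - ?d z *\<^sub>R g z) = g z"
      using local_tube[OF O(1) C2 p] by metis
    have gr: "grad ?d z = g z" if "z \<in> ball p e" for z using has_jet_unique(1)[OF J that] .
    have sub: "ball p (e/4) \<subseteq> ball p e" using e by (intro subset_ball) simp
    have "norm (grad ?d z) = 1 \<and> z - ?d z *\<^sub>R grad ?d z \<in> ?F \<and> grad ?d (z - ?d z *\<^sub>R grad ?d z) = grad ?d z"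
      if z: "z \<in> ball p (e/4)" for z
    proof -
      have ze: "z \<in> ball p e" using z sub by blast
      have "dist p (z - ?d z *\<^sub>R g z) < 2 * dist p z + e/4" using a[OF ze] by simp
      then have "z - ?d z *\<^sub>R g z \<in> ball p e" using z e by simp
      then show ?thesis using a[OF ze] b[OF z] gr ze by simp
    qed
    moreover have "has_jet (ball p (e/4)) ?d (grad ?d) (hess ?d)"
      by (rule has_jet_canonical[OF has_jet_subset[OF J open_ball sub]])
    ultimately show ?thesis using e by (intro exI[of _ "ball p (e/4)"]) auto
  qed
  then obtain W where W: "\<And>p. p \<in> ?F \<Longrightarrow> open (W p) \<and> p \<in> W p \<and> has_jet (W p) ?d (grad ?d) (hess ?d) \<and>
     (\<forall>z\<in>W p. norm (grad ?d z) = 1 \<and> z - ?d z *\<^sub>R grad ?d z \<in> ?F \<and> grad ?d (z - ?d z *\<^sub>R grad ?d z) = grad ?d z)"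
    by metis
  define X where "X = (\<Union>p\<in>?F. W p)"
  have X: "open X" "?F \<subseteq> X" unfolding X_def using W by blast+
  have JX: "has_jet X ?d (grad ?d) (hess ?d)"
    by (rule has_jet_glue[OF _ X(1)]) (use W in \<open>unfold X_def, blast\<close>)
  obtain e where e: "e > 0" "{z. infdist z ?F \<le> e} \<subseteq> X"
    using compact_in_open_separated[OF Fne cF X] by blast
  have opn: "open {z. bdist \<Omega> z < e}"
    unfolding bdist_def by (intro open_Collect_less continuous_intros)
  have sub: "{z. bdist \<Omega> z < e} \<subseteq> X" using e by (auto simp: bdist_def)
  have "compact {z. infdist z ?F \<le> e}" by (rule compact_infdist_le[OF Fne cF e(1)])
  then have "compact ({z. infdist z ?F \<le> e} \<times> sphere (0::complex^'n) 1)" by (intro compact_Times compact_sphere)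
  moreover have "continuous_on ({z. infdist z ?F \<le> e} \<times> sphere (0::complex^'n) 1) (\<lambda>q. hess ?d (fst q) (snd q))"
    by (rule continuous_on_hess_app[OF JX]) (use e in \<open>auto intro!: continuous_intros\<close>)
  ultimately have "bounded ((\<lambda>q. hess ?d (fst q) (snd q)) ` ({z. infdist z ?F \<le> e} \<times> sphere (0::complex^'n) 1))"
    using compact_continuous_image compact_imp_bounded by blast
  then obtain M where M: "M > 0" "\<And>z v. infdist z ?F \<le> e \<Longrightarrow> norm v = 1 \<Longrightarrow> norm (hess ?d z v) \<le> M"
    unfolding bounded_pos by force
  have bnd: "norm (hess ?d z v) \<le> M * norm v" if "bdist \<Omega> z < e" for z v
  proof (cases "v = 0")
    case True
    have "linear (hess ?d z)" using has_jet_linear[OF JX] sub that by blast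
    then show ?thesis using True by (simp add: linear_0)
  next
    case False
    have lin: "linear (hess ?d z)" using has_jet_linear[OF JX] sub that by blast
    have "norm (hess ?d z (v /\<^sub>R norm v)) \<le> M" using that False by (intro M(2)) (auto simp: bdist_def)
    then show ?thesis using False by (simp add: linear_cmul[OF lin] divide_simps mult.commute)
  qed
  have all: "norm (grad ?d z) = 1 \<and> z - ?d z *\<^sub>R grad ?d z \<in> ?F \<and> grad ?d (z - ?d z *\<^sub>R grad ?d z) = grad ?d z"
    if "bdist \<Omega> z < e" for z
    using sub that W unfolding X_def by blast
  show ?thesis
    by (rule that[OF e(1) has_jet_subset[OF JX opn sub] _ _ _ M(1) bnd]) (simp_all add: all)
qed

section \<open>The Levi form of the signed distance\<close>

locale collar =
  fixes \<Omega> :: "(complex^'n::finite) set" and e M :: real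
  assumes opn: "open \<Omega>" and nonempty: "\<Omega> \<noteq> {}" and bdd: "bounded \<Omega>" and e_pos: "e > 0" and M_pos: "M > 0"
    and jet: "has_jet {z. bdist \<Omega> z < e} (signed_dist \<Omega>) (grad (signed_dist \<Omega>)) (hess (signed_dist \<Omega>))"
    and norm_grad: "bdist \<Omega> z < e \<Longrightarrow> norm (grad (signed_dist \<Omega>) z) = 1"
    and foot: "bdist \<Omega> z < e \<Longrightarrow> z - signed_dist \<Omega> z *\<^sub>R grad (signed_dist \<Omega>) z \<in> frontier \<Omega>"
    and grad_foot: "bdist \<Omega> z < e \<Longrightarrow>
      grad (signed_dist \<Omega>) (z - signed_dist \<Omega> z *\<^sub>R grad (signed_dist \<Omega>) z) = grad (signed_dist \<Omega>) z"
    and hess_bound: "bdist \<Omega> z < e \<Longrightarrow> norm (hess (signed_dist \<Omega>) z v) \<le> M * norm v"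
begin

abbreviation "\<delta> \<equiv> signed_dist \<Omega>"
abbreviation "g \<equiv> grad \<delta>"
abbreviation "H \<equiv> hess \<delta>"

lemma frontier_bdist: "p \<in> frontier \<Omega> \<Longrightarrow> bdist \<Omega> p = 0"
  by (simp add: bdist_def)

lemma frontier_collar: "p \<in> frontier \<Omega> \<Longrightarrow> bdist \<Omega> p < e"
  using e_pos by (simp add: frontier_bdist)

lemma abs_signed_dist: "\<bar>\<delta> z\<bar> = bdist \<Omega> z"
  using infdist_nonneg[of z "frontier \<Omega>"] by (simp add: signed_dist_def bdist_def)

lemma linear_H: "bdist \<Omega> z < e \<Longrightarrow> linear (H z)"
  using has_jet_linear[OF jet] by simp

lemma H_sym: "bdist \<Omega> z < e \<Longrightarrow> H z u \<bullet> v = u \<bullet> H z v"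
  using has_jet_symmetric[OF jet] by simp

text \<open>The gradient has constant length, so every derivative of it is orthogonal to it. By
  symmetry of the Hessian, \<open>H z (g z)\<close> is then orthogonal to itself.\<close>

lemma H_normal: "bdist \<Omega> z < e \<Longrightarrow> H z v \<bullet> g z = 0" and H_grad: "bdist \<Omega> z < e \<Longrightarrow> H z (g z) = 0"
proof -
  have *: "H z v \<bullet> g z = 0" if z: "bdist \<Omega> z < e" for z v
  proof -
    have mem: "z \<in> {z. bdist \<Omega> z < e}" using z by simp
    have "((\<lambda>x. g x \<bullet> g x) has_derivative (\<lambda>v. g z \<bullet> H z v + H z v \<bullet> g z)) (at z)"
      by (rule has_derivative_inner[OF has_jetD(3)[OF jet mem] has_jetD(3)[OF jet mem]])
    moreover have "((\<lambda>x. g x \<bullet> g x) has_derivative (\<lambda>v. 0)) (at z)"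
      by (rule has_derivative_transform_within_open[OF has_derivative_const has_jetD(1)[OF jet] mem])
        (use norm_grad in \<open>simp add: norm_eq_1\<close>)
    ultimately have "(\<lambda>v. g z \<bullet> H z v + H z v \<bullet> g z) = (\<lambda>v. 0)" by (rule has_derivative_unique)
    from fun_cong[OF this, of v] have "g z \<bullet> H z v + H z v \<bullet> g z = 0" .
    then show ?thesis by (simp add: inner_commute)
  qed
  show "bdist \<Omega> z < e \<Longrightarrow> H z v \<bullet> g z = 0" using * .
  assume z: "bdist \<Omega> z < e"
  have "H z (g z) \<bullet> H z (g z) = g z \<bullet> H z (H z (g z))" by (rule H_sym[OF z])
  then show "H z (g z) = 0" using *[OF z] by (simp add: inner_commute)
qed

text \<open>Differentiate the identity that the gradient is constant along normals.\<close>

lemma H_foot: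
  assumes z: "bdist \<Omega> z < e"
  shows "H z v = H (z - \<delta> z *\<^sub>R g z) v - \<delta> z *\<^sub>R H (z - \<delta> z *\<^sub>R g z) (H z v)"
proof -
  let ?N = "{z. bdist \<Omega> z < e}" and ?p = "z - \<delta> z *\<^sub>R g z"
  have mem: "z \<in> ?N" using z by simp
  have p: "bdist \<Omega> ?p < e" using frontier_collar[OF foot[OF z]] .
  then have pm: "?p \<in> ?N" by simp
  have "((\<lambda>x. x - \<delta> x *\<^sub>R g x) has_derivative (\<lambda>v. v - (\<delta> z *\<^sub>R H z v + (g z \<bullet> v) *\<^sub>R g z))) (at z)"
    by (rule has_derivative_diff[OF has_derivative_ident has_derivative_scaleR[OF has_jetD(2)[OF jet mem] has_jetD(3)[OF jet mem]]])
  from has_derivative_compose[where g=g and x=z and f="\<lambda>x. x - \<delta> x *\<^sub>R g x", OF this has_jetD(3)[OF jet pm]]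
  have 1: "((\<lambda>x. g (x - \<delta> x *\<^sub>R g x)) has_derivative (\<lambda>v. H ?p (v - (\<delta> z *\<^sub>R H z v + (g z \<bullet> v) *\<^sub>R g z)))) (at z)" .
  have "((\<lambda>x. g (x - \<delta> x *\<^sub>R g x)) has_derivative H z) (at z)"
    by (rule has_derivative_transform_within_open[OF has_jetD(3)[OF jet mem] has_jetD(1)[OF jet] mem])
      (rule grad_foot[symmetric], simp)
  then have "H z v = H ?p (v - (\<delta> z *\<^sub>R H z v + (g z \<bullet> v) *\<^sub>R g z))"
    by (rule fun_cong[OF has_derivative_unique[OF 1, symmetric]])
  also have "\<dots> = H ?p v - (\<delta> z *\<^sub>R H ?p (H z v) + (g z \<bullet> v) *\<^sub>R H ?p (g z))"
    by (simp add: linear_diff[OF linear_H[OF p]] linear_add[OF linear_H[OF p]] linear_cmul[OF linear_H[OF p]])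
  also have "H ?p (g z) = 0" using H_grad[OF p] grad_foot[OF z] by simp
  finally show ?thesis unfolding scaleR_zero_right add_0_right .
qed

end

lemma collar_exists:
  fixes \<Omega> :: "(complex^'n::finite) set"
  assumes "open \<Omega>" "\<Omega> \<noteq> {}" "bounded \<Omega>" "C2_boundary \<Omega>"
  obtains e M where "collar \<Omega> e M"
proof (rule tube[OF assms])
  fix e M assume "e > 0" "has_jet {z. bdist \<Omega> z < e} (signed_dist \<Omega>) (grad (signed_dist \<Omega>)) (hess (signed_dist \<Omega>))"
    "\<And>z. bdist \<Omega> z < e \<Longrightarrow> norm (grad (signed_dist \<Omega>) z) = 1"
    "\<And>z. bdist \<Omega> z < e \<Longrightarrow> z - signed_dist \<Omega> z *\<^sub>R grad (signed_dist \<Omega>) z \<in> frontier \<Omega>"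
    "\<And>z. bdist \<Omega> z < e \<Longrightarrow>
      grad (signed_dist \<Omega>) (z - signed_dist \<Omega> z *\<^sub>R grad (signed_dist \<Omega>) z) = grad (signed_dist \<Omega>) z"
    "M > 0" "\<And>z v. bdist \<Omega> z < e \<Longrightarrow> norm (hess (signed_dist \<Omega>) z v) \<le> M * norm v"
  then have "collar \<Omega> e M" using assms by unfold_locales
  then show thesis by (rule that)
qed

section \<open>Complex linear algebra in real coordinates\<close>

lemma inner_i_smult: "x \<bullet> (\<i> *s y) = - ((\<i> *s x) \<bullet> (y::complex^'n::finite))"
  by (simp add: inner_vec_def inner_complex_def sum_negf[symmetric] algebra_simps)

lemma i_smult_inner_i_smult [simp]: "(\<i> *s x) \<bullet> (\<i> *s y) = x \<bullet> (y::complex^'n::finite)"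
  by (simp add: inner_vec_def inner_complex_def algebra_simps)

lemma sum_mult_cnj: "(\<Sum>j\<in>UNIV. X $ j * cnj (Y $ j)) = Complex (X \<bullet> Y) (X \<bullet> (\<i> *s (Y::complex^'n::finite)))"
  by (simp add: complex_eq_iff inner_vec_def inner_complex_def algebra_simps)

text \<open>The complex-linear part of a real-linear map. For the Hessian its matrix entries are, up
  to conjugation and a factor 2, the mixed Wirtinger derivatives.\<close>

definition clin :: "((complex^'n::finite) \<Rightarrow> complex^'n) \<Rightarrow> complex^'n \<Rightarrow> complex^'n" where
  "clin A v = (1/2) *\<^sub>R (A v - \<i> *s A (\<i> *s v))"

lemma linear_smult: "linear (\<lambda>w::complex^'n::finite. c *s w)"
  using bounded_linear_smult bounded_linear.linear by blast

lemma clin_smult: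
  assumes "linear A"
  shows "clin A (c *s v) = c *s clin A v"
proof -
  have c: "x = Re c *\<^sub>R y + Im c *\<^sub>R (\<i> *s y)" if "x = c *s y" for x y :: "complex^'n"
    using that by (simp add: vec_eq_iff complex_eq_iff)
  have l: "linear (clin A)"
    unfolding clin_def[abs_def]
    by (intro linear_compose_scale_right linear_compose_sub assms linear_compose[unfolded o_def, OF _ linear_smult]
        linear_compose[unfolded o_def, OF linear_smult])
  have i: "clin A (\<i> *s v) = \<i> *s clin A v"
    by (simp add: clin_def linear_neg[OF assms] linear_diff[OF linear_smult] linear_cmul[OF linear_smult])
  show ?thesis
    unfolding c[OF refl, of v] c[OF refl, of "clin A v"] by (simp add: linear_add[OF l] linear_cmul[OF l] i)
qed

lemma clin_expand:
  assumes "linear A"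
  shows "clin A v $ j = (\<Sum>k\<in>UNIV. v $ k * (clin A (axis k 1) $ j))"
proof -
  have l: "linear (clin A)"
    unfolding clin_def[abs_def]
    by (intro linear_compose_scale_right linear_compose_sub assms linear_compose[unfolded o_def, OF _ linear_smult]
        linear_compose[unfolded o_def, OF linear_smult])
  have "v = (\<Sum>k\<in>UNIV. v $ k *s axis k 1)" by (simp add: basis_expansion)
  then have "clin A v = clin A (\<Sum>k\<in>UNIV. v $ k *s axis k 1)" by simp
  also have "\<dots> = (\<Sum>k\<in>UNIV. clin A (v $ k *s axis k 1))" by (rule linear_sum[OF l])
  finally have "clin A v = (\<Sum>k\<in>UNIV. clin A (v $ k *s axis k 1))" .
  then show ?thesis by (simp add: clin_smult[OF assms])
qed

definition tang :: "complex^'n::finite \<Rightarrow> complex^'n \<Rightarrow> bool" where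
  "tang N \<tau> \<longleftrightarrow> \<tau> \<bullet> N = 0 \<and> (\<i> *s \<tau>) \<bullet> N = 0"

text \<open>With \<open>N\<close> the gradient and \<open>A\<close> the Hessian of the signed
  distance, this is sixteen times the squared modulus of \<alpha> on \<tau>. It is the squared
  modulus of the mixed entry of the Levi form between \<tau> and the unit complex normal.\<close>

definition beta2 :: "complex^'n::finite \<Rightarrow> (complex^'n \<Rightarrow> complex^'n) \<Rightarrow> complex^'n \<Rightarrow> real" where
  "beta2 N A \<tau> = (A \<tau> \<bullet> (\<i> *s N))\<^sup>2 + (A (\<i> *s \<tau>) \<bullet> (\<i> *s N))\<^sup>2"

section \<open>Wirtinger derivatives of the signed distance in terms of its gradient and
  Hessian\<close>

context collar begin

lemma sdist_derivative:
  assumes "bdist \<Omega> z < e"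
  shows "frechet_derivative (sdist \<Omega>) (at z) = (\<lambda>v. complex_of_real (g z \<bullet> v))"
  by (rule frechet_derivative_at[symmetric],
      rule bounded_linear.has_derivative[OF bounded_linear_of_real])
    (use has_jetD(2)[OF jet] assms in simp)

lemma dz_sdist: "bdist \<Omega> z < e \<Longrightarrow> dz j (sdist \<Omega>) z = cnj (g z $ j) / 2"
  and dzbar_sdist: "bdist \<Omega> z < e \<Longrightarrow> dzbar j (sdist \<Omega>) z = g z $ j / 2"
  by (simp_all add: dz_def dzbar_def sdist_derivative inner_axis complex_eq_iff inner_complex_def)

lemma dzbar_dz_sdist:
  assumes z: "bdist \<Omega> z < e"
  shows "dzbar k (dz j (sdist \<Omega>)) z = cnj (clin (H z) (axis k 1) $ j) / 2"
proof -
  have mem: "z \<in> {z. bdist \<Omega> z < e}" using z by simp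
  have bl: "bounded_linear (\<lambda>x::complex^'n. cnj (x $ j) / 2)"
    by (intro bounded_linear_compose[OF bounded_linear_divide]
        bounded_linear_compose[OF bounded_linear_cnj] bounded_linear_vec_nth)
  have "(dz j (sdist \<Omega>) has_derivative (\<lambda>v. cnj (H z v $ j) / 2)) (at z)"
    by (rule has_derivative_transform_within_open[OF bounded_linear.has_derivative[OF bl has_jetD(3)[OF jet mem]]
        has_jetD(1)[OF jet] mem]) (simp add: dz_sdist)
  then have "frechet_derivative (dz j (sdist \<Omega>)) (at z) = (\<lambda>v. cnj (H z v $ j) / 2)"
    by (rule frechet_derivative_at[symmetric])
  moreover have "axis k \<i> = \<i> *s axis k (1::complex)" by (simp add: vec_eq_iff axis_def)
  ultimately show ?thesis by (simp add: dzbar_def clin_def complex_eq_iff)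
qed

lemma sum_dzbar_dz_sdist:
  assumes z: "bdist \<Omega> z < e"
  shows "(\<Sum>k\<in>UNIV. dzbar k (dz j (sdist \<Omega>)) z * cnj (Y $ k)) = cnj (clin (H z) Y $ j) / 2"
  by (subst clin_expand[OF linear_H[OF z]])
    (simp add: dzbar_dz_sdist[OF z] sum_divide_distrib mult.commute)

lemma complex_hessian_sdist:
  assumes z: "bdist \<Omega> z < e"
  shows "complex_hessian (sdist \<Omega>) z X Y =
    Complex (H z Y \<bullet> X + H z (\<i> *s Y) \<bullet> (\<i> *s X)) (H z (\<i> *s Y) \<bullet> X - H z Y \<bullet> (\<i> *s X)) / 4"
proof -
  have "complex_hessian (sdist \<Omega>) z X Y =
      (\<Sum>j\<in>UNIV. X $ j * (\<Sum>k\<in>UNIV. dzbar k (dz j (sdist \<Omega>)) z * cnj (Y $ k)))"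
    unfolding complex_hessian_def by (simp add: sum_distrib_left mult_ac)
  also have "\<dots> = (\<Sum>j\<in>UNIV. X $ j * cnj (clin (H z) Y $ j)) / 2"
    by (simp add: sum_dzbar_dz_sdist[OF z] sum_divide_distrib)
  also have "\<dots> = Complex (X \<bullet> clin (H z) Y) (X \<bullet> (\<i> *s clin (H z) Y)) / 2" by (simp only: sum_mult_cnj)
  finally show ?thesis
    by (simp add: complex_eq_iff clin_def inner_diff_right inner_i_smult inner_commute field_simps)
qed

lemma Re_complex_hessian_sdist:
  "bdist \<Omega> z < e \<Longrightarrow> Re (complex_hessian (sdist \<Omega>) z X X) = levi_trace (H z) X / 4"
  by (simp add: complex_hessian_sdist levi_trace_def)

lemma T10_iff:
  assumes z: "bdist \<Omega> z < e"
  shows "\<tau> \<in> T10 \<Omega> z \<longleftrightarrow> tang (g z) \<tau>"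
proof -
  have "(\<Sum>j\<in>UNIV. dz j (sdist \<Omega>) z * \<tau> $ j) = (\<Sum>j\<in>UNIV. \<tau> $ j * cnj (g z $ j)) / 2"
    by (simp add: dz_sdist[OF z] sum_divide_distrib mult.commute)
  also have "\<dots> = Complex (\<tau> \<bullet> g z) (\<tau> \<bullet> (\<i> *s g z)) / 2" by (simp only: sum_mult_cnj)
  finally show ?thesis by (auto simp: T10_def tang_def complex_eq_iff inner_i_smult)
qed

text \<open>The sum defining \<alpha> is the inner product of the gradient with the complex-linear
  part of the Hessian. Its half \<open>H z v\<close> is orthogonal to the gradient, so only the
  rotated half survives.\<close>

lemma alpha_eq:
  assumes z: "bdist \<Omega> z < e"
  shows "alpha \<Omega> z v = (H z (\<i> *s v) \<bullet> (\<i> *s g z)) / 2"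
proof -
  have "alpha \<Omega> z v = Re (\<Sum>j\<in>UNIV. g z $ j * cnj (clin (H z) v $ j))"
  proof -
    have "Re (a / 2 * (b / 2)) = Re (a * b) / 4" for a b :: complex by simp
    then show ?thesis
      unfolding alpha_def by (simp only: dzbar_sdist[OF z] sum_dzbar_dz_sdist[OF z] Re_sum sum_divide_distrib[symmetric])
  qed
  also have "\<dots> = g z \<bullet> clin (H z) v" by (simp add: sum_mult_cnj)
  also have "\<dots> = (H z (\<i> *s v) \<bullet> (\<i> *s g z)) / 2"
    using H_normal[OF z, of v] by (simp add: clin_def inner_diff_right inner_i_smult inner_commute)
  finally show ?thesis .
qed

text \<open>The 16 is the square of \<open>2 * 2\<close>: one factor 2 comes from
  \<open>alpha_eq\<close>, the other from the passage to (1,0)-vectors in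
  \<open>on_10\<close>.\<close>

lemma cmod_on_10_alpha:
  assumes z: "bdist \<Omega> z < e"
  shows "(cmod (on_10 (alpha \<Omega> z) \<tau>))\<^sup>2 = beta2 (g z) (H z) \<tau> / 16"
  unfolding on_10_def alpha_eq[OF z] beta2_def
  by (simp add: cmod_power2 linear_neg[OF linear_H[OF z]] power_divide)

lemma hnorm_eq: "hnorm X = norm X / sqrt 2" for X :: "complex^'n"
  by (simp add: hnorm_def norm_vec_def L2_set_def real_sqrt_divide)

end

lemma levi_trace_add:
  assumes "linear A" and sym: "\<And>u v. A u \<bullet> v = u \<bullet> A v"
  shows "levi_trace A (x + y) = levi_trace A x + 2 * (A x \<bullet> y + A (\<i> *s x) \<bullet> (\<i> *s y)) + levi_trace A y"
proof -
  have "A y \<bullet> x = A x \<bullet> y" "A (\<i> *s y) \<bullet> (\<i> *s x) = A (\<i> *s x) \<bullet> (\<i> *s y)"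
    using sym by (simp_all add: inner_commute)
  then show ?thesis
    by (simp add: levi_trace_def linear_add[OF linear_smult] linear_add[OF assms(1)] inner_add_left inner_add_right)
qed

lemma levi_trace_scaleR:
  assumes "linear A"
  shows "levi_trace A (c *\<^sub>R x) = c\<^sup>2 * levi_trace A x"
  by (simp add: levi_trace_def linear_cmul[OF linear_smult] linear_cmul[OF assms] power2_eq_square algebra_simps)

lemma beta2_scaleR:
  assumes "linear A"
  shows "beta2 N A (c *\<^sub>R x) = c\<^sup>2 * beta2 N A x"
  by (simp add: beta2_def linear_cmul[OF linear_smult] linear_cmul[OF assms] power_mult_distrib algebra_simps)

lemma tang_scaleR: "tang N x \<Longrightarrow> tang N (c *\<^sub>R x)"
  by (simp add: tang_def linear_cmul[OF linear_smult])

lemma tang_add: "tang N x \<Longrightarrow> tang N y \<Longrightarrow> tang N (x + y)"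
  by (simp add: tang_def linear_add[OF linear_smult] inner_add_left)

lemma tang_i_smult: "tang N x \<Longrightarrow> tang N (\<i> *s x)"
  by (simp add: tang_def)

text \<open>For small steps the linear term wins: \<open>t = - a / c\<close> with
  \<open>c > b\<close> would give a negative value. This serves to polarize a nonnegative form at a
  null vector.\<close>

lemma real_linear_coeff_eq_0:
  fixes a b :: real
  assumes "\<And>t. 0 \<le> 2 * t * a + t\<^sup>2 * b"
  shows "a = 0"
proof (rule ccontr)
  assume a: "a \<noteq> 0"
  define c where "c = \<bar>b\<bar> + 1"
  have c: "c > 0" "b < c" by (auto simp: c_def)
  have "2 * (- a / c) * a + (- a / c)\<^sup>2 * b = (a\<^sup>2 / c) * (b / c - 2)"
    using c by (simp add: field_simps power2_eq_square)
  also have "\<dots> < 0" using a c by (intro mult_pos_neg) (auto simp: field_simps)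
  finally show False using assms[of "- a / c"] by simp
qed

section \<open>Levi-null directions and the supremum of \<alpha>\<close>

context collar begin

lemma levi_trace_nonneg:
  assumes "pseudoconvex \<Omega>" "p \<in> frontier \<Omega>" "tang (g p) \<tau>"
  shows "0 \<le> levi_trace (H p) \<tau>"
proof -
  have p: "bdist \<Omega> p < e" using frontier_collar[OF assms(2)] .
  have "0 \<le> Re (complex_hessian (sdist \<Omega>) p \<tau> \<tau>)"
    using assms T10_iff[OF p] unfolding pseudoconvex_def by blast
  then show ?thesis using Re_complex_hessian_sdist[OF p] by simp
qed

text \<open>A nonnegative Hermitian form that vanishes on \<tau> pairs to 0 with every \<theta>:
  perturbing to \<open>\<tau> + s \<theta>\<close> kills the real part of the pairing, and replacing
  \<theta> by \<open>\<i> *s \<theta>\<close> kills the imaginary part.\<close>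

lemma levi_nullI:
  assumes psc: "pseudoconvex \<Omega>" and pF: "p \<in> frontier \<Omega>" and t: "tang (g p) \<tau>" and null: "levi_trace (H p) \<tau> = 0"
  shows "\<tau> \<in> levi_null \<Omega> p"
proof -
  have p: "bdist \<Omega> p < e" using frontier_collar[OF pF] .
  note lin = linear_H[OF p] and sym = H_sym[OF p]
  have S: "H p \<tau> \<bullet> \<theta> + H p (\<i> *s \<tau>) \<bullet> (\<i> *s \<theta>) = 0" if th: "tang (g p) \<theta>" for \<theta>
  proof (rule real_linear_coeff_eq_0)
    fix s :: real
    have "0 \<le> levi_trace (H p) (\<tau> + s *\<^sub>R \<theta>)"
      by (intro levi_trace_nonneg[OF psc pF] tang_add t tang_scaleR th)
    also have "\<dots> = 2 * s * (H p \<tau> \<bullet> \<theta> + H p (\<i> *s \<tau>) \<bullet> (\<i> *s \<theta>)) + s\<^sup>2 * levi_trace (H p) \<theta>"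
      by (simp add: levi_trace_add[OF lin sym] null levi_trace_scaleR[OF lin] linear_cmul[OF linear_smult] algebra_simps)
    finally show "0 \<le> 2 * s * (H p \<tau> \<bullet> \<theta> + H p (\<i> *s \<tau>) \<bullet> (\<i> *s \<theta>)) + s\<^sup>2 * levi_trace (H p) \<theta>" .
  qed
  have "complex_hessian (sdist \<Omega>) p \<tau> \<theta> = 0" if th: "\<theta> \<in> T10 \<Omega> p" for \<theta>
  proof -
    have th': "tang (g p) \<theta>" using th T10_iff[OF p] by simp
    have 1: "H p \<theta> \<bullet> \<tau> + H p (\<i> *s \<theta>) \<bullet> (\<i> *s \<tau>) = 0"
      using S[OF th'] by (metis sym inner_commute)
    have "H p \<tau> \<bullet> (\<i> *s \<theta>) + H p (\<i> *s \<tau>) \<bullet> (\<i> *s (\<i> *s \<theta>)) = 0"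
      by (rule S[OF tang_i_smult[OF th']])
    then have 2: "H p (\<i> *s \<theta>) \<bullet> \<tau> - H p \<theta> \<bullet> (\<i> *s \<tau>) = 0"
      using sym[of \<tau> "\<i> *s \<theta>"] sym[of "\<i> *s \<tau>" \<theta>] by (simp add: inner_commute)
    show ?thesis unfolding complex_hessian_sdist[OF p] using 1 2 by (simp add: complex_eq_iff)
  qed
  then show ?thesis using t T10_iff[OF p] unfolding levi_null_def by blast
qed

text \<open>A nonzero tangential vector with vanishing Levi form excludes strict pseudoconvexity, so
  \<open>alpha_sup\<close> is given by the supremum, and by \<open>levi_nullI\<close> the vector
  takes part in it.\<close>

lemma alpha_sup_ge:
  assumes psc: "pseudoconvex \<Omega>" and pF: "p \<in> frontier \<Omega>" and t: "tang (g p) \<tau>"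
    and null: "levi_trace (H p) \<tau> = 0" and nz: "\<tau> \<noteq> 0"
  shows "ereal (sqrt (beta2 (g p) (H p) \<tau>) / 4 / hnorm \<tau>) \<le> alpha_sup \<Omega>"
proof -
  have p: "bdist \<Omega> p < e" using frontier_collar[OF pF] .
  have mem: "\<tau> \<in> levi_null \<Omega> p - {0}" using levi_nullI[OF psc pF t null] nz by simp
  have "\<not> strictly_pseudoconvex \<Omega>"
    unfolding strictly_pseudoconvex_def using pF mem T10_iff[OF p] t nz Re_complex_hessian_sdist[OF p, of \<tau>] null by force
  then have "alpha_sup \<Omega> = (SUP p\<in>{p\<in>frontier \<Omega>. levi_null \<Omega> p \<noteq> {0}}.
              SUP \<tau>\<in>levi_null \<Omega> p - {0}. ereal (cmod (on_10 (alpha \<Omega> p) \<tau>) / hnorm \<tau>))"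
    by (simp add: alpha_sup_def)
  moreover have "ereal (cmod (on_10 (alpha \<Omega> p) \<tau>) / hnorm \<tau>) \<le> \<dots>"
    using mem pF by (intro SUP_upper2[of p] SUP_upper2[of \<tau>]) auto
  moreover have "cmod (on_10 (alpha \<Omega> p) \<tau>) = sqrt (beta2 (g p) (H p) \<tau>) / 4"
  proof -
    have "cmod (on_10 (alpha \<Omega> p) \<tau>) = sqrt (beta2 (g p) (H p) \<tau> / 16)"
      by (rule real_sqrt_unique[symmetric]) (simp_all add: cmod_on_10_alpha[OF p])
    then show ?thesis by (simp add: real_sqrt_divide)
  qed
  ultimately show ?thesis by simp
qed

text \<open>In the extended reals an empty supremum is \<open>-\<infinity>\<close>. Failure of
  strict pseudoconvexity, together with pseudoconvexity, supplies a nonzero null vector, so the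
  supremum is over a nonempty set of nonnegative numbers.\<close>

lemma alpha_sup_nonneg:
  assumes psc: "pseudoconvex \<Omega>"
  shows "0 \<le> alpha_sup \<Omega>"
proof (cases "strictly_pseudoconvex \<Omega>")
  case True
  then show ?thesis by (simp add: alpha_sup_def)
next
  case False
  then obtain p \<tau> where p: "p \<in> frontier \<Omega>" "\<tau> \<in> T10 \<Omega> p" "\<tau> \<noteq> 0"
    "\<not> 0 < Re (complex_hessian (sdist \<Omega>) p \<tau> \<tau>)"
    unfolding strictly_pseudoconvex_def by blast
  have pe: "bdist \<Omega> p < e" using frontier_collar[OF p(1)] .
  have t: "tang (g p) \<tau>" using p(2) T10_iff[OF pe] by simp
  have "levi_trace (H p) \<tau> = 0"
    using levi_trace_nonneg[OF psc p(1) t] p(4) Re_complex_hessian_sdist[OF pe, of \<tau>] by simp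
  from alpha_sup_ge[OF psc p(1) t this p(3)]
  have "ereal (sqrt (beta2 (g p) (H p) \<tau>) / 4 / hnorm \<tau>) \<le> alpha_sup \<Omega>" .
  moreover have "0 \<le> sqrt (beta2 (g p) (H p) \<tau>) / 4 / hnorm \<tau>"
    by (simp add: hnorm_eq beta2_def)
  ultimately show ?thesis by (metis ereal_less_eq(5) order_trans)
qed

text \<open>The root of \<open>beta2\<close> is \<open>4 |\<alpha>(\<tau>)|\<close>, and
  \<open>hnorm\<close> is the Euclidean norm over \<open>sqrt 2\<close>; the 8 is the square of
  \<open>4 / sqrt 2\<close>.\<close>

lemma beta2_null_le:
  assumes psc: "pseudoconvex \<Omega>" and pF: "p \<in> frontier \<Omega>" and t: "tang (g p) \<tau>"
    and null: "levi_trace (H p) \<tau> = 0" and A: "alpha_sup \<Omega> \<le> ereal A"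
  shows "beta2 (g p) (H p) \<tau> \<le> 8 * A\<^sup>2 * (norm \<tau>)\<^sup>2"
proof (cases "\<tau> = 0")
  case True
  have "linear (H p)" using linear_H[OF frontier_collar[OF pF]] .
  then show ?thesis using True by (simp add: beta2_def linear_0 linear_0[OF linear_smult])
next
  case False
  have "ereal (sqrt (beta2 (g p) (H p) \<tau>) / 4 / hnorm \<tau>) \<le> ereal A"
    using alpha_sup_ge[OF psc pF t null False] A by (rule order_trans)
  then have "sqrt (beta2 (g p) (H p) \<tau>) / 4 / hnorm \<tau> \<le> A" by simp
  then have "sqrt (beta2 (g p) (H p) \<tau>) \<le> 4 * A * (norm \<tau> / sqrt 2)"
    using False by (simp add: hnorm_eq field_simps)
  then have "(sqrt (beta2 (g p) (H p) \<tau>))\<^sup>2 \<le> (4 * A * (norm \<tau> / sqrt 2))\<^sup>2"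
    by (intro power_mono) (auto simp: beta2_def)
  then show ?thesis by (simp add: beta2_def power_mult_distrib power_divide)
qed

text \<open>Away from the Levi-null directions the Levi form is bounded below by compactness.\<close>

lemma beta2_le_levi_trace:
  assumes psc: "pseudoconvex \<Omega>" and A: "alpha_sup \<Omega> \<le> ereal A" and b: "8 * A\<^sup>2 < b"
  obtains C where "C \<ge> 0"
    "\<And>p \<tau>. p \<in> frontier \<Omega> \<Longrightarrow> tang (g p) \<tau> \<Longrightarrow> beta2 (g p) (H p) \<tau> \<le> b * (norm \<tau>)\<^sup>2 + C * levi_trace (H p) \<tau>"
proof -
  let ?F = "frontier \<Omega>" and ?N = "{z. bdist \<Omega> z < e}"
  define K where "K = ?F \<times> sphere (0::complex^'n) 1"
  \<comment> \<open>Unit tangential vectors on which \<open>beta2\<close> is at least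
    \<open>b\<close>. As \<open>b > 8 * A^2\<close>, this compact set contains no Levi-null vector,
    so \<open>beta2\<close> over the Levi form has a maximum on it, which becomes \<open>C\<close>.
    Off this set the term with \<open>b\<close> alone suffices.\<close>
  define S where "S = {q \<in> K. snd q \<bullet> g (fst q) = 0 \<and> (\<i> *s snd q) \<bullet> g (fst q) = 0 \<and> b \<le> beta2 (g (fst q)) (H (fst q)) (snd q)}"
  have cF: "compact ?F" using bdd by (simp add: compact_frontier_bounded)
  have cK: "compact K" unfolding K_def by (intro compact_Times cF compact_sphere)
  have FN: "?F \<subseteq> ?N" using frontier_collar by auto
  have cg: "continuous_on K (\<lambda>q. g (fst q))"
    by (rule continuous_on_compose2[OF has_jet_continuous_on(2)[OF jet]]) (use FN in \<open>auto simp: K_def intro!: continuous_intros\<close>)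
  have ci: "continuous_on T (\<lambda>q. \<i> *s h q)" if "continuous_on T h" for h :: "(complex^'n) \<times> (complex^'n) \<Rightarrow> complex^'n" and T
    by (rule bounded_linear.continuous_on[OF bounded_linear_smult that])
  have cH: "continuous_on K (\<lambda>q. H (fst q) (h q))" if "continuous_on K h" for h
    by (rule continuous_on_hess_app[OF jet _ that]) (use FN in \<open>auto simp: K_def intro!: continuous_intros\<close>)
  have cs: "continuous_on K snd" by (intro continuous_intros)
  have cb: "continuous_on K (\<lambda>q. beta2 (g (fst q)) (H (fst q)) (snd q))"
    unfolding beta2_def by (intro continuous_intros cH ci cg cs)
  have cl: "continuous_on K (\<lambda>q. levi_trace (H (fst q)) (snd q))"
    unfolding levi_trace_def by (intro continuous_intros cH ci cs)
  have "closedin (top_of_set K) (K \<inter> (\<lambda>q. snd q \<bullet> g (fst q)) -` {0})"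
    "closedin (top_of_set K) (K \<inter> (\<lambda>q. (\<i> *s snd q) \<bullet> g (fst q)) -` {0})"
    "closedin (top_of_set K) (K \<inter> (\<lambda>q. beta2 (g (fst q)) (H (fst q)) (snd q)) -` {b..})"
    by (intro continuous_closedin_preimage continuous_intros cb cg ci cs closed_singleton closed_atLeast)+
  then have "closedin (top_of_set K) (K \<inter> (\<lambda>q. snd q \<bullet> g (fst q)) -` {0} \<inter> (K \<inter> (\<lambda>q. (\<i> *s snd q) \<bullet> g (fst q)) -` {0})
    \<inter> (K \<inter> (\<lambda>q. beta2 (g (fst q)) (H (fst q)) (snd q)) -` {b..}))" by (rule closedin_Int[OF closedin_Int])
  also have "(K \<inter> (\<lambda>q. snd q \<bullet> g (fst q)) -` {0} \<inter> (K \<inter> (\<lambda>q. (\<i> *s snd q) \<bullet> g (fst q)) -` {0})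
    \<inter> (K \<inter> (\<lambda>q. beta2 (g (fst q)) (H (fst q)) (snd q)) -` {b..})) = S" by (auto simp: S_def)
  finally have cS: "compact S" using closedin_compact[OF cK] by blast
  have SK: "S \<subseteq> K" by (auto simp: S_def)
  have pos: "0 < levi_trace (H (fst q)) (snd q)" if q: "q \<in> S" for q
  proof -
    have *: "fst q \<in> ?F" "norm (snd q) = 1" "tang (g (fst q)) (snd q)" "b \<le> beta2 (g (fst q)) (H (fst q)) (snd q)"
      using q by (auto simp: S_def K_def tang_def)
    have "levi_trace (H (fst q)) (snd q) \<noteq> 0"
      using beta2_null_le[OF psc *(1,3) _ A] *(2,4) b by force
    then show ?thesis using levi_trace_nonneg[OF psc *(1,3)] by simp
  qed
  obtain C where C: "C \<ge> 0" "\<And>q. q \<in> S \<Longrightarrow> beta2 (g (fst q)) (H (fst q)) (snd q) \<le> C * levi_trace (H (fst q)) (snd q)"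
  proof (cases "S = {}")
    case True
    then show ?thesis using that[of 0] by simp
  next
    case False
    have "continuous_on S (\<lambda>q. beta2 (g (fst q)) (H (fst q)) (snd q) / levi_trace (H (fst q)) (snd q))"
      using pos by (intro continuous_on_divide continuous_on_subset[OF cb SK] continuous_on_subset[OF cl SK]) force
    from continuous_attains_sup[OF cS False this] obtain q0 where q0: "q0 \<in> S"
      "\<And>q. q \<in> S \<Longrightarrow> beta2 (g (fst q)) (H (fst q)) (snd q) / levi_trace (H (fst q)) (snd q)
        \<le> beta2 (g (fst q0)) (H (fst q0)) (snd q0) / levi_trace (H (fst q0)) (snd q0)" by blast
    show ?thesis
    proof (rule that)
      show "0 \<le> beta2 (g (fst q0)) (H (fst q0)) (snd q0) / levi_trace (H (fst q0)) (snd q0)"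
        using pos[OF q0(1)] by (simp add: beta2_def)
    qed (use q0(2) pos in \<open>simp add: pos_divide_le_eq\<close>)
  qed
  have "beta2 (g p) (H p) \<tau> \<le> b * (norm \<tau>)\<^sup>2 + C * levi_trace (H p) \<tau>" if pF: "p \<in> ?F" and t: "tang (g p) \<tau>" for p \<tau>
  proof (cases "\<tau> = 0")
    case True
    have "linear (H p)" using linear_H[OF frontier_collar[OF pF]] .
    then show ?thesis using True by (simp add: beta2_def levi_trace_def linear_0 linear_0[OF linear_smult])
  next
    case False
    have lin: "linear (H p)" using linear_H[OF frontier_collar[OF pF]] .
    define u where "u = \<tau> /\<^sub>R norm \<tau>"
    have u: "norm u = 1" "tang (g p) u" "\<tau> = norm \<tau> *\<^sub>R u" using False t by (auto simp: u_def tang_scaleR)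
    have "0 \<le> 8 * A\<^sup>2" by simp
    then have b0: "0 \<le> b" using b by linarith
    have T0: "0 \<le> C * levi_trace (H p) u" using C(1) levi_trace_nonneg[OF psc pF u(2)] by simp
    have "beta2 (g p) (H p) u \<le> b + C * levi_trace (H p) u"
    proof (cases "b \<le> beta2 (g p) (H p) u")
      case True
      then have "(p, u) \<in> S" using u pF by (auto simp: S_def K_def tang_def)
      then show ?thesis using C(2)[of "(p, u)"] b0 by simp
    next
      case False
      then show ?thesis using T0 by simp
    qed
    then have "(norm \<tau>)\<^sup>2 * beta2 (g p) (H p) u \<le> (norm \<tau>)\<^sup>2 * (b + C * levi_trace (H p) u)"
      by (rule mult_left_mono) simp
    then have "beta2 (g p) (H p) (norm \<tau> *\<^sub>R u) \<le> b * (norm \<tau>)\<^sup>2 + C * levi_trace (H p) (norm \<tau> *\<^sub>R u)"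
      by (simp add: beta2_scaleR[OF lin] levi_trace_scaleR[OF lin] algebra_simps)
    then show ?thesis using u(3) by simp
  qed
  with C(1) show ?thesis by (rule that)
qed

end

section \<open>The Levi form near the boundary\<close>

text \<open>The right-hand side is \<open>(x + b)^2 - \<eta> (x + y)^2\<close>, a convex parabola in
  \<open>x\<close>, and the left-hand side is its exact minimum.\<close>

lemma complete_square_bound:
  fixes x b y \<eta> :: real
  assumes "\<eta> < 1"
  shows "- (\<eta> / (1 - \<eta>)) * (b - y)\<^sup>2 \<le> x\<^sup>2 + 2 * x * b + b\<^sup>2 - \<eta> * (x + y)\<^sup>2"
proof -
  have "x\<^sup>2 + 2 * x * b + b\<^sup>2 - \<eta> * (x + y)\<^sup>2 + (\<eta> / (1 - \<eta>)) * (b - y)\<^sup>2 = ((1 - \<eta>) * x + b - \<eta> * y)\<^sup>2 / (1 - \<eta>)"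
    using assms by (simp add: divide_simps) (simp add: power2_eq_square algebra_simps)
  moreover have "0 \<le> ((1 - \<eta>) * x + b - \<eta> * y)\<^sup>2 / (1 - \<eta>)" using assms by simp
  ultimately show ?thesis by linarith
qed

lemma square_add_scaled_le:
  fixes a m d :: real
  assumes "0 \<le> d"
  shows "(a + d * m)\<^sup>2 \<le> (1 + d) * a\<^sup>2 + (d + d\<^sup>2) * m\<^sup>2"
proof -
  have "0 \<le> d * (a - m)\<^sup>2" using assms by simp
  then show ?thesis by (simp add: power2_eq_square algebra_simps)
qed

lemma half_square_le:
  fixes x y :: real
  shows "x\<^sup>2 / 2 - y\<^sup>2 \<le> (x + y)\<^sup>2"
proof -
  have "0 \<le> (x + 2 * y)\<^sup>2" by simp
  then show ?thesis by (simp add: power2_eq_square algebra_simps)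
qed

lemma square_diff_le:
  fixes b y :: real
  shows "(b - y)\<^sup>2 \<le> 2 * b\<^sup>2 + 2 * y\<^sup>2"
proof -
  have "0 \<le> (b + y)\<^sup>2" by simp
  then show ?thesis by (simp add: power2_eq_square algebra_simps)
qed

lemma inner_i_smult_self [simp]: "(\<i> *s u) \<bullet> u = 0" "u \<bullet> (\<i> *s u) = 0" for u :: "complex^'n::finite"
  using inner_i_smult[of u u] by (simp_all add: inner_commute)

lemma norm_i_smult [simp]: "norm (\<i> *s u) = norm (u::complex^'n::finite)"
  by (simp add: norm_eq_sqrt_inner)

lemma complex_Cauchy_Schwarz:
  "(z \<bullet> u)\<^sup>2 + (z \<bullet> (\<i> *s u))\<^sup>2 \<le> (norm z)\<^sup>2 * (norm (u::complex^'n::finite))\<^sup>2"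
proof -
  define S where "S = (z \<bullet> u)\<^sup>2 + (z \<bullet> (\<i> *s u))\<^sup>2"
  define v where "v = (z \<bullet> u) *\<^sub>R u + (z \<bullet> (\<i> *s u)) *\<^sub>R (\<i> *s u)"
  have S0: "0 \<le> S" by (simp add: S_def)
  have zv: "z \<bullet> v = S" by (simp add: v_def S_def inner_add_right power2_eq_square)
  have vv: "v \<bullet> v = S * (u \<bullet> u)"
    by (simp add: v_def S_def inner_add_right inner_add_left power2_eq_square algebra_simps)
  have "(z \<bullet> v)\<^sup>2 \<le> (z \<bullet> z) * (v \<bullet> v)" by (rule Cauchy_Schwarz_ineq)
  then have "S * S \<le> S * ((z \<bullet> z) * (u \<bullet> u))"
    by (simp add: zv vv power2_eq_square mult_ac)
  then have "S * S \<le> S * ((norm z)\<^sup>2 * (norm u)\<^sup>2)" by (simp only: power2_norm_eq_inner)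
  then have "S \<le> (norm z)\<^sup>2 * (norm u)\<^sup>2 \<or> S = 0" using S0 by (cases "S = 0") (simp_all add: mult_le_cancel_left)
  then show ?thesis unfolding S_def[symmetric] by (auto simp: mult_nonneg_nonneg)
qed

text \<open>The quadratic form of the Levi form of \<open>-(-\<rho>)\<^sup>\<eta>\<close> in the decomposition into a complex tangential
  part of square length \<open>t\<close> and a normal part \<open>d x\<close>, at distance \<open>d\<close> from the boundary.\<close>

lemma quadratic_form_nonneg:
  fixes x1 x2 b1 b2 y1 y2 m1 m2 t T d \<eta> \<eta>1 K s \<theta> \<kappa> C c1 c2 c3 :: real
  assumes d: "0 < d" and eta: "0 < \<eta>" "\<eta> * (1 + d) \<le> \<eta>1 - \<theta>" "\<eta>1 < 1" "0 < \<theta>" and t: "0 \<le> t" and T: "0 \<le> T"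
    and b: "b1\<^sup>2 + b2\<^sup>2 \<le> s\<^sup>2 * t + C * T + c2 * d * t" and y: "y1\<^sup>2 + y2\<^sup>2 \<le> s\<^sup>2 * t"
    and m: "\<eta> * (d + d\<^sup>2) * (m1\<^sup>2 + m2\<^sup>2) \<le> c1 * d * (x1\<^sup>2 + x2\<^sup>2)"
    and kappa: "4 * K - 4 * (\<eta>1 / (1 - \<eta>1)) * s\<^sup>2 = 2 * \<kappa>" and th: "\<theta> * s\<^sup>2 \<le> \<kappa>"
    and d1: "2 * (\<eta>1 / (1 - \<eta>1)) * C \<le> 1 / d"
    and d2: "(c3 + 2 * (\<eta>1 / (1 - \<eta>1)) * c2) * d \<le> \<kappa>" and d3: "(M + c1) * d \<le> \<theta> / 2"
  shows "0 \<le> T / d + (b1\<^sup>2 + b2\<^sup>2) - c3 * d * t + 2 * (x1 * b1 + x2 * b2) - M * d * (x1\<^sup>2 + x2\<^sup>2) + (x1\<^sup>2 + x2\<^sup>2)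
    + 4 * K * t - \<eta> * ((x1 + y1 + d * m1)\<^sup>2 + (x2 + y2 + d * m2)\<^sup>2)"
proof -
  define q where "q = \<eta>1 / (1 - \<eta>1)"
  define X where "X = x1\<^sup>2 + x2\<^sup>2"
  define R where "R = (x1 + y1)\<^sup>2 + (x2 + y2)\<^sup>2"
  define D where "D = (b1 - y1)\<^sup>2 + (b2 - y2)\<^sup>2"
  have X0: "0 \<le> X" and R0: "0 \<le> R" by (simp_all add: X_def R_def)
  have eta1: "0 < \<eta>1" using eta d by (smt (verit) mult_pos_pos)
  then have q0: "0 \<le> q" using eta by (simp add: q_def)
  have 1: "\<eta> * ((x1 + y1 + d * m1)\<^sup>2 + (x2 + y2 + d * m2)\<^sup>2) \<le> (\<eta>1 - \<theta>) * R + c1 * d * X"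
  proof -
    have "\<eta> * ((x1 + y1 + d * m1)\<^sup>2 + (x2 + y2 + d * m2)\<^sup>2) \<le> \<eta> * ((1 + d) * R + (d + d\<^sup>2) * (m1\<^sup>2 + m2\<^sup>2))"
      unfolding R_def
      using square_add_scaled_le[of d "x1 + y1" m1] square_add_scaled_le[of d "x2 + y2" m2] d eta(1)
      by (intro mult_left_mono) (simp_all add: algebra_simps)
    also have "\<dots> = (\<eta> * (1 + d)) * R + \<eta> * (d + d\<^sup>2) * (m1\<^sup>2 + m2\<^sup>2)" by (simp add: algebra_simps)
    also have "\<dots> \<le> (\<eta>1 - \<theta>) * R + c1 * d * X"
      using m mult_right_mono[OF eta(2) R0] by (simp add: X_def)
    finally show ?thesis .
  qed
  have 2: "- q * D \<le> X + 2 * (x1 * b1 + x2 * b2) + (b1\<^sup>2 + b2\<^sup>2) - \<eta>1 * R"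
    using complete_square_bound[OF eta(3), of b1 y1 x1] complete_square_bound[OF eta(3), of b2 y2 x2]
    by (simp add: q_def[symmetric] D_def X_def R_def algebra_simps)
  \<comment> \<open>Up to the terms in \<open>C\<close> and \<open>c2\<close>, both \<open>b\<close>
    and \<open>y\<close> have square length at most \<open>s^2 t\<close>, so
    \<open>(b - y)^2\<close> costs \<open>4 s^2 t\<close>, the same as the triangle inequality.
    Bounding both by one \<open>s\<close> is the balanced choice of \<open>K\<close>.\<close>
  have D: "D \<le> 4 * s\<^sup>2 * t + 2 * C * T + 2 * c2 * d * t"
    using square_diff_le[of b1 y1] square_diff_le[of b2 y2] b y by (simp add: D_def algebra_simps)
  have qD: "q * D \<le> q * (4 * s\<^sup>2 * t + 2 * C * T + 2 * c2 * d * t)" by (rule mult_left_mono[OF D q0])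
  \<comment> \<open>The margin \<theta> between \<open>\<eta> * (1 + d)\<close> and
    \<open>\<eta>1\<close> leaves \<open>\<theta> * R\<close> over. Comparing \<open>R\<close> with
    \<open>X / 2\<close> turns it into a multiple of \<open>X\<close>, which pays for the errors
    \<open>M * d * X\<close> and \<open>c1 * d * X\<close>.\<close>
  have R: "X / 2 - s\<^sup>2 * t \<le> R"
    using half_square_le[of x1 y1] half_square_le[of x2 y2] y by (simp add: X_def R_def add_divide_distrib)
  have tR: "\<theta> * (X / 2 - s\<^sup>2 * t) \<le> \<theta> * R" by (rule mult_left_mono[OF R]) (use eta in simp)
  have kt: "(4 * K - 4 * q * s\<^sup>2) * t = 2 * \<kappa> * t" using kappa by (simp add: q_def)
  have tht: "\<theta> * s\<^sup>2 * t \<le> \<kappa> * t" by (rule mult_right_mono[OF th t])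
  have d2t: "(c3 + 2 * q * c2) * d * t \<le> \<kappa> * t" using mult_right_mono[OF d2 t] by (simp add: q_def)
  have d3X: "(M + c1) * d * X \<le> \<theta> / 2 * X" by (rule mult_right_mono[OF d3 X0])
  \<comment> \<open>The factor \<open>1 / d\<close> lets the boundary Levi form outweigh any fixed
    multiple of itself; this absorbs the term that measures the deviation from Levi-null
    directions.\<close>
  have d1T: "2 * q * C * T \<le> T / d" using mult_right_mono[OF d1 T] by (simp add: q_def)
  have "T / d + (b1\<^sup>2 + b2\<^sup>2) - c3 * d * t + 2 * (x1 * b1 + x2 * b2) - M * d * X + X
    + 4 * K * t - \<eta> * ((x1 + y1 + d * m1)\<^sup>2 + (x2 + y2 + d * m2)\<^sup>2)
    \<ge> T / d - c3 * d * t - M * d * X + 4 * K * t - q * D + \<theta> * R - c1 * d * X"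
    using 1 2 by (simp add: algebra_simps)
  moreover have "T / d - c3 * d * t - M * d * X + 4 * K * t - q * D + \<theta> * R - c1 * d * X \<ge> 0"
    using qD tR kt tht d2t d3X d1T by (simp add: algebra_simps)
  ultimately show ?thesis unfolding X_def by linarith
qed

context collar begin

text \<open>Put \<open>W = H p (H z v)\<close>, so that \<open>H z v = H p v + d W\<close>. By
  symmetry \<open>W . v\<close> equals \<open>H z v . H p v\<close>, which is
  \<open>|H z v|^2\<close> up to an error of order \<open>d\<close>. So the gain is a genuine
  square, whatever the sign of the Hessian. The powers of \<open>M\<close> bound the
  remainders.\<close>

lemma hess_compare:
  assumes z: "bdist \<Omega> z < e" and d: "\<delta> z = - d" "0 \<le> d"
  defines "p \<equiv> z - \<delta> z *\<^sub>R g z"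
  shows "H p v \<bullet> v + d * (norm (H z v))\<^sup>2 - d\<^sup>2 * M ^ 3 * (norm v)\<^sup>2 \<le> H z v \<bullet> v"
    and "norm u = 1 \<Longrightarrow> (H z v \<bullet> u)\<^sup>2 \<le> (H p v \<bullet> u)\<^sup>2 + (2 * d * M ^ 3 + d\<^sup>2 * M ^ 4) * (norm v)\<^sup>2"
proof -
  have p: "bdist \<Omega> p < e" using frontier_collar[OF foot[OF z]] by (simp add: p_def)
  have eq: "H z v = H p v + d *\<^sub>R H p (H z v)"
    using H_foot[OF z, of v, folded p_def] by (simp only: d(1) scaleR_minus_left diff_minus_eq_add)
  define W where "W = H p (H z v)"
  have eq': "H p v = H z v - d *\<^sub>R W" using eq unfolding W_def[symmetric] by (simp add: algebra_simps)
  have nz: "norm (H z v) \<le> M * norm v" by (rule hess_bound[OF z])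
  have np: "norm (H p v) \<le> M * norm v" by (rule hess_bound[OF p])
  have "norm W \<le> M * norm (H z v)" unfolding W_def by (rule hess_bound[OF p])
  also have "\<dots> \<le> M * (M * norm v)" using nz M_pos by simp
  finally have nW: "norm W \<le> M\<^sup>2 * norm v" by (simp add: power2_eq_square)
  have "W \<bullet> v = H z v \<bullet> H p v" unfolding W_def by (simp add: H_sym[OF p])
  also have "\<dots> = (norm (H z v))\<^sup>2 - d * (H z v \<bullet> W)"
    unfolding eq' by (simp add: inner_diff_right power2_norm_eq_inner)
  finally have Wv: "W \<bullet> v = (norm (H z v))\<^sup>2 - d * (H z v \<bullet> W)" .
  have "H z v \<bullet> W \<le> norm (H z v) * norm W" by (rule norm_cauchy_schwarz)
  also have "\<dots> \<le> (M * norm v) * (M\<^sup>2 * norm v)" using M_pos by (intro mult_mono nz nW) auto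
  also have "\<dots> = M ^ 3 * (norm v)\<^sup>2" by (simp add: power2_eq_square power3_eq_cube)
  finally have "d\<^sup>2 * (H z v \<bullet> W) \<le> d\<^sup>2 * (M ^ 3 * (norm v)\<^sup>2)" by (intro mult_left_mono) auto
  moreover have "H z v \<bullet> v = H p v \<bullet> v + d * (W \<bullet> v)"
    unfolding eq' by (simp add: inner_diff_left)
  ultimately show "H p v \<bullet> v + d * (norm (H z v))\<^sup>2 - d\<^sup>2 * M ^ 3 * (norm v)\<^sup>2 \<le> H z v \<bullet> v"
    by (simp add: Wv algebra_simps power2_eq_square)
  assume u: "norm u = 1"
  have a: "\<bar>H p v \<bullet> u\<bar> \<le> M * norm v" using Cauchy_Schwarz_ineq2[of "H p v" u] np u by simp
  have b: "\<bar>W \<bullet> u\<bar> \<le> M\<^sup>2 * norm v" using Cauchy_Schwarz_ineq2[of W u] nW u by simp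
  have "(H p v \<bullet> u) * (W \<bullet> u) \<le> \<bar>H p v \<bullet> u\<bar> * \<bar>W \<bullet> u\<bar>" by (metis abs_ge_self abs_mult)
  also have "\<dots> \<le> (M * norm v) * (M\<^sup>2 * norm v)" using M_pos by (intro mult_mono a b) auto
  also have "\<dots> = M ^ 3 * (norm v)\<^sup>2" by (simp add: power2_eq_square power3_eq_cube)
  finally have 1: "2 * d * ((H p v \<bullet> u) * (W \<bullet> u)) \<le> 2 * d * (M ^ 3 * (norm v)\<^sup>2)"
    using d by (intro mult_left_mono) auto
  have "(W \<bullet> u)\<^sup>2 \<le> (M\<^sup>2 * norm v)\<^sup>2" using b by (metis abs_le_square_iff abs_of_nonneg abs_ge_zero order_trans)
  also have "\<dots> = M ^ 4 * (norm v)\<^sup>2" by (simp add: power_mult_distrib flip: power_mult)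
  finally have 2: "d\<^sup>2 * (W \<bullet> u)\<^sup>2 \<le> d\<^sup>2 * (M ^ 4 * (norm v)\<^sup>2)" by (intro mult_left_mono) auto
  have "(H z v \<bullet> u)\<^sup>2 = (H p v \<bullet> u)\<^sup>2 + 2 * d * ((H p v \<bullet> u) * (W \<bullet> u)) + d\<^sup>2 * (W \<bullet> u)\<^sup>2"
    unfolding eq' by (simp add: inner_diff_left power2_eq_square algebra_simps)
  then show "(H z v \<bullet> u)\<^sup>2 \<le> (H p v \<bullet> u)\<^sup>2 + (2 * d * M ^ 3 + d\<^sup>2 * M ^ 4) * (norm v)\<^sup>2"
    using 1 2 by (simp add: algebra_simps)
qed

text \<open>At depth \<open>d\<close> the vector \<open>v\<close> is the gradient of
  \<open>- ln d + K |z|^2\<close>, and the first three terms are the \<open>levi_trace\<close> of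
  its Hessian. Splitting \<open>w\<close> into its complex tangential part \<tau> and complex normal
  part \<nu> reduces the claim to \<open>quadratic_form_nonneg\<close> with
  \<open>c1 = 2 s^2\<close>, \<open>c2 = 4 M^3 + 2 M^4\<close> and
  \<open>c3 = 2 M^3\<close>.\<close>

lemma levi_form_collar_bound:
  assumes z: "bdist \<Omega> z < e" and d: "\<delta> z = - d" "0 < d" and d1: "d \<le> 1" and nz: "norm z \<le> r" and rK: "0 \<le> K" "2 * K * r = s"
    and psc: "pseudoconvex \<Omega>" and C: "0 \<le> C"
    and beta: "\<And>p \<tau>. p \<in> frontier \<Omega> \<Longrightarrow> tang (g p) \<tau> \<Longrightarrow> beta2 (g p) (H p) \<tau> \<le> s\<^sup>2 * (norm \<tau>)\<^sup>2 + C * levi_trace (H p) \<tau>"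
    and eta: "0 < \<eta>" "\<eta> * (1 + d) \<le> \<eta>1 - \<theta>" "\<eta>1 < 1" "0 < \<theta>"
    and kappa: "4 * K - 4 * (\<eta>1 / (1 - \<eta>1)) * s\<^sup>2 = 2 * \<kappa>" and th: "\<theta> * s\<^sup>2 \<le> \<kappa>"
    and small: "2 * (\<eta>1 / (1 - \<eta>1)) * C \<le> 1 / d"
      "(2 * M ^ 3 + 2 * (\<eta>1 / (1 - \<eta>1)) * (4 * M ^ 3 + 2 * M ^ 4)) * d \<le> \<kappa>" "(M + 2 * s\<^sup>2) * d \<le> \<theta> / 2"
  defines "v \<equiv> g z /\<^sub>R d + (2 * K) *\<^sub>R z"
  shows "0 \<le> levi_trace (H z) w / d + ((g z \<bullet> w)\<^sup>2 + (g z \<bullet> (\<i> *s w))\<^sup>2) / d\<^sup>2 + 4 * K * (norm w)\<^sup>2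
    - \<eta> * ((v \<bullet> w)\<^sup>2 + (v \<bullet> (\<i> *s w))\<^sup>2)"
proof -
  define N where "N = g z"
  define p where "p = z - \<delta> z *\<^sub>R g z"
  have pF: "p \<in> frontier \<Omega>" unfolding p_def by (rule foot[OF z])
  have gp: "g p = N" unfolding p_def N_def by (rule grad_foot[OF z])
  have N1: "norm N = 1" unfolding N_def by (rule norm_grad[OF z])
  have NN: "N \<bullet> N = 1" using N1 by (simp add: norm_eq_1)
  note lin = linear_H[OF z] and sym = H_sym[OF z] and HN = H_normal[OF z, folded N_def] and HN' = H_grad[OF z, folded N_def]
  define s1 where "s1 = w \<bullet> N"
  define s2 where "s2 = w \<bullet> (\<i> *s N)"
  define \<nu> where "\<nu> = s1 *\<^sub>R N + s2 *\<^sub>R (\<i> *s N)"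
  define \<tau> where "\<tau> = w - \<nu>"
  have i\<nu>: "\<i> *s \<nu> = s1 *\<^sub>R (\<i> *s N) - s2 *\<^sub>R N"
    by (simp add: \<nu>_def linear_add[OF linear_smult] linear_cmul[OF linear_smult])
  have w: "w = \<tau> + \<nu>" by (simp add: \<tau>_def)
  have iwN: "(\<i> *s w) \<bullet> N = - s2" by (simp add: s2_def inner_i_smult)
  have iN: "\<tau> \<bullet> N = 0" "\<tau> \<bullet> (\<i> *s N) = 0"
    by (simp_all add: \<tau>_def \<nu>_def inner_diff_left inner_add_left NN s1_def s2_def)
  then have tang: "tang N \<tau>" by (simp add: tang_def inner_i_smult)
  then have itN: "(\<i> *s \<tau>) \<bullet> N = 0" by (simp add: tang_def)
  define t where "t = (norm \<tau>)\<^sup>2"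
  have n\<nu>: "\<nu> \<bullet> \<nu> = s1\<^sup>2 + s2\<^sup>2" by (simp add: \<nu>_def inner_add_left inner_add_right NN power2_eq_square)
  have t\<nu>: "\<tau> \<bullet> \<nu> = 0" using iN by (simp add: \<nu>_def inner_add_right)
  have nw: "(norm w)\<^sup>2 = t + (s1\<^sup>2 + s2\<^sup>2)"
    unfolding t_def power2_norm_eq_inner w n\<nu>[symmetric]
    using t\<nu> by (simp add: inner_add_left inner_add_right inner_commute[of \<nu> \<tau>])
  \<comment> \<open>Order and signs are matched to \<open>x1 = (N . w) / d\<close> and
    \<open>x2 = (N . iw) / d\<close>, so that the cross term becomes
    \<open>d (x1 b1 + x2 b2)\<close>.\<close>
  define b1 where "b1 = H z (\<i> *s \<tau>) \<bullet> (\<i> *s N)"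
  define b2 where "b2 = - (H z \<tau> \<bullet> (\<i> *s N))"
  have B: "b1\<^sup>2 + b2\<^sup>2 = beta2 N (H z) \<tau>" by (simp add: b1_def b2_def beta2_def)
  define x1 where "x1 = s1 / d"
  define x2 where "x2 = - s2 / d"
  define T where "T = levi_trace (H p) \<tau>"
  have T0: "0 \<le> T" unfolding T_def by (rule levi_trace_nonneg[OF psc pF]) (simp add: gp tang)
  have cross: "H z \<tau> \<bullet> \<nu> + H z (\<i> *s \<tau>) \<bullet> (\<i> *s \<nu>) = d * (x1 * b1 + x2 * b2)"
    unfolding i\<nu> using HN d(2) by (simp add: \<nu>_def inner_add_right inner_diff_right b1_def b2_def x1_def x2_def field_simps)
  \<comment> \<open>The Hessian annihilates \<open>N\<close>, so of the complex normal line only the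
    real direction \<open>\<i> *s N\<close> contributes. A crude bound is enough, because after
    \<open>s1 = d x1\<close>, \<open>s2 = - d x2\<close> and division by \<open>d\<close> it costs
    only \<open>M d (x1^2 + x2^2)\<close>.\<close>
  have tr\<nu>: "levi_trace (H z) \<nu> \<ge> - M * (s1\<^sup>2 + s2\<^sup>2)"
  proof -
    have H\<nu>: "H z \<nu> = s2 *\<^sub>R H z (\<i> *s N)" "H z (\<i> *s \<nu>) = s1 *\<^sub>R H z (\<i> *s N)"
      unfolding i\<nu> by (simp_all add: \<nu>_def linear_add[OF lin] linear_diff[OF lin] linear_cmul[OF lin] HN')
    have "levi_trace (H z) \<nu> = (s1\<^sup>2 + s2\<^sup>2) * (H z (\<i> *s N) \<bullet> (\<i> *s N))"
      unfolding levi_trace_def H\<nu> unfolding i\<nu>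
      by (simp add: \<nu>_def inner_add_right inner_diff_right HN power2_eq_square algebra_simps)
    moreover have "- M \<le> H z (\<i> *s N) \<bullet> (\<i> *s N)"
    proof -
      have "\<bar>H z (\<i> *s N) \<bullet> (\<i> *s N)\<bar> \<le> norm (H z (\<i> *s N)) * norm (\<i> *s N)" by (rule Cauchy_Schwarz_ineq2)
      also have "\<dots> \<le> M" using hess_bound[OF z, of "\<i> *s N"] N1 by simp
      finally show ?thesis by simp
    qed
    then have "(s1\<^sup>2 + s2\<^sup>2) * (- M) \<le> (s1\<^sup>2 + s2\<^sup>2) * (H z (\<i> *s N) \<bullet> (\<i> *s N))"
      by (rule mult_left_mono) simp
    ultimately show ?thesis by (simp add: algebra_simps)
  qed
  note cmp = hess_compare[OF z d(1) less_imp_le[OF d(2)], folded p_def]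
  have H2: "(H z u \<bullet> (\<i> *s N))\<^sup>2 \<le> (norm (H z u))\<^sup>2" for u
  proof -
    have "\<bar>H z u \<bullet> (\<i> *s N)\<bar> \<le> norm (H z u)" using Cauchy_Schwarz_ineq2[of "H z u" "\<i> *s N"] N1 by simp
    then show ?thesis by (metis abs_le_square_iff abs_norm_cancel)
  qed
  have tr\<tau>: "T + d * (b1\<^sup>2 + b2\<^sup>2) - 2 * M ^ 3 * d\<^sup>2 * t \<le> levi_trace (H z) \<tau>"
  proof -
    have "d * (b1\<^sup>2 + b2\<^sup>2) \<le> d * ((norm (H z \<tau>))\<^sup>2 + (norm (H z (\<i> *s \<tau>)))\<^sup>2)"
      unfolding b1_def b2_def using H2[of \<tau>] H2[of "\<i> *s \<tau>"] d(2) by (intro mult_left_mono) auto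
    then show ?thesis
      using cmp(1)[of \<tau>] cmp(1)[of "\<i> *s \<tau>"] by (simp add: levi_trace_def T_def t_def algebra_simps)
  qed
  have bound: "b1\<^sup>2 + b2\<^sup>2 \<le> s\<^sup>2 * t + C * T + (4 * M ^ 3 + 2 * M ^ 4) * d * t"
  proof -
    have "b1\<^sup>2 + b2\<^sup>2 \<le> beta2 N (H p) \<tau> + 2 * (2 * d * M ^ 3 + d\<^sup>2 * M ^ 4) * t"
      using cmp(2)[of "\<i> *s N" \<tau>] cmp(2)[of "\<i> *s N" "\<i> *s \<tau>"] N1
      by (simp add: B beta2_def t_def algebra_simps)
    also have "\<dots> \<le> s\<^sup>2 * t + C * T + 2 * (2 * d * M ^ 3 + d\<^sup>2 * M ^ 4) * t"
      using beta[OF pF, of \<tau>] by (simp add: gp tang t_def T_def)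
    finally have 1: "b1\<^sup>2 + b2\<^sup>2 \<le> s\<^sup>2 * t + C * T + 2 * (2 * d * M ^ 3 + d\<^sup>2 * M ^ 4) * t" .
    have "d\<^sup>2 * (M ^ 4 * t) \<le> d * (M ^ 4 * t)"
      using d1 d(2) M_pos by (intro mult_right_mono) (auto simp: power2_eq_square mult_left_le t_def)
    then show ?thesis using 1 by (simp add: algebra_simps)
  qed
  define y1 where "y1 = (2 * K) * (z \<bullet> \<tau>)"
  define y2 where "y2 = (2 * K) * (z \<bullet> (\<i> *s \<tau>))"
  have Kz: "(2 * K)\<^sup>2 * (norm z)\<^sup>2 \<le> s\<^sup>2"
  proof -
    have "(2 * K) * norm z \<le> s" using mult_left_mono[OF nz, of "2 * K"] rK by simp
    then have "((2 * K) * norm z)\<^sup>2 \<le> s\<^sup>2" using rK by (intro power_mono) auto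
    then show ?thesis by (simp add: power_mult_distrib)
  qed
  have KzX: "(2 * K)\<^sup>2 * ((z \<bullet> u)\<^sup>2 + (z \<bullet> (\<i> *s u))\<^sup>2) \<le> s\<^sup>2 * (norm u)\<^sup>2" for u
  proof -
    have "(2 * K)\<^sup>2 * ((z \<bullet> u)\<^sup>2 + (z \<bullet> (\<i> *s u))\<^sup>2) \<le> (2 * K)\<^sup>2 * ((norm z)\<^sup>2 * (norm u)\<^sup>2)"
      by (intro mult_left_mono complex_Cauchy_Schwarz) simp
    also have "\<dots> \<le> s\<^sup>2 * (norm u)\<^sup>2" using mult_right_mono[OF Kz, of "(norm u)\<^sup>2"] by (simp add: mult.assoc)
    finally show ?thesis .
  qed
  have y: "y1\<^sup>2 + y2\<^sup>2 \<le> s\<^sup>2 * t"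
    using KzX[of \<tau>] by (simp add: y1_def y2_def t_def power_mult_distrib distrib_left)
  \<comment> \<open>\<open>d m1\<close> and \<open>d m2\<close> are what the normal part of
    \<open>w\<close> contributes to \<open>2 K z . w\<close> and \<open>2 K z . iw\<close>; the pair
    is a complex product, so its square length factors.\<close>
  define m1 where "m1 = (2 * K) * (x1 * (z \<bullet> N) - x2 * (z \<bullet> (\<i> *s N)))"
  define m2 where "m2 = (2 * K) * (x1 * (z \<bullet> (\<i> *s N)) + x2 * (z \<bullet> N))"
  have m: "\<eta> * (d + d\<^sup>2) * (m1\<^sup>2 + m2\<^sup>2) \<le> 2 * s\<^sup>2 * d * (x1\<^sup>2 + x2\<^sup>2)"
  proof -
    have "m1\<^sup>2 + m2\<^sup>2 = (2 * K)\<^sup>2 * ((z \<bullet> N)\<^sup>2 + (z \<bullet> (\<i> *s N))\<^sup>2) * (x1\<^sup>2 + x2\<^sup>2)"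
      unfolding m1_def m2_def by (simp add: power2_eq_square algebra_simps)
    also have "\<dots> \<le> s\<^sup>2 * (x1\<^sup>2 + x2\<^sup>2)"
      using KzX[of N] N1 by (intro mult_right_mono) auto
    finally have 1: "m1\<^sup>2 + m2\<^sup>2 \<le> s\<^sup>2 * (x1\<^sup>2 + x2\<^sup>2)" .
    have "\<eta> * (1 + d) \<le> 1" using eta by simp
    moreover have "\<eta> * 1 \<le> \<eta> * (1 + d)" using d(2) eta(1) by (intro mult_left_mono) auto
    ultimately have "\<eta> * 1 \<le> 1" by linarith
    moreover have "d\<^sup>2 \<le> d" using d d1 by (simp add: power2_eq_square mult_left_le)
    ultimately have 2: "\<eta> * (d + d\<^sup>2) \<le> 2 * d" using mult_mono[of \<eta> 1 "d + d\<^sup>2" "2 * d"] d(2) eta(1) by simp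
    have "\<eta> * (d + d\<^sup>2) * (m1\<^sup>2 + m2\<^sup>2) \<le> (2 * d) * (s\<^sup>2 * (x1\<^sup>2 + x2\<^sup>2))"
      by (rule mult_mono[OF 2 1]) (use d(2) in auto)
    then show ?thesis by (simp add: algebra_simps)
  qed
  have Nw: "N \<bullet> w = d * x1" "N \<bullet> (\<i> *s w) = d * x2"
    using d(2) iwN by (simp_all add: x1_def x2_def s1_def inner_commute)
  have s12: "s1 = d * x1" "s2 = - d * x2" using d(2) by (simp_all add: x1_def x2_def)
  have vw: "v \<bullet> w = x1 + y1 + d * m1"
  proof -
    have "v \<bullet> w = x1 + (2 * K) * (z \<bullet> w)"
      using Nw d(2) by (simp add: v_def N_def[symmetric] inner_add_left)
    also have "z \<bullet> w = z \<bullet> \<tau> + s1 * (z \<bullet> N) + s2 * (z \<bullet> (\<i> *s N))"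
      unfolding w \<nu>_def by (simp add: inner_add_right)
    finally show ?thesis by (simp add: y1_def m1_def s12 algebra_simps)
  qed
  have viw: "v \<bullet> (\<i> *s w) = x2 + y2 + d * m2"
  proof -
    have "v \<bullet> (\<i> *s w) = x2 + (2 * K) * (z \<bullet> (\<i> *s w))"
      using Nw d(2) by (simp add: v_def N_def[symmetric] inner_add_left)
    also have "z \<bullet> (\<i> *s w) = z \<bullet> (\<i> *s \<tau>) + s1 * (z \<bullet> (\<i> *s N)) - s2 * (z \<bullet> N)"
      unfolding w linear_add[OF linear_smult] i\<nu> by (simp add: inner_add_right inner_diff_right)
    finally show ?thesis by (simp add: y2_def m2_def s12 algebra_simps)
  qed
  have tot: "levi_trace (H z) w \<ge> T + d * (b1\<^sup>2 + b2\<^sup>2) - 2 * M ^ 3 * d\<^sup>2 * t + 2 * d * (x1 * b1 + x2 * b2) - M * d\<^sup>2 * (x1\<^sup>2 + x2\<^sup>2)"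
  proof -
    have "levi_trace (H z) w = levi_trace (H z) \<tau> + 2 * (d * (x1 * b1 + x2 * b2)) + levi_trace (H z) \<nu>"
      unfolding w levi_trace_add[OF lin sym] cross ..
    moreover have "M * (s1\<^sup>2 + s2\<^sup>2) = M * d\<^sup>2 * (x1\<^sup>2 + x2\<^sup>2)" by (simp add: s12 power_mult_distrib algebra_simps)
    ultimately show ?thesis using tr\<tau> tr\<nu> by linarith
  qed
  have "levi_trace (H z) w / d \<ge> (T + d * (b1\<^sup>2 + b2\<^sup>2) - 2 * M ^ 3 * d\<^sup>2 * t + 2 * d * (x1 * b1 + x2 * b2) - M * d\<^sup>2 * (x1\<^sup>2 + x2\<^sup>2)) / d"
    using tot d(2) by (intro divide_right_mono) auto
  also have "(T + d * (b1\<^sup>2 + b2\<^sup>2) - 2 * M ^ 3 * d\<^sup>2 * t + 2 * d * (x1 * b1 + x2 * b2) - M * d\<^sup>2 * (x1\<^sup>2 + x2\<^sup>2)) / d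
    = T / d + (b1\<^sup>2 + b2\<^sup>2) - 2 * M ^ 3 * d * t + 2 * (x1 * b1 + x2 * b2) - M * d * (x1\<^sup>2 + x2\<^sup>2)"
    using d(2) by (simp add: add_divide_distrib diff_divide_distrib power2_eq_square)
  finally have L: "T / d + (b1\<^sup>2 + b2\<^sup>2) - 2 * M ^ 3 * d * t + 2 * (x1 * b1 + x2 * b2) - M * d * (x1\<^sup>2 + x2\<^sup>2) \<le> levi_trace (H z) w / d" .
  have G: "((N \<bullet> w)\<^sup>2 + (N \<bullet> (\<i> *s w))\<^sup>2) / d\<^sup>2 = x1\<^sup>2 + x2\<^sup>2"
    unfolding Nw using d(2) by (simp add: power_mult_distrib add_divide_distrib)
  \<comment> \<open>The normal part of \<open>|w|^2\<close> has a favourable sign and is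
    dropped.\<close>
  have W: "4 * K * (norm w)\<^sup>2 \<ge> 4 * K * t" using rK nw by (simp add: mult_left_mono)
  have t0: "0 \<le> t" by (simp add: t_def)
  have "0 \<le> T / d + (b1\<^sup>2 + b2\<^sup>2) - (2 * M ^ 3) * d * t + 2 * (x1 * b1 + x2 * b2) - M * d * (x1\<^sup>2 + x2\<^sup>2) + (x1\<^sup>2 + x2\<^sup>2)
    + 4 * K * t - \<eta> * ((x1 + y1 + d * m1)\<^sup>2 + (x2 + y2 + d * m2)\<^sup>2)"
    by (rule quadratic_form_nonneg[OF d(2) eta t0 T0 bound y m kappa th small(1) small(2) small(3)])
  then show ?thesis unfolding vw viw N_def[symmetric] G using L W by linarith
qed

end

section \<open>Choice of the constants\<close>

context collar begin

lemma levi_form_collar: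
  assumes psc: "pseudoconvex \<Omega>" and A: "alpha_sup \<Omega> \<le> ereal A" "0 \<le> A" and r: "0 < r"
    and eta: "0 < \<eta>" "\<eta> * (1 + 4 * sqrt 2 * A * r) < 1"
  obtains K \<epsilon> where "0 < K" "0 < \<epsilon>" "\<epsilon> \<le> e"
    "\<And>z d w. \<delta> z = - d \<Longrightarrow> 0 < d \<Longrightarrow> d < \<epsilon> \<Longrightarrow> norm z \<le> r \<Longrightarrow>
      0 \<le> levi_trace (H z) w / d + ((g z \<bullet> w)\<^sup>2 + (g z \<bullet> (\<i> *s w))\<^sup>2) / d\<^sup>2 + 4 * K * (norm w)\<^sup>2
       - \<eta> * (((g z /\<^sub>R d + (2 * K) *\<^sub>R z) \<bullet> w)\<^sup>2 + ((g z /\<^sub>R d + (2 * K) *\<^sub>R z) \<bullet> (\<i> *s w))\<^sup>2)"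
proof -
  define a where "a = 2 * sqrt 2 * A"
  \<comment> \<open>\<open>s < s0\<close> is equivalent to \<open>\<eta> (1 + 2 r s) < 1\<close>, so
    the hypothesis on \<eta> says exactly \<open>a < s0\<close>. The midpoint \<open>s\<close>
    exceeds \<open>a\<close>, which gives the strict inequality \<open>8 * A^2 < s^2\<close>, and it
    is positive even for \<open>A = 0\<close>.\<close>
  define s0 where "s0 = (1 / \<eta> - 1) / (2 * r)"
  define s where "s = (a + s0) / 2"
  have a0: "0 \<le> a" using A(2) by (simp add: a_def)
  have "\<eta> * (1 + 2 * a * r) < 1" using eta(2) by (simp add: a_def mult_ac)
  then have "a < s0" using eta(1) r by (simp add: s0_def field_simps)
  then have s: "a < s" "s < s0" "0 < s" using a0 by (auto simp: s_def)
  have es: "\<eta> * (1 + 2 * r * s) < 1" using s(2) eta(1) r by (simp add: s0_def field_simps)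
  have rs: "0 < 2 * r * s" using r s by simp
  \<comment> \<open>The critical exponent for the constant \<open>s\<close>. Placing
    \<open>\<eta>1\<close> strictly between \<eta> and \<open>h\<close> leaves room for the factor
    \<open>1 + d\<close> and for \<theta>.\<close>
  define h where "h = 1 / (1 + 2 * r * s)"
  have h: "\<eta> < h" "h < 1" using es rs by (simp_all add: h_def field_simps)
  define \<eta>1 where "\<eta>1 = (\<eta> + h) / 2"
  have e1: "\<eta> < \<eta>1" "\<eta>1 < h" "\<eta>1 < 1" "0 < \<eta>1" using h eta(1) by (auto simp: \<eta>1_def)
  define q where "q = \<eta>1 / (1 - \<eta>1)"
  have q0: "0 < q" using e1 by (simp add: q_def)
  have "\<eta>1 * (1 + 2 * r * s) < 1" using e1(2) rs by (simp add: h_def field_simps)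
  then have qrs: "q * (2 * r * s) < 1" using e1 by (simp add: q_def field_simps)
  define K where "K = s / (2 * r)"
  have K: "0 < K" "2 * K * r = s" using r s by (simp_all add: K_def)
  \<comment> \<open>Half of the surplus of \<open>4 K\<close> over \<open>4 q s^2\<close>. One
    \<kappa> pays for \<open>\<theta> s^2\<close>, the other for the tangential errors of order
    \<open>d\<close>.\<close>
  define \<kappa> where "\<kappa> = 2 * K - 2 * q * s\<^sup>2"
  have kap: "0 < \<kappa>"
  proof -
    have "\<kappa> = (s / r) * (1 - q * (2 * r * s))"
      using r by (simp add: \<kappa>_def K_def power2_eq_square field_simps)
    then show ?thesis using qrs r s by simp
  qed
  have "8 * A\<^sup>2 = a\<^sup>2" by (simp add: a_def power_mult_distrib)
  also have "a\<^sup>2 < s\<^sup>2" using a0 s by (intro power_strict_mono) auto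
  finally obtain C where C: "C \<ge> 0"
    "\<And>p \<tau>. p \<in> frontier \<Omega> \<Longrightarrow> tang (g p) \<tau> \<Longrightarrow> beta2 (g p) (H p) \<tau> \<le> s\<^sup>2 * (norm \<tau>)\<^sup>2 + C * levi_trace (H p) \<tau>"
    using beta2_le_levi_trace[OF psc A(1)] by metis
  define \<theta> where "\<theta> = min ((\<eta>1 - \<eta>) / 2) (\<kappa> / s\<^sup>2)"
  have th: "0 < \<theta>" using e1 kap s by (simp add: \<theta>_def)
  have th1: "\<theta> \<le> (\<eta>1 - \<eta>) / 2" unfolding \<theta>_def by (rule min.cobounded1)
  have th2: "\<theta> * s\<^sup>2 \<le> \<kappa>"
  proof -
    have "\<theta> * s\<^sup>2 \<le> (\<kappa> / s\<^sup>2) * s\<^sup>2" by (intro mult_right_mono) (auto simp: \<theta>_def)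
    then show ?thesis using s by simp
  qed
  define c where "c = 2 * M ^ 3 + 2 * q * (4 * M ^ 3 + 2 * M ^ 4)"
  have c0: "0 < c" using M_pos q0 unfolding c_def by (intro add_pos_pos mult_pos_pos zero_less_power) auto
  \<comment> \<open>The entries ensure in turn: being in the collar, \<open>d \<le> 1\<close>, room
    for \<open>1 + d\<close> beside \<eta>, absorption of the \<open>C\<close> term, smallness of
    the errors in \<open>t\<close>, and smallness of those in \<open>x\<close>. The
    \<open>+ 1\<close> keeps the fourth denominator positive when \<open>C = 0\<close>.\<close>
  define \<epsilon> where "\<epsilon> = Min {e, 1, (\<eta>1 - \<eta>) / 2, 1 / (2 * q * C + 1), \<kappa> / c, (\<theta> / 2) / (M + 2 * s\<^sup>2)}"
  have qC: "0 < 2 * q * C + 1" using q0 C(1) by (simp add: add_nonneg_pos)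
  have Ms: "0 < M + 2 * s\<^sup>2" using M_pos by (simp add: add_pos_nonneg)
  have eps: "0 < \<epsilon>" using e_pos e1 qC kap c0 th Ms by (simp add: \<epsilon>_def)
  have le: "\<epsilon> \<le> e" "\<epsilon> \<le> 1" "\<epsilon> \<le> (\<eta>1 - \<eta>) / 2" "\<epsilon> \<le> 1 / (2 * q * C + 1)" "\<epsilon> \<le> \<kappa> / c" "\<epsilon> \<le> (\<theta> / 2) / (M + 2 * s\<^sup>2)"
    unfolding \<epsilon>_def by (rule Min_le; simp)+
  show ?thesis
  proof (rule that[OF K(1) eps le(1)])
    fix z d w assume z: "\<delta> z = - d" "0 < d" "d < \<epsilon>" "norm z \<le> r"
    have b: "bdist \<Omega> z < e" using z le(1) abs_signed_dist[of z] by simp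
    have d1: "d \<le> 1" using z le(2) by simp
    have ed: "\<eta> * (1 + d) \<le> \<eta>1 - \<theta>"
    proof -
      have "\<eta> * d \<le> 1 * d" using e1 z(2) by (intro mult_right_mono) auto
      then show ?thesis using z(3) le(3) th1 by (simp add: algebra_simps)
    qed
    have "d \<le> 1 / (2 * q * C + 1)" using z(3) le(4) by simp
    then have "d * (2 * q * C + 1) \<le> 1" using qC by (simp only: pos_le_divide_eq)
    then have s1: "2 * (\<eta>1 / (1 - \<eta>1)) * C \<le> 1 / d"
      using z(2) unfolding q_def[symmetric] by (simp add: field_simps)
    have s2: "(2 * M ^ 3 + 2 * (\<eta>1 / (1 - \<eta>1)) * (4 * M ^ 3 + 2 * M ^ 4)) * d \<le> \<kappa>"
    proof -
      have "d \<le> \<kappa> / c" using z(3) le(5) by simp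
      then have "c * d \<le> \<kappa>" using c0 by (simp only: pos_le_divide_eq mult.commute)
      then show ?thesis unfolding q_def[symmetric] c_def[symmetric] .
    qed
    have s3: "(M + 2 * s\<^sup>2) * d \<le> \<theta> / 2"
    proof -
      have "d \<le> (\<theta> / 2) / (M + 2 * s\<^sup>2)" using z(3) le(6) by simp
      then show ?thesis using Ms by (simp only: pos_le_divide_eq mult.commute)
    qed
    have kk: "4 * K - 4 * (\<eta>1 / (1 - \<eta>1)) * s\<^sup>2 = 2 * \<kappa>" unfolding q_def[symmetric] by (simp add: \<kappa>_def)
    show "0 \<le> levi_trace (H z) w / d + ((g z \<bullet> w)\<^sup>2 + (g z \<bullet> (\<i> *s w))\<^sup>2) / d\<^sup>2 + 4 * K * (norm w)\<^sup>2
       - \<eta> * (((g z /\<^sub>R d + (2 * K) *\<^sub>R z) \<bullet> w)\<^sup>2 + ((g z /\<^sub>R d + (2 * K) *\<^sub>R z) \<bullet> (\<i> *s w))\<^sup>2)"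
      by (rule levi_form_collar_bound[OF b z(1,2) d1 z(4) less_imp_le[OF K(1)] K(2) psc C(1) C(2) eta(1) ed e1(3) th kk th2 s1 s2 s3])
  qed
qed

end

section \<open>The defining function\<close>

lemma DERIV_max_0_power:
  "((\<lambda>x::real. max 0 x ^ (n + 2)) has_real_derivative real (n + 2) * max 0 x ^ (n + 1)) (at x)"
proof (cases x "0::real" rule: linorder_cases)
  case less
  have "((\<lambda>x::real. 0) has_real_derivative 0) (at x)" by simp
  then show ?thesis using less
    by (simp add: max_def) (rule has_field_derivative_transform_within_open[of "\<lambda>x. 0" _ _ "{..<0}"], auto)
next
  case greater
  have "((\<lambda>x::real. x ^ (n + 2)) has_real_derivative real (n + 2) * x ^ (n + 1)) (at x)"
    using DERIV_pow[of "n + 2" x UNIV] by simp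
  then have "((\<lambda>x::real. max 0 x ^ (n + 2)) has_real_derivative real (n + 2) * x ^ (n + 1)) (at x)"
    by (rule has_field_derivative_transform_within_open[of _ _ _ "{0<..}"]) (use greater in auto)
  then show ?thesis using greater by simp
next
  case equal
  have "((\<lambda>h::real. max 0 h ^ (n + 2) / h) \<longlongrightarrow> 0) (at 0)"
  proof (rule Lim_null_comparison)
    show "\<forall>\<^sub>F h in at (0::real). norm (max 0 h ^ (n + 2) / h) \<le> \<bar>h\<bar> ^ (n + 1)"
    proof (rule always_eventually, rule allI)
      fix h :: real
      show "norm (max 0 h ^ (n + 2) / h) \<le> \<bar>h\<bar> ^ (n + 1)"
      proof (cases "h \<le> 0")
        case True
        then have "norm (max 0 h ^ (n + 2) / h) = 0" by simp
        then show ?thesis by (metis abs_ge_zero zero_le_power)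
      qed simp
    qed
    show "((\<lambda>h::real. \<bar>h\<bar> ^ (n + 1)) \<longlongrightarrow> 0) (at 0)"
      by (rule tendsto_eq_intros refl)+ simp
  qed
  then show ?thesis using equal by (simp add: DERIV_def)
qed

text \<open>A \<open>C\<^sup>2\<close> smoothing of \<open>max 0\<close>, whose second derivative is the tent function.\<close>

definition smax :: "real \<Rightarrow> real" where
  "smax x = (max 0 (x + 1) ^ 3 - 2 * max 0 x ^ 3 + max 0 (x - 1) ^ 3) / 6"

definition smax' :: "real \<Rightarrow> real" where
  "smax' x = (max 0 (x + 1) ^ 2 - 2 * max 0 x ^ 2 + max 0 (x - 1) ^ 2) / 2"

definition smax'' :: "real \<Rightarrow> real" where
  "smax'' x = max 0 (x + 1) - 2 * max 0 x + max 0 (x - 1)"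

lemma DERIV_smax: "(smax has_real_derivative smax' x) (at x)"
proof -
  have *: "((\<lambda>x::real. max 0 (x + c) ^ 3) has_real_derivative 3 * max 0 (x + c) ^ 2) (at x)" for c
  proof -
    have "((\<lambda>x. max 0 (x + c) ^ (1 + 2)) has_real_derivative (real (1 + 2) * max 0 (x + c) ^ (1 + 1)) * 1) (at x)"
      by (rule DERIV_chain2[where f="\<lambda>x. max 0 x ^ (1 + 2)" and g="\<lambda>x. x + c", OF DERIV_max_0_power])
        (auto intro!: derivative_eq_intros)
    then show ?thesis by (simp add: numeral_3_eq_3 numeral_2_eq_2)
  qed
  have z: "((\<lambda>x::real. max 0 x ^ 3) has_real_derivative 3 * max 0 x ^ 2) (at x)" using *[of 0] by simp
  have m: "((\<lambda>x::real. max 0 (x - 1) ^ 3) has_real_derivative 3 * max 0 (x - 1) ^ 2) (at x)" using *[of "-1"] by simp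
  show ?thesis unfolding smax_def[abs_def] smax'_def
    by (rule DERIV_cong[OF DERIV_cdivide[OF DERIV_add[OF DERIV_diff[OF *[of 1] DERIV_cmult[OF z]] m]]]) simp
qed

lemma DERIV_smax': "(smax' has_real_derivative smax'' x) (at x)"
proof -
  have *: "((\<lambda>x::real. max 0 (x + c) ^ 2) has_real_derivative 2 * max 0 (x + c)) (at x)" for c
  proof -
    have "((\<lambda>x. max 0 (x + c) ^ (0 + 2)) has_real_derivative (real (0 + 2) * max 0 (x + c) ^ (0 + 1)) * 1) (at x)"
      by (rule DERIV_chain2[where f="\<lambda>x. max 0 x ^ (0 + 2)" and g="\<lambda>x. x + c", OF DERIV_max_0_power])
        (auto intro!: derivative_eq_intros)
    then show ?thesis by (simp add: power2_eq_square)
  qed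
  have z: "((\<lambda>x::real. max 0 x ^ 2) has_real_derivative 2 * max 0 x) (at x)" using *[of 0] by simp
  have m: "((\<lambda>x::real. max 0 (x - 1) ^ 2) has_real_derivative 2 * max 0 (x - 1)) (at x)" using *[of "-1"] by simp
  show ?thesis unfolding smax'_def[abs_def] smax''_def
    by (rule DERIV_cong[OF DERIV_cdivide[OF DERIV_add[OF DERIV_diff[OF *[of 1] DERIV_cmult[OF z]] m]]]) simp
qed

lemma continuous_on_smax'': "continuous_on S smax''"
  unfolding smax''_def[abs_def] by (intro continuous_intros)

lemma smax''_nonneg: "0 \<le> smax'' x"
  by (simp add: smax''_def max_def)

lemma smax_eq_0: "x \<le> -1 \<Longrightarrow> smax x = 0" and smax_eq_id: "1 \<le> x \<Longrightarrow> smax x = x"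
  by (simp_all add: smax_def max_def power3_eq_cube algebra_simps)

lemma smax'_mono: "x \<le> y \<Longrightarrow> smax' x \<le> smax' y"
  using DERIV_nonneg_imp_nondecreasing[of x y smax'] DERIV_smax' smax''_nonneg by blast

lemma smax'_nonneg: "0 \<le> smax' x" and smax'_le_1: "smax' x \<le> 1"
proof -
  have "smax' (min x (-1)) = 0" by (simp add: smax'_def max_def)
  then show "0 \<le> smax' x" using smax'_mono[of "min x (-1)" x] by simp
  have "smax' (max x 1) = 1" by (simp add: smax'_def max_def power2_eq_square field_simps)
  then show "smax' x \<le> 1" using smax'_mono[of x "max x 1"] by simp
qed

lemma smax_mono: "x \<le> y \<Longrightarrow> smax x \<le> smax y"
  using DERIV_nonneg_imp_nondecreasing[of x y smax] DERIV_smax smax'_nonneg by blast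

lemma smax_ge: "x \<le> smax x"
proof (cases "x \<le> 1")
  case True
  have "((\<lambda>x. x - smax x) has_real_derivative 1 - smax' y) (at y)" for y
    by (rule derivative_eq_intros DERIV_smax refl)+
  then have "x - smax x \<le> 1 - smax 1"
    using DERIV_nonneg_imp_nondecreasing[OF True, of "\<lambda>x. x - smax x"] smax'_le_1 by (metis diff_ge_0_iff_ge)
  then show ?thesis by (simp add: smax_eq_id)
qed (simp add: smax_eq_id)

text \<open>The composite with \<open>k\<close> has Levi form \<open>k'\<close> times the old one
  plus \<open>k''\<close> times the squared differential, so the assumed bound leaves
  \<open>\<eta> * k' + k''\<close> as coefficient of the square. For
  \<open>k y = - exp (- (\<eta> * y))\<close> this coefficient is 0, which ties the bound to the
  exponent \<eta>.\<close>

lemma levi_trace_compose: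
  assumes "0 \<le> \<eta>" and L: "\<eta> * ((G \<bullet> w)\<^sup>2 + (G \<bullet> (\<i> *s w))\<^sup>2) \<le> levi_trace A w"
    and k: "0 \<le> k'" "0 \<le> \<eta> * k' + k''"
  shows "0 \<le> levi_trace (\<lambda>v. k' *\<^sub>R A v + (k'' * (G \<bullet> v)) *\<^sub>R G) w"
proof -
  define S where "S = (G \<bullet> w)\<^sup>2 + (G \<bullet> (\<i> *s w))\<^sup>2"
  have "levi_trace (\<lambda>v. k' *\<^sub>R A v + (k'' * (G \<bullet> v)) *\<^sub>R G) w = k' * levi_trace A w + k'' * S"
    by (simp add: levi_trace_def S_def inner_add_left power2_eq_square algebra_simps)
  moreover have "k' * (\<eta> * S) \<le> k' * levi_trace A w" using L k by (intro mult_left_mono) (auto simp: S_def)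
  moreover have "0 \<le> (\<eta> * k' + k'') * S" using k by (intro mult_nonneg_nonneg) (auto simp: S_def)
  ultimately show ?thesis by (simp add: algebra_simps)
qed

section \<open>Construction of the defining function\<close>

context collar begin

lemma bdist_pos: "z \<in> \<Omega> \<Longrightarrow> 0 < bdist \<Omega> z"
proof -
  assume z: "z \<in> \<Omega>"
  have ne: "frontier \<Omega> \<noteq> {}" using opn nonempty bdd frontier_eq_empty[of \<Omega>] not_bounded_UNIV by auto
  have "z \<notin> frontier \<Omega>" using z opn by (simp add: frontier_def interior_open)
  then have "infdist z (frontier \<Omega>) \<noteq> 0"
    using in_closed_iff_infdist_zero[OF frontier_closed ne, of z] by simp
  then show ?thesis using infdist_nonneg[of z "frontier \<Omega>"] by (simp add: bdist_def)
qed

lemma signed_dist_inside: "z \<in> \<Omega> \<Longrightarrow> \<delta> z = - bdist \<Omega> z"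
  by (simp add: signed_dist_def)

lemma open_bdist_less: "open {z. bdist \<Omega> z < c}"
  unfolding bdist_def by (intro open_Collect_less continuous_intros)

lemma open_bdist_greater: "open {z. c < bdist \<Omega> z}"
  unfolding bdist_def by (intro open_Collect_less continuous_intros)

lemma DF_exponent:
  assumes psc: "pseudoconvex \<Omega>" and A: "alpha_sup \<Omega> \<le> ereal A" "0 \<le> A" and r: "0 < r" "\<And>z. z \<in> \<Omega> \<Longrightarrow> norm z \<le> r"
    and eta: "0 < \<eta>" "\<eta> < 1" "\<eta> * (1 + 4 * sqrt 2 * A * r) < 1"
  shows "\<eta> \<in> DF_exponents \<Omega>"
proof -
  obtain K \<epsilon> where K: "0 < K" and eps: "0 < \<epsilon>" "\<epsilon> \<le> e"
    and form: "\<And>z d w. \<delta> z = - d \<Longrightarrow> 0 < d \<Longrightarrow> d < \<epsilon> \<Longrightarrow> norm z \<le> r \<Longrightarrow>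
      0 \<le> levi_trace (H z) w / d + ((g z \<bullet> w)\<^sup>2 + (g z \<bullet> (\<i> *s w))\<^sup>2) / d\<^sup>2 + 4 * K * (norm w)\<^sup>2
       - \<eta> * (((g z /\<^sub>R d + (2 * K) *\<^sub>R z) \<bullet> w)\<^sup>2 + ((g z /\<^sub>R d + (2 * K) *\<^sub>R z) \<bullet> (\<i> *s w))\<^sup>2)"
    using levi_form_collar[OF psc A r(1) eta(1,3)] by metis
  have normr: "K * (z \<bullet> z) \<le> K * r\<^sup>2" if "z \<in> \<Omega>" for z
    using K power_mono[OF r(2)[OF that], of 2] by (simp add: power2_norm_eq_inner[symmetric])
  define \<phi> where "\<phi> z = - ln (- \<delta> z) + K * (z \<bullet> z)" for z :: "complex^'n"
  \<comment> \<open>At distance at least \<open>\<epsilon> / 2\<close> from the boundary this makes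
    \<open>\<phi> \<le> c0 - 1\<close>, where the smoothed maximum in \<open>G\<close> vanishes and
    \<open>G (\<phi> z)\<close> is the constant \<open>c0\<close>.\<close>
  define c0 where "c0 = 1 - ln (\<epsilon> / 2) + K * r\<^sup>2"
  define G where "G y = c0 + smax (y - c0)" for y
  define Vn where "Vn = \<Omega> \<inter> {z. bdist \<Omega> z < \<epsilon>}"
  define Vd where "Vd = \<Omega> \<inter> {z. \<epsilon> / 2 < bdist \<Omega> z}"
  \<comment> \<open>Closer than this \<open>\<phi> \<ge> c0 + 1\<close>, where \<open>G\<close> is
    the identity. There \<open>P\<close> is the explicit product of \<open>- \<delta>\<close> and an
    exponential, which is twice continuously differentiable across the boundary although \<phi>
    blows up there.\<close>
  define \<epsilon>2 where "\<epsilon>2 = min \<epsilon> (exp (- (c0 + 1)))"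
  define Vb where "Vb = {z. bdist \<Omega> z < \<epsilon>2}"
  \<comment> \<open>The middle branch continues the product formula to the boundary and to points
    near it outside the domain. Inside, the first and last branches agree where
    \<open>\<epsilon> / 2 < bdist \<Omega> z < \<epsilon>\<close>.\<close>
  define P where "P z = (if z \<in> Vn then exp (- G (\<phi> z)) else if bdist \<Omega> z < \<epsilon> then - \<delta> z * exp (- (K * (z \<bullet> z))) else exp (- c0))" for z
  define D where "D = 2 * r"
  \<comment> \<open>A lower bound for \<open>P\<close> over the distance: the first entry serves
    where \<open>G\<close> is the identity, the second where \<open>P \<ge> exp (- (c0 + 1))\<close>
    and the distance is at most \<open>D\<close>. Multiplying by \<open>\<Lambda> = 1 / c2\<close>
    gives the normalization \<open>\<rho> \<le> - bdist\<close>.\<close>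
  define c2 where "c2 = min (exp (- (K * r\<^sup>2))) (exp (- (c0 + 1)) / D)"
  define \<Lambda> where "\<Lambda> = 1 / c2"
  define \<rho> where "\<rho> z = - \<Lambda> * P z" for z
  have eps2: "0 < \<epsilon>2" "\<epsilon>2 \<le> \<epsilon>" using eps by (auto simp: \<epsilon>2_def)
  have opens: "open Vn" "open Vd" "open Vb"
    unfolding Vn_def Vd_def Vb_def by (intro open_Int opn open_bdist_less open_bdist_greater)+
  have ezc: "exp (- \<phi> z) = bdist \<Omega> z * exp (- (K * (z \<bullet> z)))" if "z \<in> \<Omega>" for z
    using bdist_pos[OF that] by (simp add: \<phi>_def signed_dist_inside[OF that] exp_add exp_diff exp_minus field_simps)
  have G_low: "G (\<phi> z) = c0" if "z \<in> \<Omega>" "\<epsilon> / 2 \<le> bdist \<Omega> z" for z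
  proof -
    have "ln (\<epsilon> / 2) \<le> ln (bdist \<Omega> z)" using that eps bdist_pos[OF that(1)] by simp
    then have "\<phi> z \<le> c0 - 1" using normr[OF that(1)] by (simp add: \<phi>_def c0_def signed_dist_inside[OF that(1)])
    then show ?thesis by (simp add: G_def smax_eq_0)
  qed
  have G_high: "G y = y" if "c0 + 1 \<le> y" for y using that by (simp add: G_def smax_eq_id)
  have phi_high: "c0 + 1 \<le> \<phi> z" if "z \<in> \<Omega>" "bdist \<Omega> z < \<epsilon>2" for z
  proof -
    have "ln (bdist \<Omega> z) \<le> ln (exp (- (c0 + 1)))"
      using that bdist_pos[OF that(1)] by (intro ln_mono) (auto simp: \<epsilon>2_def)
    moreover have "0 \<le> K * (z \<bullet> z)" using K by simp
    ultimately show ?thesis by (simp add: \<phi>_def signed_dist_inside[OF that(1)])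
  qed
  have P_b: "P z = - \<delta> z * exp (- (K * (z \<bullet> z)))" if "z \<in> Vb" for z
  proof (cases "z \<in> \<Omega>")
    case True
    then have "z \<in> Vn" "G (\<phi> z) = \<phi> z" using that eps2 phi_high G_high by (auto simp: Vn_def Vb_def)
    then show ?thesis using ezc[OF True] by (simp add: P_def signed_dist_inside[OF True])
  qed (use that eps2 in \<open>auto simp: P_def Vn_def Vb_def\<close>)
  have P_d: "P z = exp (- c0)" if "z \<in> Vd" for z
    using that G_low[of z] by (auto simp: P_def Vn_def Vd_def)
  have P_n: "P z = exp (- G (\<phi> z))" if "z \<in> Vn" for z using that by (simp add: P_def)
  have cover: "\<Omega> = Vn \<union> Vd" using eps by (auto simp: Vn_def Vd_def)
  have jet_n: "has_jet Vn \<delta> g H"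
    by (rule has_jet_subset[OF jet opens(1)]) (use eps in \<open>auto simp: Vn_def\<close>)
  have neg: "\<delta> z < 0" if "z \<in> Vn" for z
    using that bdist_pos[of z] by (simp add: Vn_def signed_dist_inside)
  have jet_ln: "has_jet Vn (\<lambda>z. - ln (- \<delta> z)) (\<lambda>z. (- inverse (\<delta> z)) *\<^sub>R g z)
      (\<lambda>z v. (- inverse (\<delta> z)) *\<^sub>R H z v + (inverse (\<delta> z ^ 2) * (g z \<bullet> v)) *\<^sub>R g z)"
  proof (rule has_jet_compose[where k="\<lambda>s. - ln (- s)" and I="{..<0}", OF jet_n])
    show "\<delta> z \<in> {..<0}" if "z \<in> Vn" for z using neg[OF that] by simp
    show "((\<lambda>s. - ln (- s)) has_real_derivative - inverse y) (at y)" if "y \<in> {..<0}" for y :: real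
      using that by (auto intro!: derivative_eq_intros simp: field_simps)
    show "((\<lambda>s. - inverse s) has_real_derivative inverse (y ^ 2)) (at y)" if "y \<in> {..<0}" for y :: real
      using that by (auto intro!: derivative_eq_intros simp: power2_eq_square field_simps)
    show "continuous_on {..<0} (\<lambda>y::real. inverse (y ^ 2))" by (intro continuous_intros) auto
  qed simp
  define g\<phi> where "g\<phi> z = (- inverse (\<delta> z)) *\<^sub>R g z + (2 * K) *\<^sub>R z" for z
  define H\<phi> where "H\<phi> z v = (- inverse (\<delta> z)) *\<^sub>R H z v + (inverse (\<delta> z ^ 2) * (g z \<bullet> v)) *\<^sub>R g z + (2 * K) *\<^sub>R v" for z v
  have jet_\<phi>: "has_jet Vn \<phi> g\<phi> H\<phi>"
    unfolding \<phi>_def[abs_def] g\<phi>_def[abs_def] H\<phi>_def[abs_def]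
    by (rule has_jet_add[OF jet_ln has_jet_norm_square[OF opens(1)]])
  have phi_form: "\<eta> * ((g\<phi> z \<bullet> w)\<^sup>2 + (g\<phi> z \<bullet> (\<i> *s w))\<^sup>2) \<le> levi_trace (H\<phi> z) w" if z: "z \<in> Vn" for z w
  proof -
    have zO: "z \<in> \<Omega>" using z by (simp add: Vn_def)
    define d where "d = bdist \<Omega> z"
    have d: "\<delta> z = - d" "0 < d" "d < \<epsilon>" using z bdist_pos[OF zO] by (simp_all add: d_def signed_dist_inside[OF zO] Vn_def)
    have "levi_trace (H\<phi> z) w = levi_trace (H z) w / d + ((g z \<bullet> w)\<^sup>2 + (g z \<bullet> (\<i> *s w))\<^sup>2) / d\<^sup>2 + 4 * K * (norm w)\<^sup>2"
      using d(2) by (simp add: levi_trace_def H\<phi>_def d(1) inner_add_left power2_norm_eq_inner)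
        (simp add: power2_eq_square field_simps)
    moreover have "g\<phi> z = g z /\<^sub>R d + (2 * K) *\<^sub>R z" by (simp add: g\<phi>_def d(1))
    ultimately show ?thesis using form[OF d r(2)[OF zO], of w] by simp
  qed
  \<comment> \<open>General \<open>L\<close> and \<open>a\<close> cover two uses:
    \<open>L = \<Lambda>\<close>, \<open>a = 1\<close> gives \<rho>, while
    \<open>L = \<Lambda> powr \<eta>\<close>, \<open>a = \<eta>\<close> gives
    \<open>- ((- \<rho>) powr \<eta>)\<close>.\<close>
  have G_der: "((\<lambda>y. - (L * exp (- (a * G y)))) has_real_derivative L * a * smax' (y - c0) * exp (- (a * G y))) (at y)"
    "((\<lambda>y. L * a * smax' (y - c0) * exp (- (a * G y))) has_real_derivative
      L * a * exp (- (a * G y)) * (smax'' (y - c0) - a * (smax' (y - c0))\<^sup>2)) (at y)"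
    "continuous_on UNIV (\<lambda>y. L * a * exp (- (a * G y)) * (smax'' (y - c0) - a * (smax' (y - c0))\<^sup>2))" for L a y :: real
  proof -
    have sh: "((\<lambda>y. y - c0) has_real_derivative 1) (at y)" for y
      by (auto intro!: derivative_eq_intros)
    have s: "((\<lambda>y. smax (y - c0)) has_real_derivative smax' (y - c0)) (at y)" for y
      using DERIV_chain2[where f=smax and g="\<lambda>y. y - c0", OF DERIV_smax sh] by simp
    have s': "((\<lambda>y. smax' (y - c0)) has_real_derivative smax'' (y - c0)) (at y)" for y
      using DERIV_chain2[where f=smax' and g="\<lambda>y. y - c0", OF DERIV_smax' sh] by simp
    have Gd: "(G has_real_derivative smax' (y - c0)) (at y)" for y
      unfolding G_def[abs_def] by (rule derivative_eq_intros s refl)+ simp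
    show "((\<lambda>y. - (L * exp (- (a * G y)))) has_real_derivative L * a * smax' (y - c0) * exp (- (a * G y))) (at y)"
      by (rule derivative_eq_intros Gd refl)+ simp
    show "((\<lambda>y. L * a * smax' (y - c0) * exp (- (a * G y))) has_real_derivative
      L * a * exp (- (a * G y)) * (smax'' (y - c0) - a * (smax' (y - c0))\<^sup>2)) (at y)"
      by (rule derivative_eq_intros Gd s' refl)+ (simp add: power2_eq_square algebra_simps)
    have "continuous_on UNIV G" "continuous_on UNIV (\<lambda>y. smax' (y - c0))"
      by (rule DERIV_continuous_on, rule has_field_derivative_at_within[OF Gd])
        (rule DERIV_continuous_on, rule has_field_derivative_at_within[OF s'])
    moreover have "continuous_on UNIV (\<lambda>y. smax'' (y - c0))"
      by (rule continuous_on_compose2[OF continuous_on_smax''[of UNIV]]) (auto intro!: continuous_intros)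
    ultimately show "continuous_on UNIV (\<lambda>y. L * a * exp (- (a * G y)) * (smax'' (y - c0) - a * (smax' (y - c0))\<^sup>2))"
      by (intro continuous_intros)
  qed
  have jet_G: "has_jet Vn (\<lambda>z. - (L * exp (- (a * G (\<phi> z)))))
    (\<lambda>z. (L * a * smax' (\<phi> z - c0) * exp (- (a * G (\<phi> z)))) *\<^sub>R g\<phi> z)
    (\<lambda>z v. (L * a * smax' (\<phi> z - c0) * exp (- (a * G (\<phi> z)))) *\<^sub>R H\<phi> z v +
      (L * a * exp (- (a * G (\<phi> z))) * (smax'' (\<phi> z - c0) - a * (smax' (\<phi> z - c0))\<^sup>2) * (g\<phi> z \<bullet> v)) *\<^sub>R g\<phi> z)" for L a :: real
    by (rule has_jet_compose[where k="\<lambda>y. - (L * exp (- (a * G y)))" and I=UNIV, OF jet_\<phi> _ _ G_der]) simp_all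
  have D0: "0 < D" using r by (simp add: D_def)
  have c2: "0 < c2" using D0 by (simp add: c2_def)
  have L0: "0 < \<Lambda>" using c2 by (simp add: \<Lambda>_def)
  have "has_jet (Vb \<union> \<Omega>) \<rho> (grad \<rho>) (hess \<rho>)"
  proof (rule has_jet_glue)
    show "open (Vb \<union> \<Omega>)" using opens opn by auto
    fix x assume "x \<in> Vb \<union> \<Omega>"
    then consider "x \<in> Vb" | "x \<in> Vn" | "x \<in> Vd" using cover by auto
    then show "\<exists>V g H. x \<in> V \<and> has_jet V \<rho> g H"
    proof cases
      case 1
      have jb: "has_jet Vb \<delta> g H" by (rule has_jet_subset[OF jet opens(3)]) (use eps2 eps in \<open>auto simp: Vb_def\<close>)
      have je: "\<exists>g H. has_jet Vb (\<lambda>z. \<Lambda> * exp (- (K * (z \<bullet> z)))) g H"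
      proof (intro exI, rule has_jet_compose[where k="\<lambda>y. \<Lambda> * exp (- y)" and I=UNIV, OF has_jet_norm_square[OF opens(3)]])
        show "((\<lambda>y. \<Lambda> * exp (- y)) has_real_derivative - \<Lambda> * exp (- y)) (at y)" for y
          by (auto intro!: derivative_eq_intros)
        show "((\<lambda>y. - \<Lambda> * exp (- y)) has_real_derivative \<Lambda> * exp (- y)) (at y)" for y
          by (auto intro!: derivative_eq_intros)
        show "continuous_on UNIV (\<lambda>y. \<Lambda> * exp (- y))" by (intro continuous_intros)
      qed simp_all
      then obtain g' H' where "has_jet Vb (\<lambda>z. \<Lambda> * exp (- (K * (z \<bullet> z)))) g' H'" by blast
      from has_jet_cong[OF has_jet_mult[OF jb this], of \<rho>] P_b show ?thesis
        using 1 by (intro exI[of _ Vb]) (fastforce simp: \<rho>_def)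
    next
      case 2
      from has_jet_cong[OF jet_G[of \<Lambda> 1], of \<rho>] P_n show ?thesis
        using 2 by (intro exI[of _ Vn]) (fastforce simp: \<rho>_def)
    next
      case 3
      from has_jet_cong[OF has_jet_const[OF opens(2), of "- \<Lambda> * exp (- c0)"], of \<rho>] P_d show ?thesis
        using 3 by (intro exI[of _ Vd]) (fastforce simp: \<rho>_def)
    qed
  qed
  from has_jet_C2_on[OF this] have "C2_on (Vb \<union> \<Omega>) \<rho>" .
  moreover have clO: "closure \<Omega> \<subseteq> Vb \<union> \<Omega>"
    using eps2 frontier_bdist opn by (auto simp: Vb_def frontier_def interior_open)
  moreover have "open (Vb \<union> \<Omega>)" using opens opn by auto
  ultimately have C2: "C2_on_closed (closure \<Omega>) \<rho>" unfolding C2_on_closed_def by blast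
  define u where "u z = - ((- \<rho> z) powr \<eta>)" for z
  have u_n: "u z = - (\<Lambda> powr \<eta> * exp (- (\<eta> * G (\<phi> z))))" if "z \<in> Vn" for z
    using L0 by (simp add: u_def \<rho>_def P_n[OF that] powr_mult powr_def[of "exp _"] mult.commute)
  have u_d: "u z = - ((\<Lambda> * exp (- c0)) powr \<eta>)" if "z \<in> Vd" for z
    by (simp add: u_def \<rho>_def P_d[OF that])
  have ju_n: "has_jet Vn u (grad u) (hess u)"
    "\<And>z v. z \<in> Vn \<Longrightarrow> hess u z v = (\<Lambda> powr \<eta> * \<eta> * smax' (\<phi> z - c0) * exp (- (\<eta> * G (\<phi> z)))) *\<^sub>R H\<phi> z v +
      (\<Lambda> powr \<eta> * \<eta> * exp (- (\<eta> * G (\<phi> z))) * (smax'' (\<phi> z - c0) - \<eta> * (smax' (\<phi> z - c0))\<^sup>2) * (g\<phi> z \<bullet> v)) *\<^sub>R g\<phi> z"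
  proof -
    note j = has_jet_cong[OF jet_G[of "\<Lambda> powr \<eta>" \<eta>] u_n refl refl]
    show "has_jet Vn u (grad u) (hess u)" by (rule has_jet_canonical[OF j])
    show "hess u z v = (\<Lambda> powr \<eta> * \<eta> * smax' (\<phi> z - c0) * exp (- (\<eta> * G (\<phi> z)))) *\<^sub>R H\<phi> z v +
      (\<Lambda> powr \<eta> * \<eta> * exp (- (\<eta> * G (\<phi> z))) * (smax'' (\<phi> z - c0) - \<eta> * (smax' (\<phi> z - c0))\<^sup>2) * (g\<phi> z \<bullet> v)) *\<^sub>R g\<phi> z"
      if "z \<in> Vn" for z v
      by (simp only: has_jet_unique(2)[OF j that])
  qed
  have ju_d: "has_jet Vd u (grad u) (hess u)" "\<And>z v. z \<in> Vd \<Longrightarrow> hess u z v = 0"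
  proof -
    note j = has_jet_cong[OF has_jet_const[OF opens(2)] u_d refl refl]
    show "has_jet Vd u (grad u) (hess u)" by (rule has_jet_canonical[OF j])
    show "hess u z v = 0" if "z \<in> Vd" for z v using has_jet_unique(2)[OF j that] by simp
  qed
  have "has_jet \<Omega> u (grad u) (hess u)"
    by (rule has_jet_glue[OF _ opn]) (use ju_n(1) ju_d(1) cover in blast)
  moreover have "0 \<le> levi_trace (hess u x) w" if x: "x \<in> \<Omega>" for x w
  proof (cases "x \<in> Vn")
    case True
    define m where "m = smax' (\<phi> x - c0)"
    define E where "E = \<Lambda> powr \<eta> * \<eta> * exp (- (\<eta> * G (\<phi> x)))"
    have E: "0 \<le> E" using eta by (simp add: E_def)
    have m: "0 \<le> m" "m \<le> 1" by (simp_all add: m_def smax'_nonneg smax'_le_1)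
    have hess: "hess u x = (\<lambda>v. (E * m) *\<^sub>R H\<phi> x v + (E * (smax'' (\<phi> x - c0) - \<eta> * m\<^sup>2) * (g\<phi> x \<bullet> v)) *\<^sub>R g\<phi> x)"
      by (rule ext, subst ju_n(2)[OF True]) (simp add: E_def m_def mult_ac)
    show ?thesis unfolding hess
    proof (rule levi_trace_compose[OF _ phi_form[OF True]])
      show "0 \<le> E * m" using E m by simp
      \<comment> \<open>Here the slope bound enters: with \<open>k' = E m\<close> and
        \<open>k'' = E (smax'' - \<eta> m^2)\<close> the coefficient \<open>\<eta> k' + k''\<close>
        is \<open>E\<close> times the sum of \<open>\<eta> (m - m^2)\<close> and the nonnegative
        \<open>smax''\<close>.\<close>
      have "m\<^sup>2 \<le> m" using m by (simp add: power2_eq_square mult_left_le)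
      then have "\<eta> * m\<^sup>2 \<le> \<eta> * m" using eta by simp
      then have "0 \<le> E * (\<eta> * m + smax'' (\<phi> x - c0) - \<eta> * m\<^sup>2)"
        using E smax''_nonneg[of "\<phi> x - c0"] by (intro mult_nonneg_nonneg) auto
      then show "0 \<le> \<eta> * (E * m) + E * (smax'' (\<phi> x - c0) - \<eta> * m\<^sup>2)" by (simp add: algebra_simps)
    qed (use eta in simp)
  next
    case False
    then have "x \<in> Vd" using x cover by auto
    then show ?thesis using ju_d(2) by (simp add: levi_trace_def)
  qed
  ultimately have psh: "plurisubharmonic_on \<Omega> u" by (rule plurisubharmonic_on_if_levi_trace_nonneg)
  \<comment> \<open>Near the boundary \<open>G\<close> lies above the identity, so \<open>P\<close>
    is at most the distance. In the remaining part of the domain \<open>P = exp (- c0)\<close> and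
    the distance is at least \<epsilon>, whence the second summand; the 1 also makes
    \<open>C1\<close> exceed 1.\<close>
  define C1 where "C1 = 1 + exp (- c0) / \<epsilon>"
  have C1: "1 < C1" using eps by (simp add: C1_def)
  have bdD: "bdist \<Omega> z \<le> D" if "z \<in> \<Omega>" for z
  proof -
    have "frontier \<Omega> \<noteq> {}" using opn nonempty bdd frontier_eq_empty[of \<Omega>] not_bounded_UNIV by auto
    then obtain p where p: "p \<in> frontier \<Omega>" by blast
    have "\<Omega> \<subseteq> cball 0 r" using r(2) by auto
    then have "closure \<Omega> \<subseteq> cball 0 r" by (rule closure_minimal) simp
    then have "norm p \<le> r" using p by (auto simp: frontier_def)
    then have "dist z p \<le> D" using r(2)[OF that] norm_triangle_ineq4[of z p] by (simp add: dist_norm D_def)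
    then show ?thesis using infdist_le[OF p, of z] by (simp add: bdist_def)
  qed
  have Pbounds: "c2 * bdist \<Omega> z \<le> P z \<and> P z \<le> C1 * bdist \<Omega> z" if z: "z \<in> \<Omega>" for z
  proof -
    define d where "d = bdist \<Omega> z"
    have d: "0 < d" "d \<le> D" using bdist_pos[OF z] bdD[OF z] by (simp_all add: d_def)
    have flat: "c2 * d \<le> x" if "exp (- (c0 + 1)) \<le> x" for x
    proof -
      have "c2 * d \<le> (exp (- (c0 + 1)) / D) * D" using d D0 by (intro mult_mono) (auto simp: c2_def)
      then show ?thesis using that D0 by simp
    qed
    show ?thesis
    proof (cases "z \<in> Vn")
      case True
      have "exp (- G (\<phi> z)) \<le> exp (- \<phi> z)" using smax_ge[of "\<phi> z - c0"] by (simp add: G_def)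
      also have "\<dots> \<le> d * 1" unfolding ezc[OF z] d_def[symmetric] using d K by (intro mult_left_mono) auto
      also have "\<dots> \<le> C1 * d" using C1 d by simp
      finally have up: "P z \<le> C1 * d" using P_n[OF True] by simp
      have low: "c2 * d \<le> P z"
      proof (cases "c0 + 1 \<le> \<phi> z")
        case high: True
        have "c2 * d \<le> exp (- (K * (z \<bullet> z))) * d"
        proof (rule mult_right_mono)
          have "c2 \<le> exp (- (K * r\<^sup>2))" by (simp add: c2_def)
          also have "\<dots> \<le> exp (- (K * (z \<bullet> z)))" using normr[OF z] by simp
          finally show "c2 \<le> exp (- (K * (z \<bullet> z)))" .
        qed (use d in simp)
        then show ?thesis using P_n[OF True] G_high[OF high] ezc[OF z] by (simp add: d_def mult.commute)
      next
        case False
        then have "smax (\<phi> z - c0) \<le> smax 1" by (intro smax_mono) simp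
        then have "exp (- (c0 + 1)) \<le> P z" using P_n[OF True] by (simp add: G_def smax_eq_id)
        then show ?thesis by (rule flat)
      qed
      show ?thesis using up low by (simp add: d_def)
    next
      case False
      have zd: "z \<in> Vd" "\<epsilon> \<le> d"
        using False z cover by blast (use False z in \<open>simp add: Vn_def d_def\<close>)
      have "exp (- c0) \<le> exp (- c0) / \<epsilon> * d" using zd(2) eps by (simp add: field_simps)
      also have "\<dots> \<le> C1 * d" using d by (simp add: C1_def distrib_right)
      finally have "P z \<le> C1 * d" using P_d[OF zd(1)] by simp
      moreover have "c2 * d \<le> P z" by (rule flat) (simp add: P_d[OF zd(1)])
      ultimately show ?thesis by (simp add: d_def)
    qed
  qed
  have bounds: "- (\<Lambda> * C1 + 1) * bdist \<Omega> z \<le> \<rho> z \<and> \<rho> z \<le> - bdist \<Omega> z" if z: "z \<in> closure \<Omega>" for z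
  proof (cases "z \<in> \<Omega>")
    case True
    have "\<Lambda> * P z \<le> \<Lambda> * (C1 * bdist \<Omega> z)" using Pbounds[OF True] L0 by (intro mult_left_mono) auto
    moreover have "\<Lambda> * (c2 * bdist \<Omega> z) \<le> \<Lambda> * P z" using Pbounds[OF True] L0 by (intro mult_left_mono) auto
    moreover have "\<Lambda> * (c2 * bdist \<Omega> z) = bdist \<Omega> z" using c2 by (simp add: \<Lambda>_def)
    ultimately show ?thesis using bdist_pos[OF True] by (simp add: \<rho>_def algebra_simps)
  next
    case False
    then have "z \<in> frontier \<Omega>" using z opn by (simp add: frontier_def interior_open)
    then have "bdist \<Omega> z = 0" by (rule frontier_bdist)
    moreover have "z \<in> Vb" using calculation eps2 by (simp add: Vb_def)
    moreover have "\<delta> z = 0" using calculation(1) by (simp add: signed_dist_def)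
    ultimately show ?thesis by (simp add: \<rho>_def P_b)
  qed
  have "\<exists>c>1. \<forall>z\<in>closure \<Omega>. - c * bdist \<Omega> z \<le> \<rho> z \<and> \<rho> z \<le> - bdist \<Omega> z"
    using L0 C1 bounds by (intro exI[of _ "\<Lambda> * C1 + 1"]) simp
  then show ?thesis unfolding DF_exponents_def
    using eta(1,2) C2 psh unfolding u_def[abs_def] by (intro CollectI conjI exI[of _ \<rho>])
qed

end

section \<open>The lower bound for the index, with a finite or infinite supremum\<close>

theorem corollary6p1:
  fixes \<Omega> :: "(complex^'n::finite) set" and r :: real
  assumes "open \<Omega>" and "connected \<Omega>" and "\<Omega> \<noteq> {}" and "bounded \<Omega>"
    and "C2_boundary \<Omega>"
    and "pseudoconvex \<Omega>"
    and "r = (SUP z\<in>\<Omega>. norm z)"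
  shows "ereal (DF_C2 \<Omega>) \<ge> 1 / (1 + 4 * ereal (sqrt 2) * alpha_sup \<Omega> * ereal r)"
proof -
  obtain e M where "collar \<Omega> e M" using collar_exists[OF assms(1,3,4,5)] .
  then interpret collar \<Omega> e M .
  have bdd_norm: "bdd_above (norm ` \<Omega>)"
    using assms(4) by (auto simp: bounded_iff bdd_above_def)
  have le_r: "norm z \<le> r" if "z \<in> \<Omega>" for z
    unfolding assms(7) by (rule cSUP_upper[OF that bdd_norm])
  \<comment> \<open>A nonempty open set is not the single point 0. Positivity matters twice:
    \<open>K\<close> is obtained by dividing by \<open>r\<close>, and for an infinite supremum the
    convention \<open>\<infinity> * 0 = 0\<close> would turn the claimed bound into 1.\<close>
  have r0: "0 < r"
  proof (rule ccontr)
    assume "\<not> 0 < r"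
    then have "z = 0" if "z \<in> \<Omega>" for z
      using order_trans[OF le_r[OF that], of 0] by simp
    then have "\<Omega> = {0}" using assms(3) by blast
    then show False using assms(1) not_open_singleton[of "0::complex^'n"] by simp
  qed
  have bdd_DF: "bdd_above (DF_exponents \<Omega>)"
    unfolding DF_exponents_def bdd_above_def by (intro exI[of _ 1]) auto
  have DF_ge: "\<eta> \<le> DF_C2 \<Omega>" if "\<eta> \<in> DF_exponents \<Omega>" for \<eta>
    using that cSup_upper[OF that bdd_DF] by (auto simp: DF_C2_def)
  have DF0: "0 \<le> DF_C2 \<Omega>"
  proof (cases "DF_exponents \<Omega> = {}")
    case False
    then obtain \<eta> where "\<eta> \<in> DF_exponents \<Omega>" by blast
    then show ?thesis using DF_ge[of \<eta>] by (auto simp: DF_exponents_def)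
  qed (simp add: DF_C2_def)
  show ?thesis
  proof (cases "alpha_sup \<Omega>")
    case (real A)
    have A0: "0 \<le> A" using alpha_sup_nonneg[OF assms(6)] real by simp
    define B where "B = 1 + 4 * sqrt 2 * A * r"
    have B: "1 \<le> B" using A0 r0 by (simp add: B_def)
    have "1 / B \<le> DF_C2 \<Omega>"
    \<comment> \<open>\<open>1 / B\<close> is approached from below: for \<open>A = 0\<close> it
      equals 1, which is excluded as an exponent.\<close>
    proof (rule dense_le_bounded[of 0])
      show "0 < 1 / B" using B by simp
      fix \<eta> assume eta: "0 < \<eta>" "\<eta> < 1 / B"
      then have "\<eta> * B < 1" using B by (simp add: field_simps)
      moreover have "\<eta> < 1" using eta(2) B by (meson divide_le_eq_1_pos less_le_trans less_trans zero_less_one order_less_le_trans)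
      ultimately show "\<eta> \<le> DF_C2 \<Omega>"
        using DF_exponent[OF assms(6) _ A0 r0 le_r eta(1)] real by (intro DF_ge) (simp add: B_def)
    qed
    moreover have "1 / (1 + 4 * ereal (sqrt 2) * alpha_sup \<Omega> * ereal r) = ereal (1 / B)"
      unfolding real using B by (simp add: B_def[symmetric] one_ereal_def)
    ultimately show ?thesis by simp
  next
    \<comment> \<open>The denominator is infinite, so the bound is 0 and nonnegativity of the index
      is enough.\<close>
    case PInf
    then show ?thesis using r0 DF0 by (simp add: zero_ereal_def)
  next
    case MInf
    then show ?thesis using alpha_sup_nonneg[OF assms(6)] by simp
  qed
qed

end
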